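(* The kernel $K_s^{\mathrm p}$ for the periodic Riesz $s$-energy associated with the lattice $\mathcal V$ is given by $$K_s^{\mathrm p}(x,y)=\zeta_{\mathcal V}(s;x-y)+\frac{2\pi^{d/2}}{\Gamma(\frac s2)(d-s)},\qquad s>0.$$ Furthermore, for $0<s<d$, $$\int_\Omega\int_\Omega K_s^{\mathrm p}(x,y)\,dx\,dy=\frac{2\pi^{d/2}}{\Gamma(\frac s2)(d-s)}.$$
   Context: Let $V$ be a real $d\times d$ matrix with linearly independent columns $v_1,\dots,v_d$ and $\det V=1$; $\mathcal V=\{Vk:k\in\mathbb Z^d\}$; $\mathcal V^*=\{w\in\mathbb R^d: w\cdot v\in\mathbb Z\ \forall v\in\mathcal V\}$; $\Omega=\{\sum_j\alpha_jv_j:\alpha_j\in[0,1)\}$. For $s>0$ let $d\mu_s(t)=\Gamma(s/2)^{-1}t^{s/2-1}\,dt$ on $(0,\infty)$ (so that $|q|^{-s}=\int_0^\infty e^{-|q|^2t}\,d\mu_s(t)$ for $q\ne0$). The periodic Riesz kernel is $$K_s^{\mathrm p}(x,y)=\sum_{v\in\mathcal V}\int_1^\infty e^{-|x-y+v|^2t}\,d\mu_s(t)+\sum_{w\in\mathcal V^*\setminus\{0\}}e^{2\pi i w\cdot(x-y)}\int_0^1\frac{\pi^{d/2}}{t^{d/2}}e^{-\pi^2|w|^2/t}\,d\mu_s(t),\qquad x,y\in\mathbb R^d.$$ The Epstein Hurwitz zeta function of $\mathcal V$ is $\zeta_{\mathcal V}(s;q)=\sum_{v\in\mathcal V}|q+v|^{-s}$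 for $s>d$ and $q\notin\mathcal V$; for fixed $q\in\mathbb R^d\setminus\mathcal V$ it is extended to other $s$ by analytic continuation, the function $s\mapsto\zeta_{\mathcal V}(s;q)-\frac{2\pi^{d/2}}{\Gamma(s/2)(s-d)}$ being entire. At $s=d$ the right-hand side of the first formula is understood as the value of this entire function. For $q\in\mathcal V$ one uses the convention $\zeta_{\mathcal V}(s;q)=\infty$. *)

theory Defs
  imports "HOL-Analysis.Analysis" "HOL-Complex_Analysis.Complex_Analysis"
begin

definition lattice_of :: "real^'d^'d \<Rightarrow> (real^'d) set" where
  "lattice_of V = {V *v k | k. \<forall>i. k $ i \<in> \<int>}"

definition dual_lattice :: "real^'d^'d \<Rightarrow> (real^'d) set" where
  "dual_lattice V = {w. \<forall>v\<in>lattice_of V. w \<bullet> v \<in> \<int>}"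

definition fundamental_domain :: "real^'d^'d \<Rightarrow> (real^'d) set" where
  "fundamental_domain V =
     {\<Sum>j\<in>UNIV. \<alpha> j *\<^sub>R column j V | \<alpha>. \<forall>j. \<alpha> j \<in> {0..<1}}"

definition riesz_measure :: "real \<Rightarrow> real measure" where
  "riesz_measure s =
     density lborel (\<lambda>t. ennreal (indicator {0<..} t * t powr (s/2 - 1) / Gamma (s/2)))"

text \<open>
  The kernel is split into its two series. The first has nonnegative terms and is summed in
  \<^typ>\<open>ennreal\<close>: it is infinite when \<open>x - y\<close> is a lattice point, since the
  summand with \<open>x - y + v = 0\<close> is the (infinite) mass of \<open>{1<..}\<close>.
\<close>

definition riesz_direct_sum :: "real^'d^'d \<Rightarrow> real \<Rightarrow> real^'d \<Rightarrow> real^'d \<Rightarrow> ennreal" where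
  "riesz_direct_sum V s x y =
     (\<Sum>\<^sub>\<infinity>v\<in>lattice_of V.
        \<integral>\<^sup>+t\<in>{1<..}. ennreal (exp (- (norm (x - y + v))\<^sup>2 * t)) \<partial>riesz_measure s)"

definition riesz_dual_sum :: "real^'d^'d \<Rightarrow> real \<Rightarrow> real^'d \<Rightarrow> real^'d \<Rightarrow> complex" where
  "riesz_dual_sum V s x y =
     (\<Sum>\<^sub>\<infinity>w\<in>dual_lattice V - {0}.
        exp (2 * complex_of_real pi * \<i> * complex_of_real (w \<bullet> (x - y))) *
        complex_of_real (LINT t:{0<..<1}|riesz_measure s.
          pi powr (real CARD('d) / 2) / t powr (real CARD('d) / 2) *
          exp (- pi\<^sup>2 * (norm w)\<^sup>2 / t)))"

text \<open>Taking the real part in the kernel loses nothing: the terms for \<open>w\<close> and \<open>- w\<close> are conjugate.\<close>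

lemma riesz_dual_sum_real: "riesz_dual_sum V s x y \<in> \<real>"
proof -
  let ?D = "dual_lattice V - {0}"
  have bij: "bij_betw uminus ?D ?D"
    by (rule bij_betwI[where g = uminus]) (auto simp: dual_lattice_def)
  have "cnj (riesz_dual_sum V s x y) = riesz_dual_sum V s x y"
    unfolding riesz_dual_sum_def infsum_cnj[symmetric]
    by (subst infsum_reindex_bij_betw[OF bij, symmetric]) (simp add: exp_cnj)
  then show ?thesis
    by (simp add: complex_is_Real_iff complex_eq_iff)
qed

definition periodic_riesz_kernel ::
    "real^'d^'d \<Rightarrow> real \<Rightarrow> real^'d \<Rightarrow> real^'d \<Rightarrow> ereal" where
  "periodic_riesz_kernel V s x y =
     enn2ereal (riesz_direct_sum V s x y) + ereal (Re (riesz_dual_sum V s x y))"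

definition epstein_hurwitz_series :: "real^'d^'d \<Rightarrow> real \<Rightarrow> real^'d \<Rightarrow> real" where
  "epstein_hurwitz_series V s q = (\<Sum>\<^sub>\<infinity>v\<in>lattice_of V. norm (q + v) powr (- s))"

definition is_epstein_hurwitz_entire ::
    "real^'d^'d \<Rightarrow> real^'d \<Rightarrow> (complex \<Rightarrow> complex) \<Rightarrow> bool" where
  "is_epstein_hurwitz_entire V q F \<longleftrightarrow>
     F holomorphic_on UNIV \<and>
     (\<forall>s > real CARD('d).
        F (complex_of_real s) =
        complex_of_real (epstein_hurwitz_series V s q -
          2 * pi powr (real CARD('d) / 2) / (Gamma (s/2) * (s - real CARD('d)))))"

lemma is_epstein_hurwitz_entire_unique:
  fixes V :: "real^'d^'d"
  assumes "is_epstein_hurwitz_entire V q F" "is_epstein_hurwitz_entire V q G"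
  shows "F = G"
proof -
  let ?d = "real CARD('d)"
  let ?U = "complex_of_real ` {?d<..}"
  have lim: "complex_of_real (?d + 1) islimpt ?U"
    unfolding islimpt_approachable
  proof (intro allI impI)
    fix e :: real assume "e > 0"
    then show "\<exists>x'\<in>?U. x' \<noteq> complex_of_real (?d + 1) \<and> dist x' (complex_of_real (?d + 1)) < e"
      by (intro bexI[of _ "complex_of_real (?d + 1 + e/2)"])
         (auto simp: dist_norm simp del: of_real_add simp flip: of_real_diff)
  qed
  have "F z - G z = 0" for z
    by (rule analytic_continuation[of "\<lambda>z. F z - G z" UNIV ?U, OF _ _ _ _ _ lim])
       (use assms in \<open>auto simp: is_epstein_hurwitz_entire_def intro!: holomorphic_intros\<close>)
  then show ?thesis by auto
qed

definition epstein_hurwitz_entire :: "real^'d^'d \<Rightarrow> real^'d \<Rightarrow> complex \<Rightarrow> complex" where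
  "epstein_hurwitz_entire V q = (THE F. is_epstein_hurwitz_entire V q F)"

text \<open>Hence the entire function is real on the real axis, and the real parts taken below are exact.\<close>

lemma epstein_hurwitz_entire_real:
  assumes "is_epstein_hurwitz_entire V q F"
  shows "epstein_hurwitz_entire V q = F" and "F (complex_of_real s) \<in> \<real>"
proof -
  show "epstein_hurwitz_entire V q = F"
    unfolding epstein_hurwitz_entire_def
    using assms is_epstein_hurwitz_entire_unique by blast
  have "is_epstein_hurwitz_entire V q (cnj \<circ> F \<circ> cnj)"
    using assms holomorphic_on_compose_cnj_cnj[of F UNIV]
    by (auto simp: is_epstein_hurwitz_entire_def image_cnj_conv_vimage_cnj)
  from is_epstein_hurwitz_entire_unique[OF assms this]
  have "F (complex_of_real s) = cnj (F (complex_of_real s))"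
    by (metis comp_apply complex_cnj_complex_of_real)
  then show "F (complex_of_real s) \<in> \<real>"
    by (simp add: complex_is_Real_iff complex_eq_iff)
qed

text \<open>
  The zeta function has a pole at \<open>s = d\<close> for \<open>q\<close> off the lattice, so its value there is
  meaningless. At that parameter \<open>epstein_hurwitz_regular\<close> is the value of the entire function, with
  the same convention \<open>\<infinity>\<close> on the lattice.
\<close>

definition epstein_hurwitz_zeta :: "real^'d^'d \<Rightarrow> real \<Rightarrow> real^'d \<Rightarrow> ereal" where
  "epstein_hurwitz_zeta V s q =
     (if q \<in> lattice_of V then \<infinity>
      else if s > real CARD('d) then ereal (epstein_hurwitz_series V s q)
      else ereal (Re (epstein_hurwitz_entire V q (complex_of_real s)) +
             2 * pi powr (real CARD('d) / 2) / (Gamma (s/2) * (s - real CARD('d)))))"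

definition epstein_hurwitz_regular :: "real^'d^'d \<Rightarrow> real \<Rightarrow> real^'d \<Rightarrow> ereal" where
  "epstein_hurwitz_regular V s q =
     (if q \<in> lattice_of V then \<infinity>
      else ereal (Re (epstein_hurwitz_entire V q (complex_of_real s))))"

end

theory Submission
  imports Defs "HOL-Probability.Characteristic_Functions" "HOL-Real_Asymp.Real_Asymp"
begin

text \<open>
  Poisson summation for Gaussians turns the theta function \<open>\<theta> t q\<close>, the sum of
  \<open>exp (- t |q + v|\<^sup>2)\<close> over the lattice, into \<open>(\<pi> / t)\<^bsup>d/2\<^esup>\<close> times a sum over the dual
  lattice, whose term at \<open>0\<close> is constant in \<open>q\<close>. Hence the two series of the kernel are the parts
  \<open>t > 1\<close> and \<open>t < 1\<close> of a single Mellin integral of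
  \<open>\<phi> t q = \<theta> t q - [t < 1] (\<pi> / t)\<^bsup>d/2\<^esup>\<close>. For \<open>q\<close> off the lattice \<open>\<phi>\<close> decays
  exponentially at \<open>0\<close> and \<open>\<infinity>\<close>, so the integral is entire in \<open>s\<close>; for \<open>s > d\<close> the removed term
  integrates to the polar part of the zeta function. For the mean value, the dual series integrates
  to zero over \<open>\<Omega>\<close>, and the direct series unfolds to the integral of one Gaussian over the
  whole space.

  Poisson summation itself rests on the uniqueness of Fourier coefficients on the torus: if \<open>f\<close> has
  vanishing coefficients but \<open>f x\<^sub>0 \<noteq> 0\<close>, integrate \<open>f\<close> against high powers of a trigonometric
  polynomial that peaks exactly at \<open>x\<^sub>0 + L\<close>.
\<close>

section \<open>Sums and integrals\<close>

text \<open>Two kinds of series need two kinds of care. The direct series is infinite on the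
  lattice, so it is handled in \<open>ennreal\<close>, where Tonelli needs no finiteness, and real
  summability is read off afterwards from a finite integral. The series over the dual lattice
  oscillates, but its absolute values \<open>gauss_hat\<close> and \<open>dual_coeff\<close> do not
  depend on the point, so one dominated argument covers all points, on the lattice or off it. The
  zeta function is the reciprocal Gamma factor times a Mellin transform at s/2. Because
  \<open>rGamma\<close> is entire, the continuation is read off directly, with no functional
  equation. The constant of the theorem has one source, the zero frequency (pi/t)^(d/2), which is
  also the mean of \<theta> over \<Omega>. Its weighted integral over (0,1), finite for s > d, is
  the polar part of the zeta function; over (1,\<infinity>), finite for s < d, it is the mean of the
  kernel. The two values differ only in sign as expressions in s. The hypothesis det V = 1 enters
  through the volume of \<Omega>, so no covolume factor appears on either side of Poisson
  summation.\<close>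

lemma nn_integral_count_space_eq_infsum:
  fixes f :: "'a \<Rightarrow> ennreal"
  assumes "countable A"
  shows "(\<integral>\<^sup>+x. f x \<partial>count_space A) = (\<Sum>\<^sub>\<infinity>x\<in>A. f x)"
proof (cases "finite A")
  case True
  then show ?thesis by (simp add: nn_integral_count_space_finite)
next
  case False
  note bij = bij_betw_from_nat_into[OF assms False]
  have "(\<integral>\<^sup>+x. f x \<partial>count_space A) = (\<Sum>n. f (from_nat_into A n))"
    using nn_integral_bij_count_space[OF bij, of f] by (simp add: nn_integral_count_space_nat)
  also have "\<dots> = (\<Sum>\<^sub>\<infinity>n. f (from_nat_into A n))"
    by (rule sums_unique[symmetric, OF has_sum_imp_sums])
      (rule has_sum_infsum, rule nonneg_summable_on_complete, simp)
  also have "\<dots> = (\<Sum>\<^sub>\<infinity>x\<in>A. f x)"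
    by (rule infsum_reindex_bij_betw[OF bij])
  finally show ?thesis .
qed

text \<open>A sum over a countable set is an integral against the counting measure, so this and the
  two interchange lemmas below are instances of Tonelli and Fubini.\<close>

lemma borel_measurable_infsum_ennreal:
  fixes f :: "'i \<Rightarrow> 'a \<Rightarrow> ennreal"
  assumes I: "countable I" and f: "\<And>i. i \<in> I \<Longrightarrow> f i \<in> borel_measurable M"
  shows "(\<lambda>x. \<Sum>\<^sub>\<infinity>i\<in>I. f i x) \<in> borel_measurable M"
proof -
  interpret sigma_finite_measure "count_space I"
    by (rule sigma_finite_measure_count_space_countable[OF I])
  have "(\<lambda>(i, x). f i x) \<in> borel_measurable (count_space I \<Otimes>\<^sub>M M)"
    by (rule measurable_pair_measure_countable1[OF I]) (simp add: f)
  then have "(\<lambda>(x, i). f i x) \<in> borel_measurable (M \<Otimes>\<^sub>M count_space I)"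
    by (subst measurable_pair_swap_iff) (simp add: case_prod_unfold)
  from borel_measurable_nn_integral[OF this] show ?thesis
    by (simp add: nn_integral_count_space_eq_infsum[OF I])
qed

lemma nn_integral_infsum:
  fixes f :: "'i \<Rightarrow> 'a \<Rightarrow> ennreal"
  assumes I: "countable I" and f: "\<And>i. i \<in> I \<Longrightarrow> f i \<in> borel_measurable M"
  shows "(\<integral>\<^sup>+x. (\<Sum>\<^sub>\<infinity>i\<in>I. f i x) \<partial>M) = (\<Sum>\<^sub>\<infinity>i\<in>I. \<integral>\<^sup>+x. f i x \<partial>M)"
  using nn_integral_count_space_nn_integral[OF I f]
  by (simp add: nn_integral_count_space_eq_infsum[OF I])

text \<open>Fubini with the counting measure. \<open>summ\<close> gives integrability on the
  product; \<open>abs\<close> identifies the sum with the counting integral at every point, leaving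
  no exceptional set.\<close>

lemma integral_infsum:
  fixes f :: "'i \<Rightarrow> 'a \<Rightarrow> 'b::{banach, second_countable_topology}"
  assumes M: "sigma_finite_measure M" and I: "countable I"
    and f: "\<And>i. i \<in> I \<Longrightarrow> integrable M (f i)"
    and abs: "\<And>x. x \<in> space M \<Longrightarrow> (\<lambda>i. norm (f i x)) summable_on I"
    and summ: "(\<lambda>i. \<integral>x. norm (f i x) \<partial>M) summable_on I"
  shows "(\<integral>x. (\<Sum>\<^sub>\<infinity>i\<in>I. f i x) \<partial>M) = (\<Sum>\<^sub>\<infinity>i\<in>I. \<integral>x. f i x \<partial>M)"
proof -
  interpret pair_sigma_finite "count_space I" M
    by (intro pair_sigma_finite.intro sigma_finite_measure_count_space_countable I M)
  have meas: "(\<lambda>(i, x). f i x) \<in> borel_measurable (count_space I \<Otimes>\<^sub>M M)"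
    by (rule measurable_pair_measure_countable1[OF I]) (use f in auto)
  have summ': "Infinite_Set_Sum.abs_summable_on (\<lambda>i. \<integral>x. norm (f i x) \<partial>M) I"
    using summ by (subst abs_summable_equivalent[symmetric]) simp
  have int: "integrable (count_space I \<Otimes>\<^sub>M M) (\<lambda>(i, x). f i x)"
    using summ' f by (intro Fubini_integrable meas) (auto simp: abs_summable_on_def AE_count_space)
  have eq: "(\<integral>i. f i x \<partial>count_space I) = (\<Sum>\<^sub>\<infinity>i\<in>I. f i x)" if "x \<in> space M" for x
    using infsetsum_infsum[of "\<lambda>i. f i x" I] abs[OF that]
    by (simp add: infsetsum_def abs_summable_equivalent)
  have "Infinite_Set_Sum.abs_summable_on (\<lambda>i. \<integral>x. f i x \<partial>M) I"
    unfolding abs_summable_equivalent[symmetric]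
    by (rule summable_on_comparison_test[OF summ]) auto
  then have "(\<integral>i. (\<integral>x. f i x \<partial>M) \<partial>count_space I) = (\<Sum>\<^sub>\<infinity>i\<in>I. \<integral>x. f i x \<partial>M)"
    using infsetsum_infsum by (simp add: infsetsum_def)
  moreover have "(\<integral>x. (\<integral>i. f i x \<partial>count_space I) \<partial>M) = (\<integral>i. (\<integral>x. f i x \<partial>M) \<partial>count_space I)"
    by (rule Fubini_integral[OF int])
  moreover have "(\<integral>x. (\<integral>i. f i x \<partial>count_space I) \<partial>M) = (\<integral>x. (\<Sum>\<^sub>\<infinity>i\<in>I. f i x) \<partial>M)"
    by (rule Bochner_Integration.integral_cong) (simp_all add: eq)
  ultimately show "(\<integral>x. (\<Sum>\<^sub>\<infinity>i\<in>I. f i x) \<partial>M) = (\<Sum>\<^sub>\<infinity>i\<in>I. \<integral>x. f i x \<partial>M)"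
    by simp
qed

text \<open>Expanding the exponential and integrating term by term gives a power series about 0 that
  converges for every z. The moments of exp (r |X|) for all r are what dominates the series of
  norms.\<close>

lemma holomorphic_integral_exp:
  fixes \<phi> :: "'a \<Rightarrow> complex" and X :: "'a \<Rightarrow> real"
  assumes [measurable]: "\<phi> \<in> borel_measurable M" "X \<in> borel_measurable M"
    and int: "\<And>r. integrable M (\<lambda>x. norm (\<phi> x) * exp (r * \<bar>X x\<bar>))"
  shows "(\<lambda>z. \<integral>x. \<phi> x * exp (z * of_real (X x)) \<partial>M) holomorphic_on UNIV"
proof -
  define a where "a n = (\<integral>x. \<phi> x * of_real (X x) ^ n / fact n \<partial>M)" for n :: nat
  have "(\<lambda>n. a n * (z - 0) ^ n) sums (\<integral>x. \<phi> x * exp (z * of_real (X x)) \<partial>M)" for z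
  proof -
    define f where "f n x = \<phi> x * (z * of_real (X x)) ^ n / fact n" for n x
    have [measurable]: "f n \<in> borel_measurable M" for n
      unfolding f_def by measurable
    have exps: "(\<lambda>n. (norm z * \<bar>X x\<bar>) ^ n / fact n) sums exp (norm z * \<bar>X x\<bar>)" for x
      using exp_converges[of "norm z * \<bar>X x\<bar>"] by (simp add: divide_inverse mult.commute)
    have nf: "norm (f n x) = norm (\<phi> x) * ((norm z * \<bar>X x\<bar>) ^ n / fact n)" for n x
      by (simp add: f_def norm_mult norm_divide norm_power power_mult_distrib)
    have nsums: "(\<lambda>n. norm (f n x)) sums (norm (\<phi> x) * exp (norm z * \<bar>X x\<bar>))" for x
      unfolding nf by (intro sums_mult exps)
    have part: "(\<Sum>n<N. norm (f n x)) \<le> norm (\<phi> x) * exp (norm z * \<bar>X x\<bar>)" for N x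
      using sum_le_suminf[OF sums_summable[OF nsums], of "{..<N}" x] sums_unique[OF nsums] by simp
    have one: "norm (f n x) \<le> norm (\<phi> x) * exp (norm z * \<bar>X x\<bar>)" for n x
      using part[where N = "Suc n" and x = x] sum_nonneg[of "{..<n}" "\<lambda>n. norm (f n x)"] by simp
    have fi: "integrable M (f n)" for n
      by (rule Bochner_Integration.integrable_bound[OF int[of "norm z"]])
         (use one in \<open>auto simp: abs_mult\<close>)
    have "summable (\<lambda>n. \<integral>x. norm (f n x) \<partial>M)"
    proof (rule summableI_nonneg_bounded)
      fix N
      have "(\<Sum>n<N. \<integral>x. norm (f n x) \<partial>M) = (\<integral>x. (\<Sum>n<N. norm (f n x)) \<partial>M)"
        by (rule Bochner_Integration.integral_sum[symmetric]) (use fi in auto)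
      also have "\<dots> \<le> (\<integral>x. norm (\<phi> x) * exp (norm z * \<bar>X x\<bar>) \<partial>M)"
        by (rule integral_mono) (use fi int part in auto)
      finally show "(\<Sum>n<N. \<integral>x. norm (f n x) \<partial>M) \<le> \<dots>" .
    qed auto
    then have "(\<lambda>n. integral\<^sup>L M (f n)) sums (\<integral>x. (\<Sum>n. f n x) \<partial>M)"
      by (intro sums_integral fi) (auto intro: sums_summable[OF nsums])
    moreover have "(\<Sum>n. f n x) = \<phi> x * exp (z * of_real (X x))" for x
    proof -
      have "(\<lambda>n. \<phi> x * ((z * of_real (X x)) ^ n /\<^sub>R fact n)) sums (\<phi> x * exp (z * of_real (X x)))"
        by (intro sums_mult exp_converges)
      then show ?thesis
        by (simp add: f_def sums_iff scaleR_conv_of_real divide_inverse mult_ac)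
    qed
    moreover have "integral\<^sup>L M (f n) = a n * (z - 0) ^ n" for n
    proof -
      have "f n = (\<lambda>x. z ^ n * (\<phi> x * of_real (X x) ^ n / fact n))"
        by (auto simp: f_def power_mult_distrib)
      then show ?thesis by (simp add: a_def)
    qed
    ultimately show ?thesis by simp
  qed
  then have "(\<lambda>z. \<integral>x. \<phi> x * exp (z * of_real (X x)) \<partial>M) holomorphic_on ball 0 r" for r
    by (intro power_series_holomorphic[where a = a]) auto
  then show ?thesis
    by (meson UNIV_I centre_in_ball holomorphic_on_def holomorphic_on_subset
        holomorphic_on_imp_differentiable_at open_ball mem_ball_0 gt_ex
        field_differentiable_at_within)
qed

section \<open>Linear change of variables\<close>

no_notation fps_nth (infixl "$" 75)

text \<open>Singles out one coordinate by Fubini, so that a shear can be treated line by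
  line.\<close>

lemma nn_integral_lborel_coordinate_split:
  fixes g :: "'a::euclidean_space \<Rightarrow> ennreal"
  assumes [measurable]: "g \<in> borel_measurable borel" and b: "b \<in> Basis"
  shows "(\<integral>\<^sup>+x. g x \<partial>lborel)
       = (\<integral>\<^sup>+y. (\<integral>\<^sup>+t. g ((\<Sum>j\<in>Basis - {b}. y j *\<^sub>R j) + t *\<^sub>R b) \<partial>lborel) \<partial>Pi\<^sub>M (Basis - {b}) (\<lambda>_. lborel))"
proof -
  interpret product_sigma_finite "\<lambda>_::'a. lborel :: real measure" ..
  have ins: "insert b (Basis - {b}) = (Basis :: 'a set)" using b by auto
  have [measurable]: "(\<lambda>f. g (\<Sum>j\<in>Basis. f j *\<^sub>R j)) \<in> borel_measurable (Pi\<^sub>M (insert b (Basis - {b})) (\<lambda>_. lborel :: real measure))"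
    unfolding ins by measurable
  have eq: "(\<Sum>j\<in>Basis. (y(b := t)) j *\<^sub>R j) = (\<Sum>j\<in>Basis - {b}. y j *\<^sub>R j) + t *\<^sub>R b" for y :: "'a \<Rightarrow> real" and t
  proof -
    have "(\<Sum>j\<in>Basis. (y(b := t)) j *\<^sub>R j) = (\<Sum>j\<in>insert b (Basis - {b}). (y(b := t)) j *\<^sub>R j)"
      by (simp only: ins)
    also have "\<dots> = t *\<^sub>R b + (\<Sum>j\<in>Basis - {b}. (y(b := t)) j *\<^sub>R j)"
      by (subst sum.insert) auto
    also have "(\<Sum>j\<in>Basis - {b}. (y(b := t)) j *\<^sub>R j) = (\<Sum>j\<in>Basis - {b}. y j *\<^sub>R j)"
      by (rule sum.cong) auto
    finally show ?thesis by (simp add: add.commute)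
  qed
  have "(\<integral>\<^sup>+x. g x \<partial>lborel) = (\<integral>\<^sup>+f. g (\<Sum>j\<in>Basis. f j *\<^sub>R j) \<partial>Pi\<^sub>M (insert b (Basis - {b})) (\<lambda>_. lborel))"
    unfolding ins by (subst lborel_eq) (simp add: nn_integral_distr)
  also have "\<dots> = (\<integral>\<^sup>+y. (\<integral>\<^sup>+t. g (\<Sum>j\<in>Basis. (y(b := t)) j *\<^sub>R j) \<partial>lborel) \<partial>Pi\<^sub>M (Basis - {b}) (\<lambda>_. lborel))"
    by (rule product_nn_integral_insert) auto
  finally show ?thesis unfolding eq .
qed

text \<open>On each line in direction \<open>b\<close> the number \<open>x \<bullet> c\<close> is
  constant, because \<open>c\<close> is another basis vector. The shear therefore acts on the line
  as a translation.\<close>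

lemma nn_integral_lborel_shear:
  fixes g :: "'a::euclidean_space \<Rightarrow> ennreal"
  assumes [measurable]: "g \<in> borel_measurable borel" and b: "b \<in> Basis" and c: "c \<in> Basis" "c \<noteq> b"
  shows "(\<integral>\<^sup>+x. g (x + (x \<bullet> c) *\<^sub>R b) \<partial>lborel) = (\<integral>\<^sup>+x. g x \<partial>lborel)"
proof -
  have c': "((\<Sum>j\<in>Basis - {b}. y j *\<^sub>R j) + t *\<^sub>R b) \<bullet> c = y c" for y :: "'a \<Rightarrow> real" and t
  proof -
    have "(\<Sum>j\<in>Basis - {b}. y j *\<^sub>R j) \<bullet> c = (\<Sum>j\<in>Basis - {b}. if j = c then y c else 0)"
      unfolding inner_sum_left by (rule sum.cong) (use c in \<open>auto simp: inner_Basis\<close>)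
    also have "\<dots> = y c" using c by simp
    finally show ?thesis using b c by (simp add: inner_add_left inner_Basis)
  qed
  have "(\<integral>\<^sup>+x. g (x + (x \<bullet> c) *\<^sub>R b) \<partial>lborel)
      = (\<integral>\<^sup>+y. (\<integral>\<^sup>+t. g ((\<Sum>j\<in>Basis - {b}. y j *\<^sub>R j) + (y c + 1 * t) *\<^sub>R b) \<partial>lborel) \<partial>Pi\<^sub>M (Basis - {b}) (\<lambda>_. lborel))"
    by (subst nn_integral_lborel_coordinate_split[OF _ b], measurable)
       (simp only: c', simp only: scaleR_add_left add_ac mult_1)
  also have "\<dots> = (\<integral>\<^sup>+y. (\<integral>\<^sup>+t. g ((\<Sum>j\<in>Basis - {b}. y j *\<^sub>R j) + t *\<^sub>R b) \<partial>lborel) \<partial>Pi\<^sub>M (Basis - {b}) (\<lambda>_. lborel))"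
  proof (rule nn_integral_cong)
    fix y :: "'a \<Rightarrow> real"
    let ?h = "\<lambda>t. g ((\<Sum>j\<in>Basis - {b}. y j *\<^sub>R j) + t *\<^sub>R b)"
    have "(\<integral>\<^sup>+t. ?h t \<partial>lborel) = ennreal \<bar>1\<bar> * (\<integral>\<^sup>+t. ?h (y c + 1 * t) \<partial>lborel)"
      by (rule nn_integral_real_affine) auto
    then show "(\<integral>\<^sup>+t. ?h (y c + 1 * t) \<partial>lborel) = (\<integral>\<^sup>+t. ?h t \<partial>lborel)" by simp
  qed
  also have "\<dots> = (\<integral>\<^sup>+x. g x \<partial>lborel)"
    by (rule nn_integral_lborel_coordinate_split[OF _ b, symmetric]) measurable
  finally show ?thesis .
qed

lemma measurable_matrix_vector_mult [measurable]: "(*v) (A :: real^'n^'m) \<in> borel_measurable borel"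
  by (intro borel_measurable_continuous_onI matrix_vector_mult_linear_continuous_on)

lemma prod_Basis_cart: "(\<Prod>b\<in>Basis. h (b :: real^'n)) = (\<Prod>i\<in>UNIV. h (axis i 1))"
proof -
  have "bij_betw (\<lambda>i. axis i 1) UNIV (Basis :: (real^'n) set)"
    by (auto simp: bij_betw_def inj_on_def axis_eq_axis Basis_vec_def)
  from prod.reindex_bij_betw[OF this, of h] show ?thesis by simp
qed

text \<open>Proved from scratch because \<open>measure_linear_image\<close> and the change of variables theorems of
  \<^theory>\<open>HOL-Analysis.Change_Of_Vars\<close> require a well-ordered index type.\<close>

theorem nn_integral_linear_change:
  fixes A :: "real^'n^'n"
  assumes "det A \<noteq> 0" and "g \<in> borel_measurable borel"
  shows "ennreal \<bar>det A\<bar> * (\<integral>\<^sup>+x. g (A *v x) \<partial>lborel) = (\<integral>\<^sup>+x. g x \<partial>lborel)"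
proof -
  \<comment> \<open>The determinant condition sits inside \<open>P\<close> so that the induction can
    run over all matrices: a zero row makes \<open>P\<close> vacuous, and a nonsingular product has
    nonsingular factors.\<close>
  define P where "P A \<longleftrightarrow> (det A \<noteq> 0 \<longrightarrow> (\<forall>g\<in>borel_measurable borel.
    ennreal \<bar>det A\<bar> * (\<integral>\<^sup>+x. g (A *v x) \<partial>lborel) = (\<integral>\<^sup>+x. g x \<partial>lborel)))" for A :: "real^'n^'n"
  have "P A"
  proof (rule induct_matrix_elementary_alt)
    fix A B :: "real^'n^'n"
    assume A: "P A" and B: "P B"
    show "P (A ** B)"
      unfolding P_def
    proof (intro impI ballI)
      fix g :: "real^'n \<Rightarrow> ennreal"
      assume "det (A ** B) \<noteq> 0" and [measurable]: "g \<in> borel_measurable borel"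
      then have d: "det A \<noteq> 0" "det B \<noteq> 0" by (auto simp: det_mul)
      have "ennreal \<bar>det (A ** B)\<bar> * (\<integral>\<^sup>+x. g ((A ** B) *v x) \<partial>lborel)
          = ennreal \<bar>det A\<bar> * (ennreal \<bar>det B\<bar> * (\<integral>\<^sup>+x. g (A *v (B *v x)) \<partial>lborel))"
        by (simp add: det_mul abs_mult ennreal_mult' mult.assoc matrix_vector_mul_assoc)
      also have "ennreal \<bar>det B\<bar> * (\<integral>\<^sup>+x. g (A *v (B *v x)) \<partial>lborel) = (\<integral>\<^sup>+x. g (A *v x) \<partial>lborel)"
        using B[unfolded P_def, rule_format, OF d(2), of "\<lambda>y. g (A *v y)"] by simp
      also have "ennreal \<bar>det A\<bar> * \<dots> = (\<integral>\<^sup>+x. g x \<partial>lborel)"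
        using A d by (simp add: P_def)
      finally show "ennreal \<bar>det (A ** B)\<bar> * (\<integral>\<^sup>+x. g ((A ** B) *v x) \<partial>lborel) = (\<integral>\<^sup>+x. g x \<partial>lborel)" .
    qed
  next
    fix A :: "real^'n^'n" and i assume "row i A = 0"
    then show "P A" by (simp add: P_def det_zero_row)
  next
    fix A :: "real^'n^'n"
    assume diag: "\<And>i j. i \<noteq> j \<Longrightarrow> A $ i $ j = 0"
    show "P A"
      unfolding P_def
    proof (intro impI ballI)
      fix g :: "real^'n \<Rightarrow> ennreal"
      assume "det A \<noteq> 0" and [measurable]: "g \<in> borel_measurable borel"
      then have nz: "A $ i $ i \<noteq> 0" for i by (auto simp: det_diagonal diag)
      define c where "c j = j \<bullet> (A *v j)" for j :: "real^'n"
      have c: "c (axis i 1) = A $ i $ i" for i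
        by (simp add: c_def inner_axis' matrix_vector_mult_basis column_def)
      have Basis: "Basis = range (\<lambda>i. axis i (1::real) :: real^'n)"
        by (auto simp: Basis_vec_def)
      have inj: "inj (\<lambda>i. axis i (1::real) :: real^'n)"
        by (auto simp: inj_on_def axis_eq_axis)
      have T: "A *v x = 0 + (\<Sum>j\<in>Basis. (c j * (x \<bullet> j)) *\<^sub>R j)" for x
      proof -
        have "(A *v x) $ i = A $ i $ i * x $ i" for i
        proof -
          have "(A *v x) $ i = (\<Sum>j\<in>UNIV. if j = i then A $ i $ i * x $ i else 0)"
            unfolding matrix_vector_mult_def vec_lambda_beta by (rule sum.cong) (auto simp: diag)
          then show ?thesis by simp
        qed
        moreover have "(\<Sum>j\<in>Basis. (c j * (x \<bullet> j)) *\<^sub>R j) = (\<Sum>i\<in>UNIV. (A $ i $ i * x $ i) *\<^sub>R axis i 1)"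
          unfolding Basis by (subst sum.reindex[OF inj]) (simp add: c inner_axis)
        moreover have "(\<Sum>i\<in>UNIV. (A $ i $ i * x $ i) *\<^sub>R axis i (1::real)) $ k = A $ k $ k * x $ k" for k
        proof -
          have "(\<Sum>i\<in>UNIV. (A $ i $ i * x $ i) *\<^sub>R axis i (1::real)) $ k = (\<Sum>i\<in>UNIV. if i = k then A $ k $ k * x $ k else 0)"
            unfolding sum_component by (rule sum.cong) (auto simp: axis_def)
          then show ?thesis by simp
        qed
        ultimately show ?thesis by (simp add: vec_eq_iff)
      qed
      have "det A = (\<Prod>i\<in>UNIV. A $ i $ i)" by (rule det_diagonal) (rule diag)
      also have "\<dots> = (\<Prod>j\<in>Basis. c j)"
        by (simp add: prod_Basis_cart c)
      finally have det: "\<bar>det A\<bar> = (\<Prod>j\<in>Basis. \<bar>c j\<bar>)" by (simp add: abs_prod)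
      have "(\<integral>\<^sup>+x. g x \<partial>lborel)
          = (\<integral>\<^sup>+x. g x \<partial>density (distr lborel borel (\<lambda>x. 0 + (\<Sum>j\<in>Basis. (c j * (x \<bullet> j)) *\<^sub>R j))) (\<lambda>_. (\<Prod>j\<in>Basis. \<bar>c j\<bar>)))"
        by (subst lborel_affine_euclidean[of c 0]) (auto simp: Basis c nz)
      also have "\<dots> = (\<Prod>j\<in>Basis. \<bar>c j\<bar>) * (\<integral>\<^sup>+x. g (A *v x) \<partial>lborel)"
        unfolding T[symmetric]
        by (subst nn_integral_density) (auto simp: nn_integral_distr nn_integral_cmult)
      finally show "ennreal \<bar>det A\<bar> * (\<integral>\<^sup>+x. g (A *v x) \<partial>lborel) = (\<integral>\<^sup>+x. g x \<partial>lborel)"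
        by (simp add: det)
    qed
  next
    fix m n :: 'n assume mn: "m \<noteq> n"
    let ?\<tau> = "Transposition.transpose m n"
    let ?A = "(\<chi> i j. mat 1 $ i $ ?\<tau> j) :: real^'n^'n"
    have A: "?A *v x = (\<chi> i. x $ ?\<tau> i)" for x
    proof -
      have "(\<Sum>j\<in>UNIV. (if i = ?\<tau> j then 1 else 0) * x $ j) = (\<Sum>j\<in>UNIV. if j = ?\<tau> i then x $ ?\<tau> i else 0)" for i
        by (rule sum.cong) auto
      then show ?thesis by (simp add: matrix_vector_mult_def mat_def vec_eq_iff)
    qed
    \<comment> \<open>The swap is an involution, so its determinant squares to 1 and the sign can be
      ignored.\<close>
    have "(?A ** ?A) *v x = mat 1 *v x" for x
      by (simp add: A flip: matrix_vector_mul_assoc)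
    then have "?A ** ?A = mat 1" by (subst matrix_eq) blast
    then have "det ?A * det ?A = 1" by (metis det_I det_mul)
    then have det: "\<bar>det ?A\<bar> = 1" by (simp only: abs_square_eq_1 flip: power2_eq_square)
    \<comment> \<open>Lebesgue measure is determined by boxes; swapping two coordinates permutes the
      side lengths of a box.\<close>
    have "distr lborel borel ((*v) ?A) = lborel"
    proof (rule lborel_eqI[symmetric])
      fix l u :: "real^'n"
      assume lu: "\<And>b. b \<in> Basis \<Longrightarrow> l \<bullet> b \<le> u \<bullet> b"
      have lu': "l $ i \<le> u $ i" for i
        using lu[of "axis i 1"] by (simp add: inner_axis)
      have "(*v) ?A -` box l u = box (\<chi> i. l $ ?\<tau> i) (\<chi> i. u $ ?\<tau> i)"
        unfolding set_eq_iff vimage_eq mem_box_cart A by (auto, (metis transpose_involutory)+)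
      then have "emeasure (distr lborel borel ((*v) ?A)) (box l u) = emeasure lborel (box (\<chi> i. l $ ?\<tau> i) (\<chi> i. u $ ?\<tau> i))"
        by (simp add: emeasure_distr)
      also have "\<dots> = (\<Prod>b\<in>Basis. ((\<chi> i. u $ ?\<tau> i) - (\<chi> i. l $ ?\<tau> i)) \<bullet> b)"
        by (rule emeasure_lborel_box) (auto simp: Basis_vec_def inner_axis lu')
      also have "(\<Prod>b\<in>Basis. ((\<chi> i. u $ ?\<tau> i) - (\<chi> i. l $ ?\<tau> i)) \<bullet> b) = (\<Prod>i\<in>UNIV. u $ ?\<tau> i - l $ ?\<tau> i)"
        by (subst prod_Basis_cart) (simp add: inner_axis)
      also have "\<dots> = (\<Prod>i\<in>UNIV. u $ i - l $ i)"
        by (rule prod.reindex_bij_witness[where i = ?\<tau> and j = ?\<tau>]) auto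
      also have "\<dots> = (\<Prod>b\<in>Basis. (u - l) \<bullet> b)"
        by (subst prod_Basis_cart) (simp add: inner_axis)
      finally show "emeasure (distr lborel borel ((*v) ?A)) (box l u) = ennreal (\<Prod>b\<in>Basis. (u - l) \<bullet> b)" .
    qed simp
    then have "(\<integral>\<^sup>+x. g (?A *v x) \<partial>lborel) = (\<integral>\<^sup>+x. g x \<partial>lborel)" if "g \<in> borel_measurable borel" for g :: "real^'n \<Rightarrow> ennreal"
      using nn_integral_distr[of "(*v) ?A" lborel borel g] that measurable_matrix_vector_mult[of ?A] by simp
    then show "P ?A" by (simp add: P_def det)
  next
    fix m n :: 'n assume mn: "m \<noteq> n"
    let ?A = "(\<chi> i j. of_bool (i = m \<and> j = n \<or> i = j)) :: real^'n^'n"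
    have A: "?A *v x = x + (x \<bullet> axis n 1) *\<^sub>R axis m 1" for x
    proof -
      have "(\<Sum>j\<in>UNIV. of_bool (i = m \<and> j = n \<or> i = j) * x $ j)
          = (\<Sum>j\<in>UNIV. (if j = i then x $ i else 0) + (if j = n then of_bool (i = m) * x $ n else 0))" for i
        using mn by (intro sum.cong) auto
      then show ?thesis
        unfolding inner_axis by (simp add: matrix_vector_mult_def vec_eq_iff sum.distrib axis_def)
    qed
    \<comment> \<open>The shear matrix arises from the identity by adding one row to another, which
      keeps the determinant.\<close>
    have "?A = (\<chi> k. if k = m then row m (mat 1) + 1 *s row n (mat 1) else row k (mat 1))"
      using mn by (auto simp: vec_eq_iff row_def mat_def)
    then have "det ?A = det (mat 1 :: real^'n^'n)" by (simp only: det_row_operation[OF mn])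
    then have "det ?A = 1" by simp
    moreover have "(\<integral>\<^sup>+x. g (?A *v x) \<partial>lborel) = (\<integral>\<^sup>+x. g x \<partial>lborel)" if [measurable]: "g \<in> borel_measurable borel" for g :: "real^'n \<Rightarrow> ennreal"
      unfolding A using mn by (intro nn_integral_lborel_shear) (auto simp: Basis_vec_def axis_eq_axis)
    ultimately show "P ?A" by (simp add: P_def)
  qed
  with assms show ?thesis by (simp add: P_def)
qed

section \<open>Tilings by lattice translates\<close>

lemma infsum_ennreal:
  fixes f :: "'a \<Rightarrow> real"
  assumes "f summable_on A" and "\<And>x. x \<in> A \<Longrightarrow> 0 \<le> f x"
  shows "(\<Sum>\<^sub>\<infinity>x\<in>A. ennreal (f x)) = ennreal (infsum f A)"
proof -
  have "(\<Sum>\<^sub>\<infinity>x\<in>A. ennreal (f x)) = (SUP F\<in>{F. finite F \<and> F \<subseteq> A}. \<Sum>x\<in>F. ennreal (f x))"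
    by (rule nonneg_infsum_complete) simp
  also have "\<dots> = (SUP F\<in>{F. finite F \<and> F \<subseteq> A}. ennreal (sum f F))"
    by (rule SUP_cong) (use assms in \<open>auto intro!: sum_ennreal\<close>)
  also have "\<dots> = ennreal (infsum f A)"
    by (rule infsum_nonneg_is_SUPREMUM_ennreal[symmetric]) (use assms in auto)
  finally show ?thesis .
qed

text \<open>The usual route to summability below: the extended sum always exists, is evaluated or
  bounded by an integral, and its finiteness is carried back to the reals.\<close>

lemma summable_on_if_infsum_ennreal:
  fixes f :: "'a \<Rightarrow> real"
  assumes "(\<Sum>\<^sub>\<infinity>x\<in>A. ennreal (f x)) < \<infinity>" and nn: "\<And>x. x \<in> A \<Longrightarrow> 0 \<le> f x"
  shows "f summable_on A"
proof (rule nonneg_bdd_above_summable_on)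
  show "bdd_above (sum f ` {F. F \<subseteq> A \<and> finite F})"
  proof (rule bdd_aboveI2)
    fix F assume F: "F \<in> {F. F \<subseteq> A \<and> finite F}"
    have "ennreal (sum f F) = (\<Sum>x\<in>F. ennreal (f x))"
      by (rule sum_ennreal[symmetric]) (use F nn in auto)
    also have "\<dots> \<le> (\<Sum>\<^sub>\<infinity>x\<in>A. ennreal (f x))"
      by (subst nonneg_infsum_complete) (use F in \<open>auto intro!: SUP_upper\<close>)
    also have "\<dots> = ennreal (enn2real (\<Sum>\<^sub>\<infinity>x\<in>A. ennreal (f x)))"
      using assms(1) by simp
    finally show "sum f F \<le> enn2real (\<Sum>\<^sub>\<infinity>x\<in>A. ennreal (f x))"
      by (subst (asm) ennreal_le_iff) auto
  qed
qed (use nn in auto)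

lemma infsum_single:
  fixes f :: "'i \<Rightarrow> 'b::{topological_comm_monoid_add, t2_space}"
  assumes "i \<in> I" and "\<And>j. j \<in> I \<Longrightarrow> j \<noteq> i \<Longrightarrow> f j = 0"
  shows "(\<Sum>\<^sub>\<infinity>j\<in>I. f j) = f i"
proof -
  have "(\<Sum>\<^sub>\<infinity>j\<in>I. f j) = (\<Sum>\<^sub>\<infinity>j\<in>{i}. f j)"
    by (rule infsum_cong_neutral) (use assms in auto)
  then show ?thesis by simp
qed

lemma nn_integral_partition:
  assumes I: "countable I" and S[measurable]: "\<And>i. i \<in> I \<Longrightarrow> S i \<in> sets M"
    and part: "\<And>x. x \<in> space M \<Longrightarrow> \<exists>!i. i \<in> I \<and> x \<in> S i"
    and [measurable]: "f \<in> borel_measurable M"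
  shows "(\<integral>\<^sup>+x. f x \<partial>M) = (\<Sum>\<^sub>\<infinity>i\<in>I. \<integral>\<^sup>+x\<in>S i. f x \<partial>M)"
proof -
  have "(\<Sum>\<^sub>\<infinity>i\<in>I. f x * indicator (S i) x) = f x" if "x \<in> space M" for x
  proof -
    obtain i where i: "i \<in> I" "x \<in> S i" and "\<forall>j. j \<in> I \<and> x \<in> S j \<longrightarrow> j = i"
      using part[OF \<open>x \<in> space M\<close>] by (elim ex1E conjE) blast
    then have j: "x \<notin> S j" if "j \<in> I" "j \<noteq> i" for j using that by blast
    show ?thesis
      by (subst infsum_single[where i = i]) (simp_all add: i j)
  qed
  then have "(\<integral>\<^sup>+x. f x \<partial>M) = (\<integral>\<^sup>+x. (\<Sum>\<^sub>\<infinity>i\<in>I. f x * indicator (S i) x) \<partial>M)"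
    by (intro nn_integral_cong) simp
  also have "\<dots> = (\<Sum>\<^sub>\<infinity>i\<in>I. \<integral>\<^sup>+x\<in>S i. f x \<partial>M)"
    by (rule nn_integral_infsum[OF I]) measurable
  finally show ?thesis .
qed

text \<open>Pointwise at most one summand is nonzero. The nonnegative version, applied to the norm
  of \<open>f\<close>, supplies the summability needed for the interchange.\<close>

lemma integral_partition:
  fixes f :: "'a \<Rightarrow> 'b::{banach, second_countable_topology}"
  assumes M: "sigma_finite_measure M" and I: "countable I"
    and S[measurable]: "\<And>i. i \<in> I \<Longrightarrow> S i \<in> sets M"
    and part: "\<And>x. x \<in> space M \<Longrightarrow> \<exists>!i. i \<in> I \<and> x \<in> S i"
    and f: "integrable M f"
  shows "(\<integral>x. f x \<partial>M) = (\<Sum>\<^sub>\<infinity>i\<in>I. LINT x:S i|M. f x)"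
proof -
  have fin: "finite {i \<in> I. indicator (S i) x *\<^sub>R f x \<noteq> 0}"
    and sum: "(\<Sum>\<^sub>\<infinity>i\<in>I. indicator (S i) x *\<^sub>R f x) = f x" if "x \<in> space M" for x
  proof -
    obtain i where i: "i \<in> I" "x \<in> S i" and "\<forall>j. j \<in> I \<and> x \<in> S j \<longrightarrow> j = i"
      using part[OF \<open>x \<in> space M\<close>] by (elim ex1E conjE) blast
    then have j: "x \<notin> S j" if "j \<in> I" "j \<noteq> i" for j using that by blast
    have "{i \<in> I. indicator (S i) x *\<^sub>R f x \<noteq> 0} \<subseteq> {i}"
      using j by (auto simp: indicator_def split: if_splits)
    then show "finite {i \<in> I. indicator (S i) x *\<^sub>R f x \<noteq> 0}"
      by (rule finite_subset) simp
    show "(\<Sum>\<^sub>\<infinity>i\<in>I. indicator (S i) x *\<^sub>R f x) = f x"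
      by (subst infsum_single[where i = i]) (simp_all add: i j)
  qed
  have int: "integrable M (\<lambda>x. indicator (S i) x *\<^sub>R f x)" if "i \<in> I" for i
    using that f by (intro integrable_mult_indicator) auto
  have "(\<Sum>\<^sub>\<infinity>i\<in>I. ennreal (\<integral>x. norm (indicator (S i) x *\<^sub>R f x) \<partial>M))
      = (\<Sum>\<^sub>\<infinity>i\<in>I. \<integral>\<^sup>+x\<in>S i. ennreal (norm (f x)) \<partial>M)"
  proof (rule infsum_cong)
    fix i assume i: "i \<in> I"
    have "ennreal (\<integral>x. norm (indicator (S i) x *\<^sub>R f x) \<partial>M)
        = (\<integral>\<^sup>+x. ennreal (norm (indicator (S i) x *\<^sub>R f x)) \<partial>M)"
      by (rule nn_integral_eq_integral[symmetric]) (use integrable_norm[OF int[OF i]] in simp_all)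
    then show "ennreal (\<integral>x. norm (indicator (S i) x *\<^sub>R f x) \<partial>M)
        = (\<integral>\<^sup>+x\<in>S i. ennreal (norm (f x)) \<partial>M)"
      by (simp add: indicator_mult_ennreal mult.commute ennreal_mult' ennreal_indicator)
  qed
  also have "\<dots> = (\<integral>\<^sup>+x. ennreal (norm (f x)) \<partial>M)"
    using f by (intro nn_integral_partition[symmetric] I S part) auto
  also have "\<dots> < \<infinity>"
    using f by (simp add: integrable_iff_bounded)
  finally have "(\<lambda>i. \<integral>x. norm (indicator (S i) x *\<^sub>R f x) \<partial>M) summable_on I"
    by (rule summable_on_if_infsum_ennreal) auto
  then have "(\<integral>x. (\<Sum>\<^sub>\<infinity>i\<in>I. indicator (S i) x *\<^sub>R f x) \<partial>M)
      = (\<Sum>\<^sub>\<infinity>i\<in>I. \<integral>x. indicator (S i) x *\<^sub>R f x \<partial>M)"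
    by (intro integral_infsum M I int) (use fin in \<open>auto intro: finite_nonzero_values_imp_summable_on\<close>)
  moreover have "(\<integral>x. (\<Sum>\<^sub>\<infinity>i\<in>I. indicator (S i) x *\<^sub>R f x) \<partial>M) = (\<integral>x. f x \<partial>M)"
    by (rule Bochner_Integration.integral_cong) (simp_all add: sum)
  ultimately show ?thesis
    by (simp add: set_lebesgue_integral_def)
qed

lemma nn_integral_lborel_shift:
  fixes f :: "'a::euclidean_space \<Rightarrow> ennreal"
  assumes [measurable]: "f \<in> borel_measurable borel"
  shows "(\<integral>\<^sup>+x. f (x + a) \<partial>lborel) = (\<integral>\<^sup>+x. f x \<partial>lborel)"
proof -
  have "(\<integral>\<^sup>+x. f x \<partial>lborel) = (\<integral>\<^sup>+x. f x \<partial>distr lborel borel ((+) a))"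
    by (simp add: lborel_distr_plus)
  then show ?thesis by (simp add: nn_integral_distr add.commute)
qed

lemma integral_lborel_shift:
  fixes f :: "'a::euclidean_space \<Rightarrow> 'b::{banach, second_countable_topology}"
  assumes [measurable]: "f \<in> borel_measurable borel"
  shows "(\<integral>x. f (x + a) \<partial>lborel) = (\<integral>x. f x \<partial>lborel)"
proof -
  have "(\<integral>x. f x \<partial>lborel) = (\<integral>x. f x \<partial>distr lborel borel ((+) a))"
    by (simp add: lborel_distr_plus)
  then show ?thesis by (simp add: integral_distr add.commute)
qed

text \<open>The inverse \<open>U\<close> is a parameter because \<open>U *v x\<close> is the
  coordinate vector of \<open>x\<close> in the lattice basis: lattice and fundamental domain become
  conditions on single coordinates, and transposing both matrices yields the dual lattice as another
  instance.\<close>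

locale unimodular_lattice =
  fixes V U :: "real^'d^'d"
  assumes UV: "U ** V = mat 1" and VU: "V ** U = mat 1" and det_V: "det V = 1"
begin

abbreviation L :: "(real^'d) set" where "L \<equiv> lattice_of V"
abbreviation D :: "(real^'d) set" where "D \<equiv> dual_lattice V"
abbreviation \<Omega> :: "(real^'d) set" where "\<Omega> \<equiv> fundamental_domain V"

section \<open>Lattice, dual lattice and fundamental domain in coordinates\<close>

lemma U_V [simp]: "U *v (V *v x) = x" and V_U [simp]: "V *v (U *v x) = x"
  by (simp_all add: matrix_vector_mul_assoc UV VU)

lemma U_uminus: "U *v (- x) = - (U *v x)"
  by (simp add: linear_neg[OF matrix_vector_mul_linear])

lemma mem_lattice_iff: "x \<in> L \<longleftrightarrow> (\<forall>i. (U *v x) $ i \<in> \<int>)"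
  unfolding lattice_of_def by (auto intro!: exI[of _ "U *v x"])

lemma mem_fundamental_domain_iff: "x \<in> \<Omega> \<longleftrightarrow> (\<forall>i. (U *v x) $ i \<in> {0..<1})"
proof -
  have eq: "(\<Sum>j\<in>UNIV. \<alpha> j *\<^sub>R column j V) = V *v (\<chi> j. \<alpha> j)" for \<alpha>
    by (simp add: matrix_mult_sum scalar_mult_eq_scaleR)
  show ?thesis
    unfolding fundamental_domain_def eq
    by (auto intro!: exI[of _ "\<lambda>j. (U *v x) $ j"] simp del: atLeastLessThan_iff)
qed

text \<open>Pairing \<open>w\<close> with \<open>V *v k\<close> pairs
  \<open>transpose V *v w\<close> with \<open>k\<close>, so it is enough to test the basis
  vectors.\<close>

lemma mem_dual_lattice_iff: "w \<in> D \<longleftrightarrow> (\<forall>i. (transpose V *v w) $ i \<in> \<int>)"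
proof
  assume w: "w \<in> D"
  show "\<forall>i. (transpose V *v w) $ i \<in> \<int>"
  proof
    fix i
    have "V *v axis i 1 \<in> L"
      by (simp add: mem_lattice_iff axis_def)
    then have "w \<bullet> (V *v axis i 1) \<in> \<int>"
      using w by (auto simp: dual_lattice_def)
    then show "(transpose V *v w) $ i \<in> \<int>"
      by (simp add: inner_axis flip: dot_lmul_matrix)
  qed
next
  assume w: "\<forall>i. (transpose V *v w) $ i \<in> \<int>"
  have "w \<bullet> x \<in> \<int>" if "x \<in> L" for x
  proof -
    have "w \<bullet> x = (transpose V *v w) \<bullet> (U *v x)"
      by (simp add: dot_lmul_matrix)
    also have "\<dots> = (\<Sum>i\<in>UNIV. (transpose V *v w) $ i * (U *v x) $ i)"
      by (simp add: inner_vec_def)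
    also have "\<dots> \<in> \<int>"
      using w that by (intro Ints_sum Ints_mult) (auto simp: mem_lattice_iff)
    finally show ?thesis .
  qed
  then show "w \<in> D" by (simp add: dual_lattice_def)
qed

text \<open>Lets facts about lattices generated by a matrix be applied to \<open>D\<close>.\<close>

lemma dual_lattice_eq: "D = lattice_of (transpose U)"
proof -
  have "transpose V ** transpose U = mat 1" "transpose U ** transpose V = mat 1"
    by (simp_all flip: matrix_transpose_mul add: UV VU)
  then have [simp]: "transpose V *v (transpose U *v k) = k" "transpose U *v (transpose V *v k) = k" for k
    by (simp_all add: matrix_vector_mul_assoc del: transpose_matrix_vector)
  have "w \<in> D \<longleftrightarrow> w \<in> lattice_of (transpose U)" for w
    unfolding mem_dual_lattice_iff lattice_of_def
    by (auto intro!: exI[of _ "transpose V *v w"] simp del: transpose_matrix_vector)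
  then show ?thesis by blast
qed

lemma countable_lattice_of: "countable (lattice_of (W :: real^'d^'d))"
proof -
  have "lattice_of W \<subseteq> range (\<lambda>f::'d \<Rightarrow> int. W *v (\<chi> i. of_int (f i)))"
  proof
    fix x assume "x \<in> lattice_of W"
    then obtain k where k: "x = W *v k" "\<forall>i. k $ i \<in> \<int>" by (auto simp: lattice_of_def)
    then have "k = (\<chi> i. of_int \<lfloor>k $ i\<rfloor>)" by (simp add: vec_eq_iff)
    with k show "x \<in> range (\<lambda>f::'d \<Rightarrow> int. W *v (\<chi> i. of_int (f i)))"
      by (intro image_eqI[where x = "\<lambda>i. \<lfloor>k $ i\<rfloor>"]) auto
  qed
  then show ?thesis by (rule countable_subset) (intro countable_image countableI_type)
qed

lemma countable_L: "countable L" and countable_D: "countable D"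
  by (simp_all add: dual_lattice_eq countable_lattice_of)

lemma L_0 [simp]: "0 \<in> L"
  and L_add: "v \<in> L \<Longrightarrow> v' \<in> L \<Longrightarrow> v + v' \<in> L"
  and L_diff: "v \<in> L \<Longrightarrow> v' \<in> L \<Longrightarrow> v - v' \<in> L"
  and L_uminus [simp]: "- v \<in> L \<longleftrightarrow> v \<in> L"
  by (auto simp: mem_lattice_iff matrix_vector_mult_diff_distrib matrix_vector_right_distrib
      U_uminus)

text \<open>The coordinates of \<open>v\<close> are forced to be minus the floors of those of
  \<open>x\<close>.\<close>

lemma ex1_lattice_fundamental_domain: "\<exists>!v. v \<in> L \<and> x + v \<in> \<Omega>"
proof (rule ex1I[where a = "V *v (- (\<chi> i. of_int \<lfloor>(U *v x) $ i\<rfloor>))"], intro conjI)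
  show "V *v (- (\<chi> i. of_int \<lfloor>(U *v x) $ i\<rfloor>)) \<in> L"
    by (simp add: mem_lattice_iff)
  have "0 \<le> (U *v x) $ i - real_of_int \<lfloor>(U *v x) $ i\<rfloor> \<and> (U *v x) $ i - real_of_int \<lfloor>(U *v x) $ i\<rfloor> < 1" for i
    by linarith
  then show "x + V *v (- (\<chi> i. of_int \<lfloor>(U *v x) $ i\<rfloor>)) \<in> \<Omega>"
    by (simp add: mem_fundamental_domain_iff matrix_vector_right_distrib)
next
  fix v assume v: "v \<in> L \<and> x + v \<in> \<Omega>"
  have "(U *v v) $ i = - of_int \<lfloor>(U *v x) $ i\<rfloor>" for i
  proof -
    obtain k where k: "(U *v v) $ i = of_int k" using v by (auto simp: mem_lattice_iff elim: Ints_cases)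
    have "(U *v x) $ i + of_int k \<in> {0..<1}"
      using v k[symmetric] by (simp add: mem_fundamental_domain_iff matrix_vector_right_distrib)
    then have "\<lfloor>(U *v x) $ i\<rfloor> = - k" by (simp add: floor_eq_iff)
    then show ?thesis by (simp add: k)
  qed
  then have "U *v v = - (\<chi> i. of_int \<lfloor>(U *v x) $ i\<rfloor>)" by (simp add: vec_eq_iff)
  then show "v = V *v (- (\<chi> i. of_int \<lfloor>(U *v x) $ i\<rfloor>))" by (metis V_U)
qed

lemma ex1_lattice_fundamental_domain': "\<exists>!v. v \<in> L \<and> x - v \<in> \<Omega>"
  using ex1_lattice_fundamental_domain[of x]
  by (metis L_uminus add.inverse_inverse diff_conv_add_uminus)

lemma measurable_fundamental_domain [measurable]: "\<Omega> \<in> sets borel"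
proof -
  have [measurable]: "(\<lambda>x. (U *v x) $ i) \<in> borel_measurable borel" for i
    by (intro borel_measurable_continuous_onI continuous_intros matrix_vector_mult_linear_continuous_on)
  have "\<Omega> = {x \<in> space borel. \<forall>i. (U *v x) $ i \<in> {0..<1}}"
    by (auto simp: mem_fundamental_domain_iff)
  also have "\<dots> \<in> sets borel" by measurable
  finally show ?thesis .
qed

lemma measurable_translate_fundamental_domain [measurable]:
  "{x. x + a \<in> \<Omega>} \<in> sets borel" "{x. x - a \<in> \<Omega>} \<in> sets borel" "{x. x - a + b \<in> \<Omega>} \<in> sets borel"
proof -
  have "{x \<in> space borel. x + a \<in> \<Omega>} \<in> sets borel"
    "{x \<in> space borel. x - a \<in> \<Omega>} \<in> sets borel" "{x \<in> space borel. x - a + b \<in> \<Omega>} \<in> sets borel"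
    by measurable
  then show "{x. x + a \<in> \<Omega>} \<in> sets borel" "{x. x - a \<in> \<Omega>} \<in> sets borel" "{x. x - a + b \<in> \<Omega>} \<in> sets borel"
    by simp_all
qed

text \<open>The unfolding principle: translates of \<Omega> by lattice vectors partition the space,
  so a sum over the lattice of integrals over \<Omega> is a single integral over the space.\<close>

lemma nn_integral_tiling:
  fixes f :: "real^'d \<Rightarrow> ennreal"
  assumes [measurable]: "f \<in> borel_measurable borel"
  shows "(\<integral>\<^sup>+x. f x \<partial>lborel) = (\<Sum>\<^sub>\<infinity>v\<in>L. \<integral>\<^sup>+x\<in>\<Omega>. f (x + v) \<partial>lborel)"
proof -
  have "(\<integral>\<^sup>+x. f x \<partial>lborel) = (\<Sum>\<^sub>\<infinity>v\<in>L. \<integral>\<^sup>+x\<in>{x. x - v \<in> \<Omega>}. f x \<partial>lborel)"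
    by (rule nn_integral_partition[OF countable_L]) (simp_all add: ex1_lattice_fundamental_domain' measurable_translate_fundamental_domain)
  also have "\<dots> = (\<Sum>\<^sub>\<infinity>v\<in>L. \<integral>\<^sup>+x\<in>\<Omega>. f (x + v) \<partial>lborel)"
  proof (rule infsum_cong)
    fix v
    show "(\<integral>\<^sup>+x\<in>{x. x - v \<in> \<Omega>}. f x \<partial>lborel) = (\<integral>\<^sup>+x\<in>\<Omega>. f (x + v) \<partial>lborel)"
      by (subst nn_integral_lborel_shift[symmetric, where a = v]) (auto simp: indicator_def)
  qed
  finally show ?thesis .
qed

lemma integral_tiling:
  fixes f :: "real^'d \<Rightarrow> 'b::{banach, second_countable_topology}"
  assumes f: "integrable lborel f"
  shows "(\<integral>x. f x \<partial>lborel) = (\<Sum>\<^sub>\<infinity>v\<in>L. LINT x:\<Omega>|lborel. f (x + v))"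
proof -
  have [measurable]: "f \<in> borel_measurable borel" using f by auto
  have "(\<integral>x. f x \<partial>lborel) = (\<Sum>\<^sub>\<infinity>v\<in>L. LINT x:{x. x - v \<in> \<Omega>}|lborel. f x)"
    by (rule integral_partition[OF lborel.sigma_finite_measure_axioms countable_L _ _ f])
       (simp_all add: ex1_lattice_fundamental_domain' measurable_translate_fundamental_domain)
  also have "\<dots> = (\<Sum>\<^sub>\<infinity>v\<in>L. LINT x:\<Omega>|lborel. f (x + v))"
    unfolding set_lebesgue_integral_def
  proof (rule infsum_cong)
    fix v
    show "(\<integral>x. indicator {x. x - v \<in> \<Omega>} x *\<^sub>R f x \<partial>lborel) = (\<integral>x. indicator \<Omega> x *\<^sub>R f (x + v) \<partial>lborel)"
      by (subst integral_lborel_shift[symmetric, where a = v]) (auto simp: indicator_def)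
  qed
  finally show ?thesis .
qed

text \<open>The shifted copy of \<Omega> is cut along the tiling and each piece is moved back by
  periodicity; the pieces then partition \<Omega> itself.\<close>

lemma nn_integral_fundamental_domain_shift:
  fixes f :: "real^'d \<Rightarrow> ennreal"
  assumes [measurable]: "f \<in> borel_measurable borel"
    and per: "\<And>x v. v \<in> L \<Longrightarrow> f (x + v) = f x"
  shows "(\<integral>\<^sup>+x\<in>\<Omega>. f (x + a) \<partial>lborel) = (\<integral>\<^sup>+x\<in>\<Omega>. f x \<partial>lborel)"
proof -
  have "(\<integral>\<^sup>+x\<in>\<Omega>. f (x + a) \<partial>lborel) = (\<integral>\<^sup>+x. f x * indicator \<Omega> (x - a) \<partial>lborel)"
    by (subst nn_integral_lborel_shift[symmetric, where a = a]) auto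
  also have "\<dots> = (\<Sum>\<^sub>\<infinity>v\<in>L. \<integral>\<^sup>+x\<in>\<Omega>. (f (x + v) * indicator \<Omega> (x + v - a)) \<partial>lborel)"
    by (rule nn_integral_tiling) measurable
  also have "\<dots> = (\<Sum>\<^sub>\<infinity>v\<in>L. \<integral>\<^sup>+x\<in>{x. x - a + v \<in> \<Omega>}. (f x * indicator \<Omega> x) \<partial>lborel)"
    by (intro infsum_cong nn_integral_cong) (simp add: per add_diff_eq diff_add_eq mult_ac indicator_def)
  also have "\<dots> = (\<integral>\<^sup>+x\<in>\<Omega>. f x \<partial>lborel)"
    by (rule nn_integral_partition[OF countable_L, symmetric])
       (simp_all add: ex1_lattice_fundamental_domain measurable_translate_fundamental_domain)
  finally show ?thesis .
qed

lemma integral_fundamental_domain_shift: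
  fixes f :: "real^'d \<Rightarrow> 'b::{banach, second_countable_topology}"
  assumes [measurable]: "f \<in> borel_measurable borel"
    and per: "\<And>x v. v \<in> L \<Longrightarrow> f (x + v) = f x" and f: "set_integrable lborel \<Omega> f"
  shows "(LINT x:\<Omega>|lborel. f (x + a)) = (LINT x:\<Omega>|lborel. f x)"
proof -
  let ?g = "\<lambda>x. indicator \<Omega> (x - a) *\<^sub>R f x"
  \<comment> \<open>The nonnegative version applied to the norm shows that \<open>f\<close> stays
    integrable on the shifted domain.\<close>
  have "(\<integral>\<^sup>+x. ennreal (norm (?g x)) \<partial>lborel) = (\<integral>\<^sup>+x\<in>\<Omega>. ennreal (norm (f (x + a))) \<partial>lborel)"
    by (subst nn_integral_lborel_shift[symmetric, where a = a])
       (auto intro!: nn_integral_cong simp: indicator_def)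
  also have "\<dots> = (\<integral>\<^sup>+x\<in>\<Omega>. ennreal (norm (f x)) \<partial>lborel)"
    by (rule nn_integral_fundamental_domain_shift) (auto simp: per)
  also have "\<dots> = (\<integral>\<^sup>+x. ennreal (norm (indicator \<Omega> x *\<^sub>R f x)) \<partial>lborel)"
    by (auto intro!: nn_integral_cong simp: indicator_def)
  also have "\<dots> < \<infinity>"
    using f by (simp add: set_integrable_def integrable_iff_bounded)
  finally have int: "integrable lborel ?g"
    by (intro integrableI_bounded) measurable
  have "(LINT x:\<Omega>|lborel. f (x + a)) = (\<integral>x. ?g x \<partial>lborel)"
    unfolding set_lebesgue_integral_def
    by (subst integral_lborel_shift[symmetric, where a = a]) auto
  also have "\<dots> = (\<Sum>\<^sub>\<infinity>v\<in>L. LINT x:\<Omega>|lborel. ?g (x + v))"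
    by (rule integral_tiling[OF int])
  also have "\<dots> = (\<Sum>\<^sub>\<infinity>v\<in>L. LINT x:{x. x - a + v \<in> \<Omega>}|lborel. indicator \<Omega> x *\<^sub>R f x)"
    unfolding set_lebesgue_integral_def
    by (intro infsum_cong Bochner_Integration.integral_cong)
       (simp_all add: per add_diff_eq diff_add_eq mult_ac indicator_def)
  also have "\<dots> = (\<integral>x. indicator \<Omega> x *\<^sub>R f x \<partial>lborel)"
    by (rule integral_partition[OF lborel.sigma_finite_measure_axioms countable_L, symmetric])
       (use f in \<open>simp_all add: ex1_lattice_fundamental_domain measurable_translate_fundamental_domain set_integrable_def\<close>)
  finally show ?thesis by (simp add: set_lebesgue_integral_def)
qed

text \<open>\<open>V\<close> has determinant 1 and maps the half-open unit cube onto \<Omega>; that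
  cube lies between the open and the closed one.\<close>

lemma emeasure_fundamental_domain: "emeasure lborel \<Omega> = 1"
proof -
  let ?C = "{u :: real^'d. \<forall>i. u $ i \<in> {0..<1}}"
  have [measurable]: "?C \<in> sets borel"
  proof -
    have "?C = {u \<in> space borel. \<forall>i. u $ i \<in> {0..<1}}" by auto
    also have "\<dots> \<in> sets borel" by measurable
    finally show ?thesis .
  qed
  have basis_one: "(1 :: real^'d) \<bullet> b = 1" if "b \<in> Basis" for b
    using that by (auto simp: Basis_vec_def inner_axis)
  have one: "(\<Prod>b\<in>Basis. (1 :: real^'d) \<bullet> b) = 1"
    by (intro prod.neutral ballI basis_one)
  have "emeasure lborel ?C = 1"
  proof (rule antisym)
    have "emeasure lborel ?C \<le> emeasure lborel (cbox 0 (1 :: real^'d))"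
      by (rule emeasure_mono) (auto simp: mem_box_cart less_imp_le)
    also have "\<dots> = 1"
      by (subst emeasure_lborel_cbox) (simp_all add: one basis_one)
    finally show "emeasure lborel ?C \<le> 1" .
    have "1 = emeasure lborel (box 0 (1 :: real^'d))"
      by (subst emeasure_lborel_box) (simp_all add: one basis_one)
    also have "\<dots> \<le> emeasure lborel ?C"
      by (rule emeasure_mono) (auto simp: mem_box_cart less_imp_le)
    finally show "1 \<le> emeasure lborel ?C" .
  qed
  have "emeasure lborel \<Omega> = (\<integral>\<^sup>+x. indicator \<Omega> (V *v x) \<partial>lborel)"
    using nn_integral_linear_change[of V "indicator \<Omega>"] det_V by simp
  also have "\<dots> = (\<integral>\<^sup>+x. indicator ?C x \<partial>lborel)"
    by (intro nn_integral_cong) (auto simp: indicator_def mem_fundamental_domain_iff)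
  also have "\<dots> = 1"
    using \<open>emeasure lborel ?C = 1\<close> by simp
  finally show ?thesis .
qed

end

section \<open>Gaussians and the theta function\<close>

text \<open>Rescaling by \<open>c = 1 / sqrt (2 * t)\<close> turns the Gaussian into a multiple of
  the standard normal density, whose characteristic function is known.\<close>

lemma
  fixes t u :: real
  assumes t: "t > 0"
  shows integrable_gaussian_real: "integrable lborel (\<lambda>x. exp (- (t * x\<^sup>2)) *\<^sub>R iexp (u * x))"
    and integral_gaussian_real: "(\<integral>x. exp (- (t * x\<^sup>2)) *\<^sub>R iexp (u * x) \<partial>lborel)
      = of_real (sqrt (pi / t) * exp (- (u\<^sup>2 / (4 * t))))"
proof -
  define c where "c = 1 / sqrt (2 * t)"
  have c: "c > 0" using t by (simp add: c_def)
  have c2: "c\<^sup>2 = 1 / (2 * t)" using t by (simp add: c_def power_divide)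
  let ?f = "\<lambda>x. exp (- (t * x\<^sup>2)) *\<^sub>R iexp (u * x)"
  let ?g = "\<lambda>x. std_normal_density x *\<^sub>R iexp (u * c * x)"
  have fg: "?f (0 + c * x) = of_real (sqrt (2 * pi)) * ?g x" for x
  proof -
    have "t * (c * x)\<^sup>2 = x\<^sup>2 / 2" using t by (simp add: power_mult_distrib c2)
    then show ?thesis
      by (simp add: normal_density_def scaleR_conv_of_real mult_ac)
  qed
  have int_g: "integrable lborel ?g"
  proof (rule Bochner_Integration.integrable_bound)
    show "integrable lborel (std_normal_density :: real \<Rightarrow> real)"
      using integrable_std_normal_moment[of 0] by simp
  qed auto
  show "integrable lborel ?f"
    using int_g by (subst lborel_integrable_real_affine_iff[of c ?f 0, symmetric])
      (use c in \<open>simp_all only: fg integrable_mult_right less_irrefl\<close>)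
  have "(\<integral>x. ?f x \<partial>lborel) = \<bar>c\<bar> *\<^sub>R (\<integral>x. ?f (0 + c * x) \<partial>lborel)"
    by (rule lborel_integral_real_affine) (use c in simp)
  also have "(\<integral>x. ?f (0 + c * x) \<partial>lborel) = of_real (sqrt (2 * pi)) * (\<integral>x. ?g x \<partial>lborel)"
    unfolding fg by (rule integral_mult_right_zero)
  also have "(\<integral>x. ?g x \<partial>lborel) = char std_normal_distribution (u * c)"
    unfolding char_def by (subst integral_density) auto
  also have "\<dots> = of_real (exp (- (u\<^sup>2 / (4 * t))))"
    by (simp add: char_std_normal_distribution power_mult_distrib c2)
  finally have "(\<integral>x. ?f x \<partial>lborel) = of_real (c * sqrt (2 * pi) * exp (- (u\<^sup>2 / (4 * t))))"
    using c by (simp add: scaleR_conv_of_real mult.assoc)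
  also have "c * sqrt (2 * pi) = sqrt (pi / t)"
    by (simp add: c_def real_sqrt_divide[symmetric] real_sqrt_mult)
  finally show "(\<integral>x. ?f x \<partial>lborel) = of_real (sqrt (pi / t) * exp (- (u\<^sup>2 / (4 * t))))" .
qed

text \<open>Both the Gaussian and the character are products over the coordinates, so the integral
  factors into one-dimensional ones.\<close>

lemma
  fixes w :: "'a::euclidean_space"
  assumes t: "t > 0"
  shows integrable_gaussian: "integrable lborel (\<lambda>x. exp (- (t * (norm x)\<^sup>2)) *\<^sub>R iexp (w \<bullet> x))"
    and integral_gaussian: "(\<integral>x. exp (- (t * (norm x)\<^sup>2)) *\<^sub>R iexp (w \<bullet> x) \<partial>lborel)
      = of_real ((pi / t) powr (real DIM('a) / 2) * exp (- ((norm w)\<^sup>2 / (4 * t))))"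
proof -
  interpret product_sigma_finite "\<lambda>_::'a. lborel :: real measure" ..
  let ?f = "\<lambda>x. exp (- (t * (norm x)\<^sup>2)) *\<^sub>R iexp (w \<bullet> x)"
  let ?g = "\<lambda>b x. exp (- (t * x\<^sup>2)) *\<^sub>R iexp ((w \<bullet> b) * x)"
  have norm2: "(norm x)\<^sup>2 = (\<Sum>b\<in>Basis. (x \<bullet> b)\<^sup>2)" for x :: 'a
    unfolding power2_norm_eq_inner by (subst euclidean_inner) (simp add: power2_eq_square)
  have fg: "?f (\<Sum>b\<in>Basis. y b *\<^sub>R b) = (\<Prod>b\<in>Basis. ?g b (y b))" for y
  proof -
    have "exp (- (t * (norm (\<Sum>b\<in>Basis. y b *\<^sub>R b))\<^sup>2)) = (\<Prod>b\<in>Basis. exp (- (t * (y b)\<^sup>2)))"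
      by (simp add: norm2 sum_distrib_left flip: exp_sum sum_negf)
    moreover have "iexp (w \<bullet> (\<Sum>b\<in>Basis. y b *\<^sub>R b)) = (\<Prod>b\<in>Basis. iexp ((w \<bullet> b) * y b))"
      by (simp add: inner_sum_right sum_distrib_left mult_ac flip: exp_sum)
    ultimately show ?thesis
      by (simp add: scaleR_conv_of_real prod.distrib flip: of_real_prod)
  qed
  have "integrable (Pi\<^sub>M Basis (\<lambda>_. lborel)) (\<lambda>y. \<Prod>b\<in>Basis. ?g b (y b))"
    by (rule product_integrable_prod) (auto intro: integrable_gaussian_real[OF t] simp del: of_real_mult)
  then show "integrable lborel ?f"
    by (subst lborel_eq) (simp add: integrable_distr_eq fg)
  have "(\<integral>x. ?f x \<partial>lborel) = (\<integral>y. (\<Prod>b\<in>Basis. ?g b (y b)) \<partial>Pi\<^sub>M Basis (\<lambda>_. lborel))"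
    by (subst lborel_eq) (simp add: integral_distr fg)
  also have "\<dots> = (\<Prod>b\<in>Basis. integral\<^sup>L lborel (?g b))"
    by (rule product_integral_prod) (auto intro: integrable_gaussian_real[OF t] simp del: of_real_mult)
  also have "\<dots> = of_real (\<Prod>b\<in>Basis. sqrt (pi / t) * exp (- ((w \<bullet> b)\<^sup>2 / (4 * t))))"
    by (simp only: integral_gaussian_real[OF t] of_real_prod)
  also have "(\<Prod>b\<in>Basis. sqrt (pi / t) * exp (- ((w \<bullet> b)\<^sup>2 / (4 * t))))
      = sqrt (pi / t) ^ DIM('a) * exp (- ((norm w)\<^sup>2 / (4 * t)))"
    by (simp add: prod.distrib norm2 sum_divide_distrib flip: exp_sum sum_negf)
  also have "sqrt (pi / t) ^ DIM('a) = (pi / t) powr (real DIM('a) / 2)"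
    using t by (simp add: powr_half_sqrt[symmetric] powr_realpow[symmetric] powr_powr)
  finally show "(\<integral>x. ?f x \<partial>lborel) = of_real ((pi / t) powr (real DIM('a) / 2) * exp (- ((norm w)\<^sup>2 / (4 * t))))" .
qed

lemma nn_integral_gaussian:
  assumes t: "t > 0"
  shows "(\<integral>\<^sup>+x. ennreal (exp (- (t * (norm (x :: 'a::euclidean_space))\<^sup>2))) \<partial>lborel)
    = ennreal ((pi / t) powr (real DIM('a) / 2))"
proof -
  have int: "integrable lborel (\<lambda>x :: 'a. exp (- (t * (norm x)\<^sup>2)))"
    using integrable_norm[OF integrable_gaussian[OF t, of 0]] by simp
  have "of_real (\<integral>x. exp (- (t * (norm (x :: 'a))\<^sup>2)) \<partial>lborel)
      = (of_real ((pi / t) powr (real DIM('a) / 2)) :: complex)"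
    using integral_gaussian[OF t, of "0 :: 'a"] by (simp add: scaleR_conv_of_real)
  then have "(\<integral>x. exp (- (t * (norm (x :: 'a))\<^sup>2)) \<partial>lborel) = (pi / t) powr (real DIM('a) / 2)"
    by (simp only: of_real_eq_iff)
  with nn_integral_eq_integral[OF int] show ?thesis by simp
qed

context unimodular_lattice
begin

text \<open>The dual lattice satisfies the same assumptions, so Gaussian summability over
  \<open>D\<close> needs no second proof.\<close>

lemma dual: "unimodular_lattice (transpose U) (transpose V)"
proof
  show "transpose V ** transpose U = mat 1" "transpose U ** transpose V = mat 1"
    by (simp_all flip: matrix_transpose_mul add: UV VU)
  have "det U * det V = 1" by (metis UV det_I det_mul)
  then show "det (transpose U) = 1" by (simp add: det_V)
qed

lemma compact_superset_fundamental_domain: obtains K where "compact K" "\<Omega> \<subseteq> K"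
proof
  show "compact ((*v) V ` cbox 0 1)"
    by (intro compact_continuous_image matrix_vector_mult_linear_continuous_on compact_cbox)
  show "\<Omega> \<subseteq> (*v) V ` cbox 0 1"
  proof
    fix x assume "x \<in> \<Omega>"
    then show "x \<in> (*v) V ` cbox 0 1"
      by (intro image_eqI[where x = "U *v x"])
         (auto simp: mem_fundamental_domain_iff mem_box_cart less_imp_le)
  qed
qed

lemma set_integrable_fundamental_domain:
  fixes f :: "real^'d \<Rightarrow> 'b::{banach, second_countable_topology}"
  assumes "continuous_on UNIV f"
  shows "set_integrable lborel \<Omega> f"
proof -
  obtain K where K: "compact K" "\<Omega> \<subseteq> K" by (rule compact_superset_fundamental_domain)
  have "set_integrable lborel K f"
    unfolding set_integrable_def
    by (rule borel_integrable_compact[OF K(1)]) (rule continuous_on_subset[OF assms], simp)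
  then show ?thesis by (rule set_integrable_subset) (use K in auto)
qed

text \<open>Each term is at most a constant times the mean over the tile \<open>q + v + \<Omega>\<close> of a wider Gaussian.\<close>

lemma summable_lattice_gaussian:
  assumes t: "t > 0"
  shows "(\<lambda>v. exp (- (t * (norm (q + v))\<^sup>2))) summable_on L"
proof -
  obtain K where K: "compact K" "\<Omega> \<subseteq> K" by (rule compact_superset_fundamental_domain)
  then obtain R where R: "\<And>x. x \<in> \<Omega> \<Longrightarrow> norm x \<le> R"
    by (metis bounded_iff compact_imp_bounded subset_eq)
  \<comment> \<open>From (a + b)^2 \<le> 2 a^2 + 2 b^2: the factor 2 is paid for by halving the
    exponent to t/2, and \<open>R\<close> bounds the displacement within a tile.\<close>
  have le: "exp (- (t * (norm (q + v))\<^sup>2)) \<le> exp (t * R\<^sup>2) * exp (- (t / 2 * (norm (q + (x + v)))\<^sup>2))"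
    if "x \<in> \<Omega>" for v x
  proof -
    have "(norm (q + (x + v)))\<^sup>2 \<le> (norm (q + v) + R)\<^sup>2"
      using norm_triangle_ineq[of "q + v" x] R[OF that] by (intro power_mono) (auto simp: add_ac)
    also have "\<dots> \<le> 2 * (norm (q + v))\<^sup>2 + 2 * R\<^sup>2"
      using sum_squares_bound[of "norm (q + v)" R] by (simp add: power2_sum)
    finally have "t / 2 * (norm (q + (x + v)))\<^sup>2 \<le> t / 2 * (2 * (norm (q + v))\<^sup>2 + 2 * R\<^sup>2)"
      using t by (intro mult_left_mono) auto
    then show ?thesis unfolding exp_add[symmetric] exp_le_cancel_iff
      by (simp add: algebra_simps)
  qed
  let ?G = "\<lambda>x. ennreal (exp (- (t / 2 * (norm (x :: real^'d))\<^sup>2)))"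
  have "(\<Sum>\<^sub>\<infinity>v\<in>L. ennreal (exp (- (t * (norm (q + v))\<^sup>2))))
      \<le> (\<Sum>\<^sub>\<infinity>v\<in>L. ennreal (exp (t * R\<^sup>2)) * (\<integral>\<^sup>+x\<in>\<Omega>. ?G (q + (x + v)) \<partial>lborel))"
  proof (rule infsum_mono)
    fix v
    have "ennreal (exp (- (t * (norm (q + v))\<^sup>2))) = (\<integral>\<^sup>+x\<in>\<Omega>. ennreal (exp (- (t * (norm (q + v))\<^sup>2))) \<partial>lborel)"
      by (simp add: nn_integral_cmult_indicator emeasure_fundamental_domain)
    also have "\<dots> \<le> (\<integral>\<^sup>+x. ennreal (exp (t * R\<^sup>2)) * (?G (q + (x + v)) * indicator \<Omega> x) \<partial>lborel)"
    proof (rule nn_integral_mono)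
      fix x
      show "ennreal (exp (- (t * (norm (q + v))\<^sup>2))) * indicator \<Omega> x
          \<le> ennreal (exp (t * R\<^sup>2)) * (?G (q + (x + v)) * indicator \<Omega> x)"
        using ennreal_leI[OF le[of x v]] by (cases "x \<in> \<Omega>") (simp_all add: ennreal_mult')
    qed
    also have "\<dots> = ennreal (exp (t * R\<^sup>2)) * (\<integral>\<^sup>+x\<in>\<Omega>. ?G (q + (x + v)) \<partial>lborel)"
      by (rule nn_integral_cmult) measurable
    finally show "ennreal (exp (- (t * (norm (q + v))\<^sup>2))) \<le> \<dots>" .
  qed (auto intro: nonneg_summable_on_complete)
  also have "\<dots> = ennreal (exp (t * R\<^sup>2)) * (\<Sum>\<^sub>\<infinity>v\<in>L. \<integral>\<^sup>+x\<in>\<Omega>. ?G (q + (x + v)) \<partial>lborel)"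
    by (simp add: nn_integral_count_space_eq_infsum[OF countable_L, symmetric] nn_integral_cmult)
  also have "(\<Sum>\<^sub>\<infinity>v\<in>L. \<integral>\<^sup>+x\<in>\<Omega>. ?G (q + (x + v)) \<partial>lborel) = (\<integral>\<^sup>+x. ?G (q + x) \<partial>lborel)"
    by (rule nn_integral_tiling[symmetric]) measurable
  also have "\<dots> = (\<integral>\<^sup>+x. ?G x \<partial>lborel)"
    using nn_integral_lborel_shift[of ?G q] by (simp add: add.commute)
  also have "\<dots> = ennreal ((pi / (t / 2)) powr (real DIM(real^'d) / 2))"
    using t by (subst nn_integral_gaussian) auto
  finally show ?thesis
    by (intro summable_on_if_infsum_ennreal) (auto simp: ennreal_mult_less_top elim!: order_le_less_trans)
qed

section \<open>The theta function\<close>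

definition \<theta> :: "real \<Rightarrow> real^'d \<Rightarrow> real" where
  "\<theta> t q = (\<Sum>\<^sub>\<infinity>v\<in>L. exp (- (t * (norm (q + v))\<^sup>2)))"

lemma \<theta>_nonneg: "0 \<le> \<theta> t q"
  unfolding \<theta>_def by (rule infsum_nonneg) auto

lemma \<theta>_periodic: "v \<in> L \<Longrightarrow> \<theta> t (q + v) = \<theta> t q"
  unfolding \<theta>_def
  by (rule infsum_reindex_bij_witness[of _ "\<lambda>u. u - v" "\<lambda>u. u + v"])
     (auto intro: L_add L_diff simp: add_ac)

text \<open>For \<open>q\<close> in a ball of radius \<open>R\<close>, halving the exponent
  dominates each term by one that does not depend on \<open>q\<close>. The convergence is thus
  locally uniform.\<close>

lemma continuous_\<theta>:
  assumes t: "t > 0"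
  shows "continuous_on UNIV (\<theta> t)"
proof -
  have "continuous_on (ball 0 R) (\<theta> t)" for R
    unfolding \<theta>_def
  proof (rule uniform_limit_theorem[OF _ Weierstrass_m_test_general])
    show "(\<lambda>v. exp (t * R\<^sup>2) * exp (- (t / 2 * (norm (0 + v))\<^sup>2))) summable_on L"
      using t by (intro summable_on_cmult_right summable_lattice_gaussian) simp
    show "norm (exp (- (t * (norm (q + v))\<^sup>2))) \<le> exp (t * R\<^sup>2) * exp (- (t / 2 * (norm (0 + v))\<^sup>2))"
      if q: "q \<in> ball 0 R" for v q :: "real^'d"
    proof -
      have "(norm v)\<^sup>2 \<le> (norm (q + v) + R)\<^sup>2"
        using norm_triangle_ineq[of "q + v" "- q"] q by (intro power_mono) auto
      also have "\<dots> \<le> 2 * (norm (q + v))\<^sup>2 + 2 * R\<^sup>2"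
        using sum_squares_bound[of "norm (q + v)" R] by (simp add: power2_sum)
      finally have "t / 2 * (norm v)\<^sup>2 \<le> t / 2 * (2 * (norm (q + v))\<^sup>2 + 2 * R\<^sup>2)"
        using t by (intro mult_left_mono) auto
      then show ?thesis unfolding exp_add[symmetric] real_norm_def abs_exp_cancel exp_le_cancel_iff
        by (simp add: algebra_simps)
    qed
  qed (auto intro!: always_eventually continuous_intros)
  then have "continuous_on (\<Union>R. ball 0 R) (\<theta> t)"
    by (intro continuous_on_open_UN) auto
  moreover have "(\<Union>R. ball 0 R) = (UNIV :: (real^'d) set)"
    by (auto intro: gt_ex)
  ultimately show ?thesis by simp
qed

end

section \<open>Fourier series on the torus\<close>

text \<open>The character of frequency \<open>w\<close>, written like the exponential in
  \<open>riesz_dual_sum\<close>. The form \<open>ch_eq\<close> suits Fourier integrals, and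
  \<open>ch_cis\<close> suits periodicity and cosines.\<close>

definition ch :: "'a::euclidean_space \<Rightarrow> 'a \<Rightarrow> complex" where
  "ch w x = exp (2 * of_real pi * \<i> * of_real (w \<bullet> x))"

lemma ch_eq: "ch w x = iexp (2 * pi * (w \<bullet> x))"
  by (simp add: ch_def mult_ac)

lemma ch_cis: "ch w x = cis (2 * pi * (w \<bullet> x))"
  by (simp add: ch_eq cis_conv_exp)

lemma norm_ch [simp]: "norm (ch w x) = 1"
  by (simp add: ch_eq)

lemma ch_0_left [simp]: "ch 0 x = 1"
  by (simp add: ch_def)

lemma ch_add_left: "ch (w + w') x = ch w x * ch w' x"
  by (simp add: ch_def inner_add_left distrib_left exp_add)

lemma ch_add_right: "ch w (x + y) = ch w x * ch w y"
  by (simp add: ch_def inner_add_right distrib_left exp_add)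

lemma continuous_ch [continuous_intros]:
  "continuous_on A f \<Longrightarrow> continuous_on A (\<lambda>x. ch w (f x))"
  unfolding ch_def by (intro continuous_intros)

lemma borel_measurable_ch [measurable]: "ch w \<in> borel_measurable borel"
  by (intro borel_measurable_continuous_onI continuous_intros)

lemma ch_plus_ch_uminus: "ch w x + ch (- w) x = of_real (2 * cos (2 * pi * (w \<bullet> x)))"
  by (simp add: ch_cis complex_eq_iff)

context unimodular_lattice
begin

lemma ch_lattice: "w \<in> D \<Longrightarrow> v \<in> L \<Longrightarrow> ch w v = 1"
  unfolding ch_cis dual_lattice_def by (auto intro!: cis_multiple_2pi)

lemma ch_periodic: "w \<in> D \<Longrightarrow> v \<in> L \<Longrightarrow> ch w (x + v) = ch w x"
  by (simp add: ch_add_right ch_lattice)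

lemma D_0 [simp]: "0 \<in> D"
  and D_add: "w \<in> D \<Longrightarrow> w' \<in> D \<Longrightarrow> w + w' \<in> D"
  and D_uminus [simp]: "- w \<in> D \<longleftrightarrow> w \<in> D"
  by (auto simp: dual_lattice_def inner_add_left inner_diff_left)

text \<open>The rows of \<open>U\<close> are the basis dual to the columns of \<open>V\<close>:
  their products with a vector are its lattice coordinates. They serve as the frequencies of the
  peaked polynomial below.\<close>

lemma row_U_in_D: "row j U \<in> D"
  by (auto simp: dual_lattice_def mem_lattice_iff matrix_vector_mul_component[symmetric] row_def)

text \<open>For w \<noteq> 0, a shift by \<open>a\<close> with \<open>w \<bullet> a = 1 / 2\<close>
  changes the sign of the character but not its integral over a period.\<close>

lemma integral_ch:
  assumes "w \<in> D"
  shows "(LINT x:\<Omega>|lborel. ch w x) = (if w = 0 then 1 else 0)"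
proof (cases "w = 0")
  case True
  then show ?thesis
    by (simp add: set_lebesgue_integral_def measure_def emeasure_fundamental_domain)
next
  case False
  define a where "a = (1 / (2 * (w \<bullet> w))) *\<^sub>R w"
  have "w \<bullet> a = 1 / 2" using False by (simp add: a_def)
  then have "2 * pi * (w \<bullet> a) = pi" by simp
  then have cha: "ch w a = -1" by (simp only: ch_cis cis_pi)
  have "(LINT x:\<Omega>|lborel. ch w (x + a)) = (LINT x:\<Omega>|lborel. ch w x)"
    using assms by (intro integral_fundamental_domain_shift set_integrable_fundamental_domain continuous_intros)
      (auto simp: ch_periodic)
  then have "- (LINT x:\<Omega>|lborel. ch w x) = (LINT x:\<Omega>|lborel. ch w x)"
    by (simp add: ch_add_right cha set_lebesgue_integral_def)
  then show ?thesis using False by simp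
qed

text \<open>All integrals of \<open>h * P ^ N\<close> vanish. Yet they receive a positive
  contribution of order \<open>p1 ^ N\<close> near the peak, while negative values of
  \<open>h\<close> contribute at most order \<open>p2 ^ N\<close> with
  \<open>p2 < p1\<close>.\<close>

lemma fourier_uniqueness:
  fixes f :: "real^'d \<Rightarrow> complex"
  assumes cont: "continuous_on UNIV f" and per: "\<And>x v. v \<in> L \<Longrightarrow> f (x + v) = f x"
    and coeff: "\<And>w. w \<in> D \<Longrightarrow> (LINT x:\<Omega>|lborel. f x * ch w x) = 0"
  shows "f x0 = 0"
proof (rule ccontr)
  assume "f x0 \<noteq> 0"
  \<comment> \<open>Multiplying by the conjugate of \<open>f x0\<close> makes the real part at
    \<open>x0\<close> equal to the squared modulus, hence positive.\<close>
  define h where "h x = Re (cnj (f x0) * f x)" for x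
  define c where "c = h x0"
  have c: "c > 0"
    using \<open>f x0 \<noteq> 0\<close> by (simp add: c_def h_def complex_eq_iff sum_squares_gt_zero_iff)
  have cont_h: "continuous_on UNIV h" unfolding h_def by (intro continuous_intros cont)
  have per_h: "h (x + v) = h x" if "v \<in> L" for x v using per[OF that] by (simp add: h_def)
  \<comment> \<open>Each summand reaches its maximum 2 exactly where a lattice coordinate of
    \<open>x - x0\<close> is an integer, so \<open>P\<close> is maximal exactly on
    \<open>x0 + L\<close>. The added 1 keeps \<open>P\<close> nonnegative, hence its powers
    monotone.\<close>
  define P where "P x = (\<Sum>j\<in>UNIV. 1 + cos (2 * pi * (row j U \<bullet> (x - x0))))" for x
  have cont_P: "continuous_on UNIV P" unfolding P_def by (intro continuous_intros)
  have P_nonneg: "0 \<le> P x" for x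
    unfolding P_def
  proof (rule sum_nonneg)
    show "0 \<le> 1 + cos (2 * pi * (row j U \<bullet> (x - x0)))" for j
      using cos_ge_minus_one[of "2 * pi * (row j U \<bullet> (x - x0))"] by linarith
  qed
  have P_max: "P x \<le> 2 * real CARD('d)" for x
    unfolding P_def using sum_mono[of UNIV "\<lambda>j. 1 + cos (2 * pi * (row j U \<bullet> (x - x0)))" "\<lambda>_. 2"] by simp
  have P_x0: "P x0 = 2 * real CARD('d)" by (simp add: P_def)
  have P_eq: "of_real (P x) = (\<Sum>j\<in>UNIV. 1 + ch (row j U) (- x0) / 2 * ch (row j U) x
      + ch (- row j U) (- x0) / 2 * ch (- row j U) x)" for x
  proof -
    have "of_real (1 + cos (2 * pi * (w \<bullet> (x - x0)))) = 1 + ch w (- x0) / 2 * ch w x + ch (- w) (- x0) / 2 * ch (- w) x" for w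
    proof -
      have "of_real (1 + cos (2 * pi * (w \<bullet> (x - x0)))) = 1 + (ch w (x + - x0) + ch (- w) (x + - x0)) / 2"
        by (subst ch_plus_ch_uminus) simp
      then show ?thesis unfolding ch_add_right by (simp add: field_simps)
    qed
    then show ?thesis unfolding P_def of_real_sum by (intro sum.cong) auto
  qed
  \<comment> \<open>The frequency \<open>w\<close> must be arbitrary in the induction, since a
    factor \<open>P\<close> moves it by plus or minus a row of \<open>U\<close>.\<close>
  have moments: "(LINT x:\<Omega>|lborel. f x * of_real (P x) ^ N * ch w x) = 0" if "w \<in> D" for N w
    using that
  proof (induction N arbitrary: w)
    case 0
    then show ?case by (simp add: coeff)
  next
    case (Suc N)
    define I where "I w = (\<lambda>x. f x * of_real (P x) ^ N * ch w x)" for w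
    have int: "set_integrable lborel \<Omega> (I w)" for w
      unfolding I_def by (intro set_integrable_fundamental_domain continuous_intros cont cont_P)
    have eq: "f x * of_real (P x) ^ Suc N * ch w x
        = (\<Sum>j\<in>UNIV. I w x + ch (row j U) (- x0) / 2 * I (row j U + w) x + ch (- row j U) (- x0) / 2 * I (- row j U + w) x)" for x
    proof -
      have "f x * of_real (P x) ^ Suc N * ch w x = I w x * of_real (P x)" by (simp add: I_def)
      also have "\<dots> = (\<Sum>j\<in>UNIV. I w x * (1 + ch (row j U) (- x0) / 2 * ch (row j U) x
      + ch (- row j U) (- x0) / 2 * ch (- row j U) x))"
        by (simp only: P_eq sum_distrib_left)
      also have "\<dots> = (\<Sum>j\<in>UNIV. I w x + ch (row j U) (- x0) / 2 * I (row j U + w) x + ch (- row j U) (- x0) / 2 * I (- row j U + w) x)"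
        by (rule sum.cong) (simp_all only: I_def ch_add_left distrib_left mult_1_left mult_1_right mult_ac)
      finally show ?thesis .
    qed
    have 0: "(LINT x:\<Omega>|lborel. I w' x) = 0" if "w' \<in> D" for w'
      using Suc.IH[OF that] by (simp add: I_def)
    define Z where "Z w' = (\<lambda>x. indicator \<Omega> x *\<^sub>R I w' x)" for w'
    have int_Z: "integrable lborel (Z w')" for w'
      using int by (simp add: set_integrable_def Z_def)
    have Z_0: "integral\<^sup>L lborel (Z w') = 0" if "w' \<in> D" for w'
      using 0[OF that] by (simp add: set_lebesgue_integral_def Z_def)
    have "(LINT x:\<Omega>|lborel. f x * of_real (P x) ^ Suc N * ch w x)
      = (\<integral>x. (\<Sum>j\<in>UNIV. Z w x + ch (row j U) (- x0) / 2 * Z (row j U + w) x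
         + ch (- row j U) (- x0) / 2 * Z (- row j U + w) x) \<partial>lborel)"
      unfolding set_lebesgue_integral_def eq Z_def
      by (simp only: scaleR_sum_right scaleR_add_right mult_scaleR_right)
    also have "\<dots> = (\<Sum>j\<in>UNIV. \<integral>x. Z w x + ch (row j U) (- x0) / 2 * Z (row j U + w) x
         + ch (- row j U) (- x0) / 2 * Z (- row j U + w) x \<partial>lborel)"
      by (intro Bochner_Integration.integral_sum Bochner_Integration.integrable_add
          integrable_mult_right int_Z)
    also have "\<dots> = (\<Sum>j\<in>(UNIV :: 'd set). 0)"
    proof (rule sum.cong)
      fix j
      have D': "row j U + w \<in> D" "- row j U + w \<in> D"
        by (intro D_add D_uminus[THEN iffD2] row_U_in_D Suc.prems)+
      show "(\<integral>x. Z w x + ch (row j U) (- x0) / 2 * Z (row j U + w) x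
         + ch (- row j U) (- x0) / 2 * Z (- row j U + w) x \<partial>lborel) = 0"
        by (simp only: Bochner_Integration.integral_add Bochner_Integration.integrable_add
          integrable_mult_right int_Z integral_mult_right_zero Z_0[OF D'(1)] Z_0[OF D'(2)] Z_0[OF Suc.prems])
           simp
    qed simp
    finally show ?case by simp
  qed
  have hP: "(LINT x:\<Omega>|lborel. h x * P x ^ N) = 0" for N
  proof -
    have "(LINT x:\<Omega>|lborel. f x * of_real (P x) ^ N) = 0"
      using moments[OF D_0, of N] by simp
    then have "(LINT x:\<Omega>|lborel. cnj (f x0) * (f x * of_real (P x) ^ N)) = 0" by simp
    moreover have "set_integrable lborel \<Omega> (\<lambda>x. cnj (f x0) * (f x * of_real (P x) ^ N))"
      by (intro set_integrable_fundamental_domain continuous_intros cont cont_P)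
    ultimately have "(\<integral>x. Re (indicator \<Omega> x *\<^sub>R (cnj (f x0) * (f x * of_real (P x) ^ N))) \<partial>lborel) = 0"
      unfolding set_lebesgue_integral_def set_integrable_def by (subst integral_Re) auto
    moreover have "Re (indicator \<Omega> x *\<^sub>R (cnj (f x0) * (f x * of_real (P x) ^ N))) = indicator \<Omega> x *\<^sub>R (h x * P x ^ N)" for x
      by (simp only: h_def mult.assoc[symmetric] scaleR_complex.sel of_real_power[symmetric])
         (simp add: mult.assoc[symmetric])
    ultimately show ?thesis by (simp only: set_lebesgue_integral_def)
  qed
  obtain K where K: "compact K" "\<Omega> \<subseteq> K" by (rule compact_superset_fundamental_domain)
  have "bounded (h ` K)"
    by (intro compact_imp_bounded compact_continuous_image K continuous_on_subset[OF cont_h]) simp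
  then obtain M where M: "M > 0" "\<And>x. x \<in> K \<Longrightarrow> \<bar>h x\<bar> \<le> M"
    by (metis bounded_pos imageI real_norm_def)
  \<comment> \<open>The part of \<open>K\<close> where \<open>h\<close> is not safely positive. It
    is compact and avoids the peak, so \<open>P\<close> stays below a bound \<open>p2\<close>
    smaller than the maximum.\<close>
  define B where "B = K \<inter> {x. h x \<le> c / 2}"
  have "compact B"
    unfolding B_def by (intro compact_Int_closed K closed_Collect_le cont_h continuous_intros)
  have P_less: "P x < 2 * real CARD('d)" if "x \<in> B" for x
  proof (rule ccontr)
    assume "\<not> P x < 2 * real CARD('d)"
    then have "P x = 2 * real CARD('d)" using P_max[of x] by simp
    then have "(\<Sum>j\<in>UNIV. 1 - cos (2 * pi * (row j U \<bullet> (x - x0)))) = 0"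
      by (simp add: P_def sum.distrib sum_subtractf)
    then have "cos (2 * pi * (row j U \<bullet> (x - x0))) = 1" for j
      by (subst (asm) sum_nonneg_eq_0_iff) auto
    moreover have "a \<in> \<int>" if "cos (2 * pi * a) = 1" for a
    proof -
      obtain n :: int where "2 * pi * a = of_int n * 2 * pi"
        using \<open>cos (2 * pi * a) = 1\<close> by (auto simp: cos_one_2pi_int)
      then have "a = of_int n" by simp
      then show ?thesis by simp
    qed
    ultimately have "row j U \<bullet> (x - x0) \<in> \<int>" for j by blast
    then have "x - x0 \<in> L"
      by (simp add: mem_lattice_iff matrix_vector_mul_component row_def)
    from per_h[OF this, of x0] have "h x = c" by (simp add: c_def)
    with that c show False by (simp add: B_def)
  qed
  have d: "1 < 2 * real CARD('d)"
    using zero_less_card_finite[where 'a = 'd] by linarith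
  \<comment> \<open>The lower bound 1 keeps \<open>p2\<close> positive for the later division, also
    when \<open>B\<close> is empty; it is still below the maximum of \<open>P\<close>.\<close>
  obtain p2 where p2: "p2 < 2 * real CARD('d)" "\<And>x. x \<in> B \<Longrightarrow> P x \<le> p2" "p2 > 0"
  proof (cases "B = {}")
    case True
    then show ?thesis by (intro that[of 1]) (use d in auto)
  next
    case False
    obtain b where b: "b \<in> B" "\<And>x. x \<in> B \<Longrightarrow> P x \<le> P b"
      using continuous_attains_sup[OF \<open>compact B\<close> False continuous_on_subset[OF cont_P]] by auto
    then show ?thesis
      by (intro that[of "max 1 (P b)"]) (use P_less[OF b(1)] d b(2) in \<open>auto intro: max.coboundedI2\<close>)
  qed
  define p1 where "p1 = (p2 + 2 * real CARD('d)) / 2"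
  have p1: "p2 < p1" "p1 < 2 * real CARD('d)" using p2 by (auto simp: p1_def)
  define W where "W = {x. P x > p1}"
  have "open W" unfolding W_def by (intro open_Collect_less cont_P continuous_intros)
  then have [measurable]: "W \<in> sets borel" by simp
  have "x0 \<in> W" using p1 P_x0 by (simp add: W_def)
  \<comment> \<open>\<open>x0\<close> need not lie in \<Omega>. But \<open>W\<close> is invariant
    under the lattice, so if its trace on \<Omega> were null, tiling would make the whole open set
    \<open>W\<close> null.\<close>
  have W_pos: "emeasure lborel (\<Omega> \<inter> W) \<noteq> 0"
  proof
    assume 0: "emeasure lborel (\<Omega> \<inter> W) = 0"
    have P_per: "P (x + v) = P x" if "v \<in> L" for x v
    proof -
      have "of_real (P (x + v)) = (of_real (P x) :: complex)"
        unfolding P_eq using that by (simp add: ch_periodic row_U_in_D)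
      then show ?thesis by (simp only: of_real_eq_iff)
    qed
    have "emeasure lborel W = (\<integral>\<^sup>+x. indicator W x \<partial>lborel)" by simp
    also have "\<dots> = (\<Sum>\<^sub>\<infinity>v\<in>L. \<integral>\<^sup>+x\<in>\<Omega>. indicator W (x + v) \<partial>lborel)"
      by (rule nn_integral_tiling) measurable
    also have "\<dots> = (\<Sum>\<^sub>\<infinity>v\<in>L. \<integral>\<^sup>+x. indicator (\<Omega> \<inter> W) x \<partial>lborel)"
      by (intro infsum_cong nn_integral_cong) (auto simp: indicator_def W_def P_per)
    also have "\<dots> = 0" using 0 by simp
    finally have "negligible W"
      by (simp add: negligible_iff_null_sets null_sets_def)
    with open_not_negligible[OF \<open>open W\<close>] \<open>x0 \<in> W\<close> show False by auto
  qed
  have \<Omega>_fin: "emeasure lborel (\<Omega> \<inter> W) < \<infinity>"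
    using emeasure_mono[of "\<Omega> \<inter> W" \<Omega> lborel] by (simp add: emeasure_fundamental_domain order_le_less_trans[OF _ ennreal_one_less_top])
  define m where "m = measure lborel (\<Omega> \<inter> W)"
  have m: "m > 0"
    using W_pos \<Omega>_fin by (simp add: m_def measure_def enn2real_positive_iff zero_less_iff_neq_zero)
  have ineq: "c / 2 * p1 ^ N * m \<le> M * p2 ^ N" for N
  proof -
    \<comment> \<open>On \<open>B\<close> the product is at least \<open>- (M * p2 ^ N)\<close> and
      \<open>W\<close> is avoided. Off \<open>B\<close> it is nonnegative, and on \<open>W\<close>
      at least \<open>c / 2 * p1 ^ N\<close>. The subtracted constant may be spread over all of
      \<Omega>, which has volume 1.\<close>
    have "indicator (\<Omega> \<inter> W) x * (c / 2 * p1 ^ N) - indicator \<Omega> x * (M * p2 ^ N) \<le> indicator \<Omega> x *\<^sub>R (h x * P x ^ N)" for x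
    proof (cases "x \<in> \<Omega>")
      case x: True
      with K have xK: "x \<in> K" by auto
      show ?thesis
      proof (cases "x \<in> B")
        case True
        then have "x \<notin> W" using p2(2) p1 by (fastforce simp: W_def)
        moreover have "- (M * p2 ^ N) \<le> h x * P x ^ N"
        proof -
          have "\<bar>h x * P x ^ N\<bar> \<le> M * p2 ^ N"
            unfolding abs_mult using M(2)[OF xK] p2(2)[OF True] P_nonneg[of x] M(1)
            by (intro mult_mono) (auto intro: power_mono)
          then show ?thesis by simp
        qed
        ultimately show ?thesis using x by simp
      next
        case False
        then have hx: "h x > c / 2" using xK by (auto simp: B_def)
        have "indicator W x * (c / 2 * p1 ^ N) \<le> h x * P x ^ N"
        proof (cases "x \<in> W")
          case True
          then have "p1 ^ N \<le> P x ^ N"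
            using p1 p2 by (intro power_mono) (auto simp: W_def)
          then have "c / 2 * p1 ^ N \<le> h x * P x ^ N"
            using hx c p1 p2 by (intro mult_mono) auto
          then show ?thesis using True by simp
        next
          case False
          then show ?thesis using hx c P_nonneg[of x] by simp
        qed
        moreover have "0 \<le> M * p2 ^ N" using M p2 by simp
        ultimately show ?thesis using x by (simp add: indicator_inter_arith)
      qed
    qed (simp add: indicator_inter_arith)
    moreover have "integrable lborel (\<lambda>x. indicator (\<Omega> \<inter> W) x * (c / 2 * p1 ^ N) - indicator \<Omega> x * (M * p2 ^ N))"
      using \<Omega>_fin by (intro Bochner_Integration.integrable_diff integrable_mult_left)
        (auto simp: emeasure_fundamental_domain)
    moreover have "integrable lborel (\<lambda>x. indicator \<Omega> x *\<^sub>R (h x * P x ^ N))"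
      using set_integrable_fundamental_domain[of "\<lambda>x. h x * P x ^ N"]
      by (simp add: set_integrable_def cont_h cont_P continuous_on_mult continuous_on_power)
    ultimately have "(\<integral>x. indicator (\<Omega> \<inter> W) x * (c / 2 * p1 ^ N) - indicator \<Omega> x * (M * p2 ^ N) \<partial>lborel)
        \<le> (\<integral>x. indicator \<Omega> x *\<^sub>R (h x * P x ^ N) \<partial>lborel)"
      by (intro integral_mono) auto
    also have "\<dots> = 0" using hP[of N] by (simp add: set_lebesgue_integral_def)
    also have "(\<integral>x. indicator (\<Omega> \<inter> W) x * (c / 2 * p1 ^ N) - indicator \<Omega> x * (M * p2 ^ N) \<partial>lborel)
        = m * (c / 2 * p1 ^ N) - M * p2 ^ N"
      using \<Omega>_fin by (subst Bochner_Integration.integral_diff)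
        (auto simp: m_def measure_def[of _ \<Omega>] emeasure_fundamental_domain)
    finally show ?thesis by (simp add: mult_ac)
  qed
  obtain N where "2 * M / (c * m) < (p1 / p2) ^ N"
    using real_arch_pow[of "p1 / p2"] p1 p2 by auto
  then have "M * p2 ^ N < c / 2 * p1 ^ N * m"
    using c m p2 by (simp add: power_divide field_simps)
  with ineq[of N] show False by simp
qed

end

section \<open>Poisson summation\<close>

context unimodular_lattice
begin

lemma summable_dual_gaussian:
  assumes "t > 0"
  shows "(\<lambda>w. exp (- (t * (norm w)\<^sup>2))) summable_on D"
  using unimodular_lattice.summable_lattice_gaussian[OF dual assms, of 0] by (simp add: dual_lattice_eq)

text \<open>The Fourier transform of the Gaussian with parameter \<open>t\<close>; it is also the
  integrand in the dual series of the kernel.\<close>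

definition gauss_hat :: "real \<Rightarrow> real^'d \<Rightarrow> real" where
  "gauss_hat t w = (pi / t) powr (real CARD('d) / 2) * exp (- (pi\<^sup>2 * (norm w)\<^sup>2 / t))"

lemma gauss_hat_nonneg: "0 \<le> gauss_hat t w"
  by (simp add: gauss_hat_def)

lemma gauss_hat_uminus [simp]: "gauss_hat t (- w) = gauss_hat t w"
  by (simp add: gauss_hat_def)

lemma summable_gauss_hat:
  assumes t: "t > 0"
  shows "gauss_hat t summable_on D"
  unfolding gauss_hat_def[abs_def]
  using summable_dual_gaussian[of "pi\<^sup>2 / t"] t by (intro summable_on_cmult_right) simp

lemma integral_gaussian_ch:
  fixes w :: "real^'d"
  assumes t: "t > 0"
  shows "integrable lborel (\<lambda>x. exp (- (t * (norm x)\<^sup>2)) *\<^sub>R ch w x)"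
    and "(\<integral>x. exp (- (t * (norm x)\<^sup>2)) *\<^sub>R ch w x \<partial>lborel) = of_real (gauss_hat t w)"
proof -
  have ch: "ch w x = iexp ((2 * pi) *\<^sub>R w \<bullet> x)" for x
    by (simp add: ch_eq)
  show "integrable lborel (\<lambda>x. exp (- (t * (norm x)\<^sup>2)) *\<^sub>R ch w x)"
    unfolding ch by (rule integrable_gaussian[OF t])
  have "(norm ((2 * pi) *\<^sub>R w))\<^sup>2 / (4 * t) = pi\<^sup>2 * (norm w)\<^sup>2 / t"
    by (simp add: power_mult_distrib)
  then show "(\<integral>x. exp (- (t * (norm x)\<^sup>2)) *\<^sub>R ch w x \<partial>lborel) = of_real (gauss_hat t w)"
    unfolding ch integral_gaussian[OF t] gauss_hat_def by simp
qed

text \<open>Unfolding: the Fourier coefficient of a periodized function is the Fourier transform of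
  the function itself.\<close>

lemma integral_\<theta>_ch:
  assumes t: "t > 0" and w: "w \<in> D"
  shows "(LINT x:\<Omega>|lborel. of_real (\<theta> t x) * ch w x) = of_real (gauss_hat t w)"
proof -
  \<comment> \<open>The character is evaluated at \<open>x + v\<close>, so that the integrals of
    \<open>f v\<close> are the pieces of one tiled integral; by periodicity it equals
    \<open>ch w x\<close>.\<close>
  define f where "f v x = indicator \<Omega> x *\<^sub>R (exp (- (t * (norm (x + v))\<^sup>2)) *\<^sub>R ch w (x + v))" for v x
  have int: "integrable lborel (f v)" for v
    using set_integrable_fundamental_domain[of "\<lambda>x. exp (- (t * (norm (x + v))\<^sup>2)) *\<^sub>R ch w (x + v)"]
    unfolding f_def set_integrable_def by (simp add: continuous_intros)
  have abs: "(\<lambda>v. norm (f v x)) summable_on L" for x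
    using summable_lattice_gaussian[OF t, of x] unfolding f_def
    by (simp add: summable_on_cmult_right)
  have "(\<Sum>\<^sub>\<infinity>v\<in>L. ennreal (\<integral>x. norm (f v x) \<partial>lborel))
      = (\<Sum>\<^sub>\<infinity>v\<in>L. \<integral>\<^sup>+x\<in>\<Omega>. ennreal (exp (- (t * (norm (x + v))\<^sup>2))) \<partial>lborel)"
  proof (rule infsum_cong)
    fix v
    have "ennreal (\<integral>x. norm (f v x) \<partial>lborel) = (\<integral>\<^sup>+x. ennreal (norm (f v x)) \<partial>lborel)"
      by (rule nn_integral_eq_integral[symmetric]) (use integrable_norm[OF int] in simp_all)
    also have "\<dots> = (\<integral>\<^sup>+x\<in>\<Omega>. ennreal (exp (- (t * (norm (x + v))\<^sup>2))) \<partial>lborel)"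
      by (intro nn_integral_cong) (simp add: f_def indicator_def)
    finally show "ennreal (\<integral>x. norm (f v x) \<partial>lborel) = \<dots>" .
  qed
  also have "\<dots> = (\<integral>\<^sup>+x. ennreal (exp (- (t * (norm (x :: real^'d))\<^sup>2))) \<partial>lborel)"
    by (rule nn_integral_tiling[symmetric]) measurable
  also have "\<dots> < \<infinity>" by (simp add: nn_integral_gaussian[OF t])
  finally have summ: "(\<lambda>v. \<integral>x. norm (f v x) \<partial>lborel) summable_on L"
    by (rule summable_on_if_infsum_ennreal) simp
  have "(LINT x:\<Omega>|lborel. of_real (\<theta> t x) * ch w x) = (\<integral>x. (\<Sum>\<^sub>\<infinity>v\<in>L. f v x) \<partial>lborel)"
    unfolding set_lebesgue_integral_def
  proof (rule Bochner_Integration.integral_cong)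
    fix x
    have "(\<Sum>\<^sub>\<infinity>v\<in>L. f v x) = (\<Sum>\<^sub>\<infinity>v\<in>L. of_real (exp (- (t * (norm (x + v))\<^sup>2))) * (indicator \<Omega> x *\<^sub>R ch w x))"
      by (intro infsum_cong) (simp add: f_def ch_periodic w scaleR_conv_of_real mult_ac)
    also have "\<dots> = (\<Sum>\<^sub>\<infinity>v\<in>L. of_real (exp (- (t * (norm (x + v))\<^sup>2)))) * (indicator \<Omega> x *\<^sub>R ch w x)"
      by (rule infsum_cmult_left')
    also have "(\<Sum>\<^sub>\<infinity>v\<in>L. of_real (exp (- (t * (norm (x + v))\<^sup>2)))) = (of_real (\<theta> t x) :: complex)"
      unfolding \<theta>_def using summable_lattice_gaussian[OF t, of x]
      by (intro infsumI has_sum_of_real has_sum_infsum)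
    finally show "indicator \<Omega> x *\<^sub>R (of_real (\<theta> t x) * ch w x) = (\<Sum>\<^sub>\<infinity>v\<in>L. f v x)" by simp
  qed simp
  also have "\<dots> = (\<Sum>\<^sub>\<infinity>v\<in>L. \<integral>x. f v x \<partial>lborel)"
    by (rule integral_infsum[OF lborel.sigma_finite_measure_axioms countable_L int abs summ])
  also have "\<dots> = (\<integral>x. exp (- (t * (norm x)\<^sup>2)) *\<^sub>R ch w x \<partial>lborel)"
    unfolding f_def using integral_tiling[OF integral_gaussian_ch(1)[OF t, of w]]
    by (simp add: set_lebesgue_integral_def)
  finally show ?thesis using integral_gaussian_ch(2)[OF t] by simp
qed

lemma norm_gauss_hat_ch [simp]: "norm (of_real (gauss_hat t w) * ch w' x) = gauss_hat t w"
  by (simp add: norm_mult gauss_hat_nonneg)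

lemma summable_gauss_hat_ch:
  assumes t: "t > 0" and S: "S \<subseteq> D"
  shows "(\<lambda>w. of_real (gauss_hat t w) * ch w x) summable_on S"
  by (rule abs_summable_summable)
     (use summable_on_subset[OF summable_gauss_hat[OF t] S] in simp)

text \<open>Both sides are continuous and periodic with the same coefficients. On the dual side
  these can be read off because the series converges absolutely and uniformly.\<close>

theorem poisson_gaussian:
  assumes t: "t > 0"
  shows "of_real (\<theta> t x) = (\<Sum>\<^sub>\<infinity>w\<in>D. of_real (gauss_hat t w) * ch w x)"
proof -
  define \<psi> where "\<psi> x = (\<Sum>\<^sub>\<infinity>w\<in>D. of_real (gauss_hat t w) * ch w x)" for x
  have cont: "continuous_on UNIV \<psi>"
    unfolding \<psi>_def
  proof (rule uniform_limit_theorem[OF _ Weierstrass_m_test_general])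
    show "gauss_hat t summable_on D" by (rule summable_gauss_hat[OF t])
  qed (auto intro!: always_eventually continuous_intros)
  have \<psi>_ch: "(LINT x:\<Omega>|lborel. \<psi> x * ch w x) = of_real (gauss_hat t w)" if w: "w \<in> D" for w
  proof -
    define f where "f u x = indicator \<Omega> x *\<^sub>R (of_real (gauss_hat t u) * ch (u + w) x)" for u x
    have int: "integrable lborel (f u)" for u
      using set_integrable_fundamental_domain[of "\<lambda>x. of_real (gauss_hat t u) * ch (u + w) x"]
      unfolding f_def set_integrable_def by (simp add: continuous_intros)
    have abs: "(\<lambda>u. norm (f u x)) summable_on D" for x
      unfolding f_def by (simp add: summable_on_cmult_right summable_gauss_hat[OF t])
    have "(\<lambda>u. \<integral>x. norm (f u x) \<partial>lborel) = gauss_hat t"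
      by (rule ext) (simp add: f_def measure_def emeasure_fundamental_domain)
    with summable_gauss_hat[OF t] have summ: "(\<lambda>u. \<integral>x. norm (f u x) \<partial>lborel) summable_on D" by simp
    have "(LINT x:\<Omega>|lborel. \<psi> x * ch w x) = (\<integral>x. (\<Sum>\<^sub>\<infinity>u\<in>D. f u x) \<partial>lborel)"
      unfolding set_lebesgue_integral_def
    proof (rule Bochner_Integration.integral_cong)
      fix x
      have "(\<Sum>\<^sub>\<infinity>u\<in>D. f u x) = (\<Sum>\<^sub>\<infinity>u\<in>D. of_real (gauss_hat t u) * ch u x * (indicator \<Omega> x *\<^sub>R ch w x))"
        by (intro infsum_cong) (simp add: f_def ch_add_left mult_ac)
      also have "\<dots> = \<psi> x * (indicator \<Omega> x *\<^sub>R ch w x)"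
        unfolding \<psi>_def by (rule infsum_cmult_left')
      finally show "indicator \<Omega> x *\<^sub>R (\<psi> x * ch w x) = (\<Sum>\<^sub>\<infinity>u\<in>D. f u x)" by simp
    qed simp
    also have "\<dots> = (\<Sum>\<^sub>\<infinity>u\<in>D. \<integral>x. f u x \<partial>lborel)"
      by (rule integral_infsum[OF lborel.sigma_finite_measure_axioms countable_D int abs summ])
    also have "\<dots> = (\<Sum>\<^sub>\<infinity>u\<in>D. of_real (gauss_hat t u) * (if u + w = 0 then 1 else 0))"
    proof (rule infsum_cong)
      fix u assume "u \<in> D"
      have "(\<integral>x. f u x \<partial>lborel) = of_real (gauss_hat t u) * (LINT x:\<Omega>|lborel. ch (u + w) x)"
        unfolding f_def set_lebesgue_integral_def mult_scaleR_right[symmetric] by (rule integral_mult_right_zero)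
      then show "(\<integral>x. f u x \<partial>lborel) = of_real (gauss_hat t u) * (if u + w = 0 then 1 else 0)"
        using integral_ch[OF D_add[OF \<open>u \<in> D\<close> w]] by simp
    qed
    \<comment> \<open>The coefficients are taken against \<open>ch w\<close> without conjugation, so
      the surviving frequency is \<open>u = - w\<close>; \<open>gauss_hat\<close> is even.\<close>
    also have "\<dots> = of_real (gauss_hat t w)"
      using w by (subst infsum_single[where i = "- w"]) (auto simp: add_eq_0_iff)
    finally show ?thesis .
  qed
  have "of_real (\<theta> t x) - \<psi> x = 0"
  proof (rule fourier_uniqueness[where f = "\<lambda>x. of_real (\<theta> t x) - \<psi> x"])
    show "continuous_on UNIV (\<lambda>x. of_real (\<theta> t x) - \<psi> x)"
      by (intro continuous_intros cont continuous_\<theta> t)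
    show "of_real (\<theta> t (x + v)) - \<psi> (x + v) = of_real (\<theta> t x) - \<psi> x" if "v \<in> L" for x v
      using that by (simp add: \<theta>_periodic \<psi>_def ch_periodic cong: infsum_cong)
    show "(LINT x:\<Omega>|lborel. (of_real (\<theta> t x) - \<psi> x) * ch w x) = 0" if w: "w \<in> D" for w
    proof -
      have "(LINT x:\<Omega>|lborel. of_real (\<theta> t x) * ch w x - \<psi> x * ch w x) = 0"
        by (subst set_integral_diff)
           (use t w in \<open>auto intro!: set_integrable_fundamental_domain continuous_intros cont continuous_\<theta>
             simp: integral_\<theta>_ch \<psi>_ch\<close>)
      then show ?thesis by (simp add: left_diff_distrib)
    qed
  qed
  then show ?thesis by (simp add: \<psi>_def)
qed

end

section \<open>The Mellin integral\<close>

lemma powr_mult_exp_bounded: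
  fixes a b :: real
  assumes b: "b > 0"
  obtains K where "K > 0" "\<And>x. x \<ge> 1 \<Longrightarrow> x powr a * exp (- (b * x)) \<le> K"
proof -
  have "((\<lambda>x. x powr a * exp (- (b * x))) \<longlongrightarrow> 0) at_top"
    using b by real_asymp
  then have "eventually (\<lambda>x. x powr a * exp (- (b * x)) < 1) at_top"
    by (rule order_tendstoD) simp
  then obtain T where T: "\<And>x. x \<ge> T \<Longrightarrow> x powr a * exp (- (b * x)) < 1"
    by (auto simp: eventually_at_top_linorder)
  have "continuous_on {1..T} (\<lambda>x. x powr a * exp (- (b * x)))"
    by (intro continuous_on_mult continuous_on_powr continuous_on_exp continuous_on_minus
        continuous_on_const continuous_on_id) auto
  then have "compact ((\<lambda>x. x powr a * exp (- (b * x))) ` {1..T})"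
    by (rule compact_continuous_image) simp
  then obtain B where B: "\<And>x. x \<in> {1..T} \<Longrightarrow> x powr a * exp (- (b * x)) \<le> B"
    using bounded_imp_bdd_above[OF compact_imp_bounded] by (fastforce simp: bdd_above_def)
  show ?thesis
  proof (rule that[of "max 1 B"])
    show "x powr a * exp (- (b * x)) \<le> max 1 B" if "x \<ge> 1" for x
      using T[of x] B[of x] that by (cases "x \<le> T") (auto simp: le_max_iff_disj)
  qed simp
qed

lemma has_bochner_integral_if_has_integral_nonneg:
  fixes f :: "'a::euclidean_space \<Rightarrow> real"
  assumes S[measurable]: "S \<in> sets borel" and [measurable]: "(\<lambda>x. indicator S x * f x) \<in> borel_measurable borel"
    and nn: "\<And>x. x \<in> S \<Longrightarrow> 0 \<le> f x" and int: "(f has_integral I) S"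
  shows "has_bochner_integral lborel (\<lambda>x. indicator S x * f x) I"
proof (rule has_bochner_integral_nn_integral)
  have nn': "0 \<le> indicator S x * f x" for x using nn by (simp add: indicator_def)
  show "I \<ge> 0" by (rule has_integral_nonneg[OF int nn])
  have "((\<lambda>x. indicator S x * f x) has_integral I) UNIV"
  proof -
    have "(\<lambda>x. if x \<in> S then f x else 0) = (\<lambda>x. indicator S x * f x)"
      by (simp add: fun_eq_iff indicator_def)
    with int show ?thesis by (metis has_integral_restrict_UNIV)
  qed
  from nn_integral_has_integral_lborel[OF _ nn' this]
  show "(\<integral>\<^sup>+x. ennreal (indicator S x * f x) \<partial>lborel) = ennreal I" by simp
  show "AE x in lborel. 0 \<le> indicator S x * f x" using nn' by simp
qed simp

text \<open>Puts Mellin integrands in the form exp (s ln t) dt/t, to which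
  \<open>holomorphic_integral_exp\<close> applies with the logarithm as \<open>X\<close>.\<close>

lemma powr_minus_one_eq:
  fixes t s :: real
  shows "t > 0 \<Longrightarrow> t powr (s - 1) = exp (s * ln t) / t"
  by (simp add: powr_diff) (simp add: powr_def)

section \<open>Separation, decay and the regularized theta function\<close>

context unimodular_lattice
begin

text \<open>The lattice is closed, being defined by integrality of continuous coordinates, so
  \<open>- q\<close> has positive distance from it.\<close>

lemma lattice_separated:
  assumes "q \<notin> L"
  obtains r where "r > 0" "\<And>v. v \<in> L \<Longrightarrow> r \<le> norm (q + v)"
proof -
  have "L = (\<Inter>i. (\<lambda>x. (U *v x) $ i) -` \<int>)" by (auto simp: mem_lattice_iff)
  also have "closed \<dots>"
    by (intro closed_INT ballI closed_vimage closed_Ints continuous_intros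
        matrix_vector_mult_linear_continuous_on)
  finally have "closed L" .
  moreover have "- q \<notin> L" using assms by simp
  ultimately obtain r where r: "r > 0" "\<forall>v\<in>L. r \<le> dist (- q) v"
    using separate_point_closed by blast
  show ?thesis
  proof (rule that[OF r(1)])
    show "r \<le> norm (q + v)" if "v \<in> L" for v
      using r(2)[rule_format, OF that] norm_minus_cancel[of "q + v"] by (simp add: dist_norm)
  qed
qed

text \<open>A nonzero \<open>w\<close> has a nonzero, hence at least unit size, integer product with
  some column of \<open>V\<close>; Cauchy-Schwarz then bounds \<open>norm w\<close> from
  below.\<close>

lemma dual_lattice_separated:
  obtains r where "r > 0" "\<And>w. w \<in> D - {0} \<Longrightarrow> r \<le> norm w"
proof -
  define R where "R = 1 + (\<Sum>j\<in>UNIV. norm (column j V))"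
  have R: "R > 0" by (simp add: R_def sum_nonneg add_pos_nonneg)
  have "1 / R \<le> norm w" if w: "w \<in> D - {0}" for w
  proof -
    have comp: "(transpose V *v w) $ j = w \<bullet> column j V" for j
      by (simp add: matrix_vector_mult_def transpose_def inner_vec_def column_def mult.commute del: transpose_matrix_vector)
    have "\<exists>j. (transpose V *v w) $ j \<noteq> 0"
    proof (rule ccontr)
      assume "\<nexists>j. (transpose V *v w) $ j \<noteq> 0"
      then have "transpose V *v w = 0" by (simp add: vec_eq_iff del: transpose_matrix_vector)
      then have "transpose U *v (transpose V *v w) = 0" by (simp del: transpose_matrix_vector)
      then have "w = 0"
        using unimodular_lattice.V_U[OF dual, of w] by (simp del: transpose_matrix_vector)
      with w show False by simp
    qed
    then obtain j where "w \<bullet> column j V \<noteq> 0" unfolding comp by blast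
    moreover have "w \<bullet> column j V \<in> \<int>"
      using w mem_dual_lattice_iff[of w] unfolding comp[symmetric] by blast
    ultimately have "1 \<le> \<bar>w \<bullet> column j V\<bar>" by (simp add: Ints_nonzero_abs_ge1)
    also have "\<dots> \<le> norm w * norm (column j V)" by (rule Cauchy_Schwarz_ineq2)
    also have "\<dots> \<le> norm w * R"
      unfolding R_def using member_le_sum[of j UNIV "\<lambda>j. norm (column j V)"]
      by (intro mult_left_mono) auto
    finally show ?thesis using R by (simp add: divide_le_eq)
  qed
  then show ?thesis using R by (intro that[of "1 / R"]) auto
qed

text \<open>Of the factor t in the exponent, t - 1 is spent on the gap \<open>r\<close> and gives
  the decay; the remaining 1 keeps the sum convergent.\<close>

lemma \<theta>_decay:
  assumes q: "q \<notin> L"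
  obtains C b where "C \<ge> 0" "b > 0" "\<And>t. t \<ge> 1 \<Longrightarrow> \<theta> t q \<le> C * exp (- (b * t))"
proof -
  obtain r where r: "r > 0" "\<And>v. v \<in> L \<Longrightarrow> r \<le> norm (q + v)" by (rule lattice_separated[OF q]) blast
  show ?thesis
  proof (rule that[of "exp (r\<^sup>2) * \<theta> 1 q" "r\<^sup>2"])
    fix t :: real assume t: "t \<ge> 1"
    have le: "exp (- (t * (norm (q + v))\<^sup>2)) \<le> exp (r\<^sup>2 - r\<^sup>2 * t) * exp (- (1 * (norm (q + v))\<^sup>2))" if "v \<in> L" for v
    proof -
      have "(t - 1) * r\<^sup>2 \<le> (t - 1) * (norm (q + v))\<^sup>2"
        using r(1) r(2)[OF that] t by (intro mult_left_mono power_mono) auto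
      then show ?thesis unfolding exp_add[symmetric] exp_le_cancel_iff by (simp add: algebra_simps)
    qed
    have "\<theta> t q \<le> (\<Sum>\<^sub>\<infinity>v\<in>L. exp (r\<^sup>2 - r\<^sup>2 * t) * exp (- (1 * (norm (q + v))\<^sup>2)))"
      unfolding \<theta>_def using t by (intro infsum_mono le summable_on_cmult_right summable_lattice_gaussian) auto
    also have "\<dots> = exp (r\<^sup>2 - r\<^sup>2 * t) * \<theta> 1 q"
      unfolding \<theta>_def by (rule infsum_cmult_right')
    finally show "\<theta> t q \<le> exp (r\<^sup>2) * \<theta> 1 q * exp (- (r\<^sup>2 * t))"
      by (simp add: exp_diff exp_minus field_simps)
  qed (use r in \<open>auto simp: \<theta>_nonneg\<close>)
qed

text \<open>The splitting of \<open>\<theta>_decay\<close> with 1/t in place of t. The gap is that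
  between 0 and the rest of the dual lattice, so the bound is free of \<open>q\<close>.\<close>

lemma dual_decay:
  obtains C b where "C \<ge> 0" "b > 0"
    "\<And>t. 0 < t \<Longrightarrow> t < 1 \<Longrightarrow> (\<Sum>\<^sub>\<infinity>w\<in>D - {0}. gauss_hat t w) \<le> C * (1 / t) powr (real CARD('d) / 2) * exp (- (b * (1 / t)))"
proof -
  obtain r where r: "r > 0" "\<And>w. w \<in> D - {0} \<Longrightarrow> r \<le> norm w" by (rule dual_lattice_separated) blast
  let ?b = "pi\<^sup>2 * r\<^sup>2"
  let ?S = "\<Sum>\<^sub>\<infinity>w\<in>D - {0}. exp (- (pi\<^sup>2 * (norm w)\<^sup>2))"
  have summ: "(\<lambda>w. exp (- (c * (norm w)\<^sup>2))) summable_on D - {0}" if "c > 0" for c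
    by (rule summable_on_subset[OF summable_dual_gaussian[OF that]]) auto
  show ?thesis
  proof (rule that[of "pi powr (real CARD('d) / 2) * (exp ?b * ?S)" ?b])
    fix t :: real assume t: "0 < t" "t < 1"
    have le: "exp (- (pi\<^sup>2 * (norm w)\<^sup>2 / t)) \<le> exp (?b - ?b * (1 / t)) * exp (- (pi\<^sup>2 * (norm w)\<^sup>2))" if "w \<in> D - {0}" for w
    proof -
      have "(1 / t - 1) * ?b \<le> (1 / t - 1) * (pi\<^sup>2 * (norm w)\<^sup>2)"
        using r(1) r(2)[OF that] t by (intro mult_left_mono power_mono) auto
      then show ?thesis unfolding exp_add[symmetric] exp_le_cancel_iff by (simp add: algebra_simps)
    qed
    have "(\<Sum>\<^sub>\<infinity>w\<in>D - {0}. exp (- (pi\<^sup>2 * (norm w)\<^sup>2 / t))) \<le> (\<Sum>\<^sub>\<infinity>w\<in>D - {0}. exp (?b - ?b * (1 / t)) * exp (- (pi\<^sup>2 * (norm w)\<^sup>2)))"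
      using t summ[of "pi\<^sup>2 / t"] summ[of "pi\<^sup>2"]
      by (intro infsum_mono le summable_on_cmult_right) auto
    also have "\<dots> = exp (?b - ?b * (1 / t)) * ?S" by (rule infsum_cmult_right')
    finally have "(pi / t) powr (real CARD('d) / 2) * (\<Sum>\<^sub>\<infinity>w\<in>D - {0}. exp (- (pi\<^sup>2 * (norm w)\<^sup>2 / t)))
        \<le> (pi / t) powr (real CARD('d) / 2) * (exp (?b - ?b * (1 / t)) * ?S)"
      by (intro mult_left_mono) auto
    moreover have p: "(pi / t) powr (real CARD('d) / 2) = pi powr (real CARD('d) / 2) * (1 / t) powr (real CARD('d) / 2)"
      using t by (simp add: powr_divide)
    moreover have e: "exp (?b - ?b * (1 / t)) = exp ?b * exp (- (?b * (1 / t)))"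
      by (simp flip: exp_add)
    ultimately show "(\<Sum>\<^sub>\<infinity>w\<in>D - {0}. gauss_hat t w)
        \<le> pi powr (real CARD('d) / 2) * (exp ?b * ?S) * (1 / t) powr (real CARD('d) / 2) * exp (- (?b * (1 / t)))"
      unfolding gauss_hat_def infsum_cmult_right' by (simp only: mult_ac)
  qed (use r in \<open>auto intro!: mult_nonneg_nonneg infsum_nonneg\<close>)
qed

text \<open>The removed term is the zero frequency of the Poisson sum. It is removed only below 1,
  where \<theta> would otherwise blow up; above 1 it would spoil the exponential decay.\<close>

definition \<phi> :: "real \<Rightarrow> real^'d \<Rightarrow> real" where
  "\<phi> t q = \<theta> t q - (if t < 1 then (pi / t) powr (real CARD('d) / 2) else 0)"

lemma \<phi>_dual:
  assumes "0 < t" "t < 1"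
  shows "of_real (\<phi> t q) = (\<Sum>\<^sub>\<infinity>w\<in>D - {0}. of_real (gauss_hat t w) * ch w q)"
proof -
  have "of_real (\<theta> t q) = (\<Sum>\<^sub>\<infinity>w\<in>insert 0 (D - {0}). of_real (gauss_hat t w) * ch w q)"
    using poisson_gaussian[OF assms(1), of q] by (simp add: insert_absorb)
  also have "\<dots> = of_real (gauss_hat t 0) * ch 0 q + (\<Sum>\<^sub>\<infinity>w\<in>D - {0}. of_real (gauss_hat t w) * ch w q)"
    by (intro infsum_insert summable_gauss_hat_ch assms) auto
  finally show ?thesis using assms by (simp add: \<phi>_def gauss_hat_def)
qed

lemma abs_\<phi>_le:
  assumes "0 < t" "t < 1"
  shows "\<bar>\<phi> t q\<bar> \<le> (\<Sum>\<^sub>\<infinity>w\<in>D - {0}. gauss_hat t w)"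
proof -
  have "\<bar>\<phi> t q\<bar> = norm (of_real (\<phi> t q) :: complex)" by simp
  also have "\<dots> \<le> (\<Sum>\<^sub>\<infinity>w\<in>D - {0}. gauss_hat t w)"
    unfolding \<phi>_dual[OF assms]
    by (rule norm_infsum_le[OF has_sum_infsum has_sum_infsum])
       (use summable_on_subset[OF summable_gauss_hat[OF assms(1)]] in
        \<open>auto intro!: summable_gauss_hat_ch assms\<close>)
  finally show ?thesis .
qed

text \<open>For \<open>t \<le> 0\<close> the series of \<open>\<theta> t q\<close> diverges and \<open>\<theta>\<close> has a junk value.\<close>

lemma measurable_\<theta> [measurable]: "(\<lambda>t. indicator {0<..} t * \<theta> t q) \<in> borel_measurable borel"
proof -
  have eq: "indicator {0<..} t * \<theta> t q
      = indicator {0<..} t * enn2real (\<Sum>\<^sub>\<infinity>v\<in>L. ennreal (exp (- (t * (norm (q + v))\<^sup>2))))" for t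
    using infsum_ennreal[OF summable_lattice_gaussian[of t q]] infsum_nonneg[of L "\<lambda>v. exp (- (t * (norm (q + v))\<^sup>2))"]
    by (cases "t > 0") (simp_all add: \<theta>_def)
  have [measurable]: "(\<lambda>t. \<Sum>\<^sub>\<infinity>v\<in>L. ennreal (exp (- (t * (norm (q + v))\<^sup>2)))) \<in> borel_measurable borel"
    by (intro borel_measurable_infsum_ennreal countable_L) measurable
  show ?thesis unfolding eq by measurable
qed

lemma measurable_\<phi> [measurable]: "(\<lambda>t. indicator {0<..} t * \<phi> t q) \<in> borel_measurable borel"
proof -
  have "(\<lambda>t. indicator {0<..} t * \<theta> t q - indicator {0<..<1} t * (pi / t) powr (real CARD('d) / 2)) \<in> borel_measurable borel"
    by measurable
  also have "(\<lambda>t. indicator {0<..} t * \<theta> t q - indicator {0<..<1} t * (pi / t) powr (real CARD('d) / 2))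
      = (\<lambda>t. indicator {0<..} t * \<phi> t q)"
    by (auto simp: \<phi>_def indicator_def fun_eq_iff)
  finally show ?thesis .
qed

text \<open>In terms of 1/t, exponential decay beats every power. The bound serves both the Mellin
  integral and the summability of \<open>dual_coeff\<close>.\<close>

lemma bounded_gauss_hat_near_0:
  obtains K where "K > 0"
    "\<And>t. 0 < t \<Longrightarrow> t < 1 \<Longrightarrow> (\<Sum>\<^sub>\<infinity>w\<in>D - {0}. gauss_hat t w) * t powr a \<le> K"
proof -
  obtain C b where C: "C \<ge> 0" and b: "b > 0"
    and le: "\<And>t. 0 < t \<Longrightarrow> t < 1 \<Longrightarrow> (\<Sum>\<^sub>\<infinity>w\<in>D - {0}. gauss_hat t w) \<le> C * (1 / t) powr (real CARD('d) / 2) * exp (- (b * (1 / t)))"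
    by (rule dual_decay) blast
  obtain K where K: "K > 0" "\<And>x. x \<ge> 1 \<Longrightarrow> x powr (real CARD('d) / 2 - a) * exp (- (b * x)) \<le> K"
    by (rule powr_mult_exp_bounded[OF b]) blast
  show ?thesis
  \<comment> \<open>The added 1 keeps the bound positive when \<open>C = 0\<close>.\<close>
  proof (rule that[of "C * K + 1"])
    fix t :: real assume t: "0 < t" "t < 1"
    have ta: "t powr a = (1 / t) powr (- a)"
      using t by (simp add: powr_divide powr_minus_divide)
    have "(\<Sum>\<^sub>\<infinity>w\<in>D - {0}. gauss_hat t w) * t powr a
        \<le> C * (1 / t) powr (real CARD('d) / 2) * exp (- (b * (1 / t))) * t powr a"
      using le[OF t] by (intro mult_right_mono) auto
    also have "\<dots> = C * ((1 / t) powr (real CARD('d) / 2 - a) * exp (- (b * (1 / t))))"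
      unfolding ta diff_conv_add_uminus powr_add by (simp only: mult_ac)
    also have "\<dots> \<le> C * K" using K(2)[of "1 / t"] t C by (intro mult_left_mono) auto
    finally show "(\<Sum>\<^sub>\<infinity>w\<in>D - {0}. gauss_hat t w) * t powr a \<le> C * K + 1" by simp
  qed (use C K in \<open>simp add: add_nonneg_pos\<close>)
qed

text \<open>The exponential moments of ln t demanded by \<open>holomorphic_integral_exp\<close>: exp
  (r |ln t|) is the power -r of t below 1 and the power r above 1.\<close>

lemma integrable_\<phi>:
  assumes q: "q \<notin> L"
  shows "integrable lborel (\<lambda>t. (indicator {0<..} t * \<bar>\<phi> t q\<bar> / t) * exp (r * \<bar>ln t\<bar>))"
proof -
  obtain C b where C: "C \<ge> 0" and b: "b > 0" and le: "\<And>t. t \<ge> 1 \<Longrightarrow> \<theta> t q \<le> C * exp (- (b * t))"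
    by (rule \<theta>_decay[OF q]) blast
  \<comment> \<open>Half of the decay rate absorbs the power of t, the other half is left for
    integrability.\<close>
  have b2: "b / 2 > 0" using b by simp
  obtain K1 where K1: "K1 > 0" "\<And>x. x \<ge> 1 \<Longrightarrow> x powr (r - 1) * exp (- (b / 2 * x)) \<le> K1"
    by (rule powr_mult_exp_bounded[OF b2]) blast
  obtain K2 where K2: "K2 > 0"
    "\<And>t. 0 < t \<Longrightarrow> t < 1 \<Longrightarrow> (\<Sum>\<^sub>\<infinity>w\<in>D - {0}. gauss_hat t w) * t powr (- r - 1) \<le> K2"
    by (rule bounded_gauss_hat_near_0) blast
  let ?g = "\<lambda>t. indicator {0<..<1} t * K2 + C * K1 * (indicator {1..} t * exp (- (b / 2) * t))"
  show ?thesis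
  proof (rule Bochner_Integration.integrable_bound)
    have "integrable lborel (\<lambda>t. indicator {1..} t * exp (- (b / 2) * t))"
      using has_bochner_integral_if_has_integral_nonneg[OF _ _ _ has_integral_exp_minus_to_infinity[OF b2, of 1]]
      by (auto simp: has_bochner_integral_iff)
    then show "integrable lborel ?g"
      by (intro Bochner_Integration.integrable_add integrable_mult_right integrable_mult_left) auto
    have "(\<lambda>t. \<bar>indicator {0<..} t * \<phi> t q\<bar> / t * exp (r * \<bar>ln t\<bar>)) \<in> borel_measurable borel"
      by measurable
    then show "(\<lambda>t. indicator {0<..} t * \<bar>\<phi> t q\<bar> / t * exp (r * \<bar>ln t\<bar>)) \<in> borel_measurable lborel"
      by (simp add: abs_mult)
    have "indicator {0<..} t * \<bar>\<phi> t q\<bar> / t * exp (r * \<bar>ln t\<bar>) \<le> ?g t" for t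
    proof -
      consider "t \<le> 0" | "0 < t" "t < 1" | "1 \<le> t" by linarith
      then show ?thesis
      proof cases
        case 1 then show ?thesis by simp
      next
        case 2
        have "exp (r * \<bar>ln t\<bar>) / t = t powr (- r - 1)"
          using 2 by (subst powr_minus_one_eq) (simp_all add: abs_if)
        then have "\<bar>\<phi> t q\<bar> / t * exp (r * \<bar>ln t\<bar>) = \<bar>\<phi> t q\<bar> * t powr (- r - 1)"
          by (metis times_divide_eq_left times_divide_eq_right)
        also have "\<dots> \<le> (\<Sum>\<^sub>\<infinity>w\<in>D - {0}. gauss_hat t w) * t powr (- r - 1)"
          by (intro mult_right_mono abs_\<phi>_le 2) simp
        also have "\<dots> \<le> K2" by (rule K2(2)[OF 2])
        finally show ?thesis using 2 by simp
      next
        case 3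
        have "exp (r * \<bar>ln t\<bar>) / t = t powr (r - 1)"
          using 3 by (subst powr_minus_one_eq) simp_all
        then have "\<bar>\<phi> t q\<bar> / t * exp (r * \<bar>ln t\<bar>) = \<theta> t q * t powr (r - 1)"
          using 3 by (simp add: \<phi>_def \<theta>_nonneg, metis times_divide_eq_left times_divide_eq_right)
        also have "\<dots> \<le> C * exp (- (b * t)) * t powr (r - 1)"
          using le[OF 3] by (intro mult_right_mono) auto
        also have "\<dots> = C * (t powr (r - 1) * exp (- (b / 2 * t))) * exp (- (b / 2) * t)"
          by (simp add: mult_ac flip: exp_add)
        also have "\<dots> \<le> C * K1 * exp (- (b / 2) * t)"
          using K1(2)[OF 3] C by (intro mult_right_mono mult_left_mono) auto
        finally show ?thesis using 3 by simp
      qed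
    qed
    moreover have "0 \<le> indicator {0<..} t * \<bar>\<phi> t q\<bar> / t * exp (r * \<bar>ln t\<bar>)" for t
      by (cases "t > 0") auto
    ultimately show "AE t in lborel. norm (indicator {0<..} t * \<bar>\<phi> t q\<bar> / t * exp (r * \<bar>ln t\<bar>)) \<le> norm (?g t)"
      unfolding real_norm_def by (intro AE_I2) (metis abs_of_nonneg order_trans)
  qed
qed

text \<open>The Mellin transform of \<phi> in t at z, written with dt/t. The parameter s of the
  kernel corresponds to z = s/2.\<close>

definition mellin :: "real^'d \<Rightarrow> complex \<Rightarrow> complex" where
  "mellin q z = (\<integral>t. of_real (indicator {0<..} t * \<phi> t q / t) * exp (z * of_real (ln t)) \<partial>lborel)"

lemma holomorphic_mellin: "q \<notin> L \<Longrightarrow> mellin q holomorphic_on UNIV"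
  unfolding mellin_def
proof (rule holomorphic_integral_exp)
  show "integrable lborel (\<lambda>t. norm (of_real (indicator {0<..} t * \<phi> t q / t) :: complex) * exp (r * \<bar>ln t\<bar>))"
    if "q \<notin> L" for r
    using integrable_\<phi>[OF that, of r]
    by (rule Bochner_Integration.integrable_cong[THEN iffD1, rotated 2])
       (auto simp: indicator_def abs_mult norm_divide)
  show "(\<lambda>t. of_real (indicator {0<..} t * \<phi> t q / t) :: complex) \<in> borel_measurable lborel"
    by measurable
qed simp

lemma
  assumes q: "q \<notin> L"
  shows integrable_mellin_real: "integrable lborel (\<lambda>t. indicator {0<..} t * \<phi> t q * t powr (s - 1))"
    and mellin_real: "mellin q (of_real s) = of_real (\<integral>t. indicator {0<..} t * \<phi> t q * t powr (s - 1) \<partial>lborel)"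
proof -
  have eq: "indicator {0<..} t * \<phi> t q * t powr (s - 1) = indicator {0<..} t * \<phi> t q / t * exp (s * ln t)" for t
    by (cases "t > 0") (simp_all add: powr_minus_one_eq)
  show "integrable lborel (\<lambda>t. indicator {0<..} t * \<phi> t q * t powr (s - 1))"
  proof (rule Bochner_Integration.integrable_bound[OF integrable_\<phi>[OF q, of "\<bar>s\<bar>"]])
    have "norm (indicator {0<..} t * \<phi> t q * t powr (s - 1)) \<le> norm (indicator {0<..} t * \<bar>\<phi> t q\<bar> / t * exp (\<bar>s\<bar> * \<bar>ln t\<bar>))" for t
      unfolding eq using abs_ge_self[of "s * ln t"] 
      by (auto simp: abs_mult indicator_def intro!: divide_right_mono mult_left_mono)
    then show "AE t in lborel. norm (indicator {0<..} t * \<phi> t q * t powr (s - 1)) \<le> norm (indicator {0<..} t * \<bar>\<phi> t q\<bar> / t * exp (\<bar>s\<bar> * \<bar>ln t\<bar>))"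
      by simp
  qed measurable
  show "mellin q (of_real s) = of_real (\<integral>t. indicator {0<..} t * \<phi> t q * t powr (s - 1) \<partial>lborel)"
    unfolding mellin_def eq integral_complex_of_real[symmetric]
    by (intro Bochner_Integration.integral_cong) (simp_all flip: exp_of_real)
qed

end

section \<open>The kernel and the zeta function\<close>

definition riesz_weight :: "real \<Rightarrow> real \<Rightarrow> real" where
  "riesz_weight s t = indicator {0<..} t * t powr (s / 2 - 1) / Gamma (s / 2)"

lemma riesz_weight_nonneg: "s > 0 \<Longrightarrow> 0 \<le> riesz_weight s t"
  by (simp add: riesz_weight_def Gamma_real_nonneg)

lemma measurable_riesz_weight [measurable]: "riesz_weight s \<in> borel_measurable borel"
  unfolding riesz_weight_def by measurable

lemma nn_integral_riesz_measure:
  assumes [measurable]: "f \<in> borel_measurable borel"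
  shows "(\<integral>\<^sup>+t. f t \<partial>riesz_measure s) = (\<integral>\<^sup>+t. ennreal (riesz_weight s t) * f t \<partial>lborel)"
  unfolding riesz_measure_def riesz_weight_def[symmetric] by (rule nn_integral_density) measurable

lemma integral_riesz_measure:
  fixes f :: "real \<Rightarrow> real"
  assumes [measurable]: "f \<in> borel_measurable borel" and "s > 0"
  shows "(\<integral>t. f t \<partial>riesz_measure s) = (\<integral>t. riesz_weight s t * f t \<partial>lborel)"
  unfolding riesz_measure_def riesz_weight_def[symmetric]
  by (subst integral_density) (use assms in \<open>auto simp: riesz_weight_nonneg\<close>)

lemma powr_integral_0_1:
  fixes a :: real
  assumes "a > -1"
  shows "has_bochner_integral lborel (\<lambda>t. indicator {0<..<1} t * t powr a) (1 / (a + 1))"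
proof (rule has_bochner_integral_if_has_integral_nonneg)
  show "((\<lambda>t. t powr a) has_integral 1 / (a + 1)) {0<..<1}"
    using has_integral_powr_from_0[OF assms, of 1] by (simp add: has_integral_Icc_iff_Ioo)
qed auto

lemma powr_integral_1_infinity:
  fixes a :: real
  assumes "a < -1"
  shows "has_bochner_integral lborel (\<lambda>t. indicator {1<..} t * t powr a) (- 1 / (a + 1))"
proof -
  have "has_bochner_integral lborel (\<lambda>t. indicator {1..} t * t powr a) (- 1 / (a + 1))"
    using has_integral_powr_to_inf[OF assms, of 1]
    by (intro has_bochner_integral_if_has_integral_nonneg) auto
  moreover have "AE t in lborel. indicator {1..} t * t powr a = indicator {1<..} t * t powr a"
    using AE_lborel_singleton[of "1 :: real"] by eventually_elim (auto simp: indicator_def)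
  ultimately show ?thesis
    by (subst has_bochner_integral_cong_AE[symmetric]) auto
qed

text \<open>If the value were a finite r, the integral over [1, R] would exceed it: \<open>R\<close>
  is chosen to make that integral equal to r + 1. This divergence is the infinite value of the
  kernel on the lattice.\<close>

lemma nn_integral_powr_infinite:
  fixes a :: real
  assumes a: "a > 0"
  shows "(\<integral>\<^sup>+t. ennreal (indicator {1<..} t * t powr (a - 1)) \<partial>lborel) = \<infinity>"
proof (rule ccontr)
  assume "\<not> ?thesis"
  then obtain r where r: "r \<ge> 0" "(\<integral>\<^sup>+t. ennreal (indicator {1<..} t * t powr (a - 1)) \<partial>lborel) = ennreal r"
    by (metis ennreal_cases infinity_ennreal_def)
  define R where "R = (1 + a * (r + 1)) powr (1 / a)"
  have R1: "R \<ge> 1" unfolding R_def using a r by (intro ge_one_powr_ge_zero) auto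
  have Ra: "R powr a = 1 + a * (r + 1)"
    unfolding R_def using a r by (simp add: powr_powr add_nonneg_nonneg)
  have "(\<integral>\<^sup>+t. ennreal (t powr (a - 1)) * indicator {1..R} t \<partial>lborel) = ennreal (R powr a / a - 1 powr a / a)"
    by (rule nn_integral_FTC_Icc[where F = "\<lambda>t. t powr a / a"])
       (use R1 a in \<open>auto intro!: derivative_eq_intros\<close>)
  also have "R powr a / a - 1 powr a / a = r + 1" using a by (simp add: Ra field_simps)
  finally have "ennreal (r + 1) = (\<integral>\<^sup>+t. ennreal (t powr (a - 1)) * indicator {1..R} t \<partial>lborel)" ..
  also have "(\<integral>\<^sup>+t. ennreal (t powr (a - 1)) * indicator {1..R} t \<partial>lborel)
      \<le> (\<integral>\<^sup>+t. ennreal (indicator {1<..} t * t powr (a - 1)) \<partial>lborel)"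
  proof (rule nn_integral_mono_AE)
    show "AE t in lborel. ennreal (t powr (a - 1)) * indicator {1..R} t \<le> ennreal (indicator {1<..} t * t powr (a - 1))"
      using AE_lborel_singleton[of "1 :: real"] by eventually_elim (auto simp: indicator_def)
  qed
  finally have "ennreal (r + 1) \<le> ennreal r" using r(2) by simp
  then show False using r(1) by (simp add: ennreal_le_iff del: ennreal_plus)
qed

text \<open>The substitution of \<open>c\<^sup>2 * t\<close> in the Gamma integral; it writes a
  Riesz potential as a superposition of Gaussians.\<close>

lemma nn_integral_riesz_weight_exp:
  assumes s: "s > 0" and c: "c > 0"
  shows "(\<integral>\<^sup>+t. ennreal (riesz_weight s t * exp (- (t * c\<^sup>2))) \<partial>lborel) = ennreal (c powr (- s))"
proof -
  let ?G = "Gamma (s / 2)"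
  have G: "?G > 0" using s by (intro Gamma_real_pos) auto
  then have G0: "?G \<noteq> 0" by simp
  have "ennreal ?G = (\<integral>\<^sup>+t. ennreal (indicator {0..} t * t powr (s / 2 - 1) / exp t) \<partial>lborel)"
    using s by (intro Gamma_conv_nn_integral_real) simp
  also have "\<dots> = ennreal \<bar>c\<^sup>2\<bar> * (\<integral>\<^sup>+t. ennreal (indicator {0..} (0 + c\<^sup>2 * t) * (0 + c\<^sup>2 * t) powr (s / 2 - 1) / exp (0 + c\<^sup>2 * t)) \<partial>lborel)"
    using c by (intro nn_integral_real_affine) auto
  also have "\<dots> = (\<integral>\<^sup>+t. ennreal (c powr s * ?G) * ennreal (riesz_weight s t * exp (- (t * c\<^sup>2))) \<partial>lborel)"
  proof (subst nn_integral_cmult[symmetric], measurable, rule nn_integral_cong_AE)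
    show "AE t in lborel. ennreal \<bar>c\<^sup>2\<bar> * ennreal (indicator {0..} (0 + c\<^sup>2 * t) * (0 + c\<^sup>2 * t) powr (s / 2 - 1) / exp (0 + c\<^sup>2 * t))
        = ennreal (c powr s * ?G) * ennreal (riesz_weight s t * exp (- (t * c\<^sup>2)))"
      using AE_lborel_singleton[of "0 :: real"]
    proof eventually_elim
      case (elim t)
      show ?case
      proof (cases "t > 0")
        case True
        have "c\<^sup>2 * (c\<^sup>2) powr (s / 2 - 1) = (c\<^sup>2) powr (s / 2)"
          using c by (simp add: powr_diff)
        also have "\<dots> = c powr s" using c by (simp add: powr_powr flip: powr_numeral)
        finally have "c\<^sup>2 * (c\<^sup>2 * t) powr (s / 2 - 1) = c powr s * t powr (s / 2 - 1)"
          using True by (simp only: powr_mult mult.assoc[symmetric])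
        moreover have "c\<^sup>2 * ((c\<^sup>2 * t) powr (s / 2 - 1) / exp (c\<^sup>2 * t))
            = c\<^sup>2 * (c\<^sup>2 * t) powr (s / 2 - 1) * exp (- (t * c\<^sup>2))"
        proof -
          have "exp (- (t * c\<^sup>2)) = 1 / exp (c\<^sup>2 * t)"
            by (metis exp_minus inverse_eq_divide mult.commute)
          then show ?thesis by simp
        qed
        moreover have "c powr s * ?G * (t powr (s / 2 - 1) / ?G * exp (- (t * c\<^sup>2)))
            = c powr s * t powr (s / 2 - 1) * exp (- (t * c\<^sup>2))"
          using G by simp
        ultimately have "c\<^sup>2 * ((c\<^sup>2 * t) powr (s / 2 - 1) / exp (c\<^sup>2 * t))
            = c powr s * ?G * (t powr (s / 2 - 1) / ?G * exp (- (t * c\<^sup>2)))"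
          by simp
        then show ?thesis
          using True c G s by (simp add: riesz_weight_def G0 flip: ennreal_mult)
      next
        case False
        with elim c show ?thesis by (simp add: riesz_weight_def zero_le_mult_iff)
      qed
    qed
  qed
  also have "\<dots> = ennreal (c powr s * ?G) * (\<integral>\<^sup>+t. ennreal (riesz_weight s t * exp (- (t * c\<^sup>2))) \<partial>lborel)"
    by (rule nn_integral_cmult) measurable
  finally have eq: "ennreal ?G = ennreal (c powr s * ?G) * (\<integral>\<^sup>+t. ennreal (riesz_weight s t * exp (- (t * c\<^sup>2))) \<partial>lborel)" .
  have pos: "c powr s * ?G > 0" using c G by simp
  \<comment> \<open>Cancelling in \<open>ennreal\<close> requires a finite integral; an infinite one
    would make Gamma infinite.\<close>
  have "(\<integral>\<^sup>+t. ennreal (riesz_weight s t * exp (- (t * c\<^sup>2))) \<partial>lborel) \<noteq> top"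
  proof
    assume inf: "(\<integral>\<^sup>+t. ennreal (riesz_weight s t * exp (- (t * c\<^sup>2))) \<partial>lborel) = top"
    have "ennreal ?G = ennreal (c powr s * ?G) * top" using eq by (simp only: inf)
    also have "\<dots> = top" using pos by (simp only: ennreal_mult_eq_top_iff ennreal_eq_0_iff not_le) blast
    finally show False by simp
  qed
  then obtain r where r: "r \<ge> 0" "(\<integral>\<^sup>+t. ennreal (riesz_weight s t * exp (- (t * c\<^sup>2))) \<partial>lborel) = ennreal r"
    by (cases rule: ennreal_cases) auto
  have "ennreal ?G = ennreal (c powr s * ?G * r)"
    using eq unfolding r(2) by (simp only: ennreal_mult[OF less_imp_le[OF pos] r(1)])
  then have "?G = c powr s * ?G * r"
    by (rule ennreal_inj[THEN iffD1, rotated 2]) (use G pos r in auto)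
  then have "r = c powr (- s)" using G c by (simp add: powr_minus field_simps)
  with r show ?thesis by simp
qed

section \<open>The kernel series and the zeta series as integrals\<close>

context unimodular_lattice
begin

definition dual_coeff :: "real \<Rightarrow> real^'d \<Rightarrow> real" where
  "dual_coeff s w = (\<integral>t. indicator {0<..<1} t * (riesz_weight s t * gauss_hat t w) \<partial>lborel)"

lemma gauss_hat_le_sum:
  assumes "t > 0" "w \<in> D - {0}"
  shows "gauss_hat t w \<le> (\<Sum>\<^sub>\<infinity>w\<in>D - {0}. gauss_hat t w)"
proof -
  have "sum (gauss_hat t) {w} \<le> (\<Sum>\<^sub>\<infinity>w\<in>D - {0}. gauss_hat t w)"
    by (rule finite_sum_le_infsum)
       (use assms summable_on_subset[OF summable_gauss_hat[OF assms(1)]] in \<open>auto simp: gauss_hat_nonneg\<close>)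
  then show ?thesis by simp
qed

text \<open>On (0,1) the weighted sum of all \<open>gauss_hat\<close> is bounded by a constant, so
  each term is integrable and the sum of the integrals is finite.\<close>

lemma
  assumes s: "s > 0"
  shows integrable_dual_coeff: "w \<in> D - {0} \<Longrightarrow> integrable lborel (\<lambda>t. indicator {0<..<1} t * (riesz_weight s t * gauss_hat t w))"
    and summable_dual_coeff: "dual_coeff s summable_on (D - {0})"
proof -
  let ?f = "\<lambda>w t. indicator {0<..<1} t * (riesz_weight s t * gauss_hat t w)"
  let ?S = "\<lambda>t. \<Sum>\<^sub>\<infinity>w\<in>D - {0}. gauss_hat t w"
  obtain K where K: "K > 0" "\<And>t. 0 < t \<Longrightarrow> t < 1 \<Longrightarrow> ?S t * t powr (s / 2 - 1) \<le> K"
    by (rule bounded_gauss_hat_near_0) blast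
  have G: "Gamma (s / 2) > 0" using s by (intro Gamma_real_pos) auto
  have nn: "0 \<le> ?f w t" for w t
    using s by (simp add: gauss_hat_nonneg riesz_weight_nonneg)
  have le: "indicator {0<..<1} t * (riesz_weight s t * ?S t) \<le> indicator {0<..<1} t * (K / Gamma (s / 2))" for t
  proof (cases "0 < t \<and> t < 1")
    case True
    then show ?thesis
      using K(2)[of t] G by (simp add: riesz_weight_def mult.commute divide_right_mono)
  qed (auto simp: indicator_def)
  have int_K: "integrable lborel (\<lambda>t :: real. indicator {0<..<1} t * (K / Gamma (s / 2)))"
    by (intro integrable_mult_left) simp
  have [measurable]: "?f w \<in> borel_measurable borel" for w
    unfolding gauss_hat_def by measurable
  show int: "integrable lborel (?f w)" if w: "w \<in> D - {0}" for w
  proof (rule Bochner_Integration.integrable_bound[OF int_K])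
    have "?f w t \<le> indicator {0<..<1} t * (K / Gamma (s / 2))" for t
    proof -
      have "?f w t \<le> indicator {0<..<1} t * (riesz_weight s t * ?S t)"
        using gauss_hat_le_sum[OF _ w, of t] s
        by (auto simp: indicator_def intro!: mult_left_mono riesz_weight_nonneg)
      also note le
      finally show ?thesis .
    qed
    then have "norm (?f w t) \<le> norm (indicator {0<..<1} t * (K / Gamma (s / 2)))" for t
      unfolding real_norm_def abs_of_nonneg[OF nn] by (rule order_trans) (rule abs_ge_self)
    then show "AE t in lborel. norm (?f w t) \<le> norm (indicator {0<..<1} t * (K / Gamma (s / 2)))"
      by (intro AE_I2)
  qed measurable
  have "(\<Sum>\<^sub>\<infinity>w\<in>D - {0}. ennreal (dual_coeff s w)) = (\<Sum>\<^sub>\<infinity>w\<in>D - {0}. \<integral>\<^sup>+t. ennreal (?f w t) \<partial>lborel)"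
    unfolding dual_coeff_def
    by (intro infsum_cong nn_integral_eq_integral[symmetric] int) (use nn in auto)
  also have "\<dots> = (\<integral>\<^sup>+t. (\<Sum>\<^sub>\<infinity>w\<in>D - {0}. ennreal (?f w t)) \<partial>lborel)"
    using countable_D by (intro nn_integral_infsum[symmetric]) auto
  also have "\<dots> \<le> (\<integral>\<^sup>+t. ennreal (indicator {0<..<1 :: real} t * (K / Gamma (s / 2))) \<partial>lborel)"
  proof (rule nn_integral_mono)
    fix t :: real
    show "(\<Sum>\<^sub>\<infinity>w\<in>D - {0}. ennreal (?f w t)) \<le> ennreal (indicator {0<..<1} t * (K / Gamma (s / 2)))"
    proof (cases "0 < t \<and> t < 1")
      case True
      have "(\<lambda>w. ?f w t) summable_on D - {0}"
        using summable_on_subset[OF summable_gauss_hat[of t], of "D - {0}"] True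
        by (intro summable_on_cmult_right) auto
      then have "(\<Sum>\<^sub>\<infinity>w\<in>D - {0}. ennreal (?f w t)) = ennreal (\<Sum>\<^sub>\<infinity>w\<in>D - {0}. ?f w t)"
        by (rule infsum_ennreal) (rule nn)
      also have "\<dots> \<le> ennreal (indicator {0<..<1} t * (K / Gamma (s / 2)))"
        unfolding infsum_cmult_right' using le[of t] by (rule ennreal_leI)
      finally show ?thesis .
    qed auto
  qed
  also have "\<dots> < \<infinity>"
    using int_K K G by (simp add: integrable_iff_bounded abs_mult)
  finally show "dual_coeff s summable_on (D - {0})"
    by (rule summable_on_if_infsum_ennreal) (auto simp: dual_coeff_def intro!: integral_nonneg_AE nn)
qed

lemma dual_coeff_nonneg: "s > 0 \<Longrightarrow> 0 \<le> dual_coeff s w"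
  unfolding dual_coeff_def
  by (intro integral_nonneg_AE AE_I2) (simp add: gauss_hat_nonneg riesz_weight_nonneg)

lemma riesz_dual_sum_eq:
  assumes s: "s > 0"
  shows "riesz_dual_sum V s x y = (\<Sum>\<^sub>\<infinity>w\<in>D - {0}. of_real (dual_coeff s w) * ch w (x - y))"
  unfolding riesz_dual_sum_def
proof (rule infsum_cong)
  fix w
  have "(LINT t:{0<..<1}|riesz_measure s. pi powr (real CARD('d) / 2) / t powr (real CARD('d) / 2) *
          exp (- pi\<^sup>2 * (norm w)\<^sup>2 / t)) = dual_coeff s w"
    unfolding set_lebesgue_integral_def dual_coeff_def
    by (subst integral_riesz_measure[OF _ s])
       (auto intro!: Bochner_Integration.integral_cong simp: gauss_hat_def indicator_def powr_divide)
  then show "exp (2 * of_real pi * \<i> * of_real (w \<bullet> (x - y))) *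
        of_real (LINT t:{0<..<1}|riesz_measure s. pi powr (real CARD('d) / 2) / t powr (real CARD('d) / 2) *
          exp (- pi\<^sup>2 * (norm w)\<^sup>2 / t)) = of_real (dual_coeff s w) * ch w (x - y)"
    by (simp add: ch_def)
qed

text \<open>The terms are dominated independently of \<open>x - y\<close>, so the interchange is
  valid on the lattice as well.\<close>

lemma riesz_dual_sum_eq_integral:
  assumes s: "s > 0"
  shows "riesz_dual_sum V s x y
    = of_real (\<integral>t. indicator {0<..<1} t * (riesz_weight s t * \<phi> t (x - y)) \<partial>lborel)"
proof -
  let ?f = "\<lambda>w t. indicator {0<..<1} t * (riesz_weight s t * gauss_hat t w)"
  let ?F = "\<lambda>w t. of_real (?f w t) * ch w (x - y)"
  have nn: "0 \<le> ?f w t" for w t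
    using s by (simp add: gauss_hat_nonneg riesz_weight_nonneg)
  have norm_F: "norm (?F w t) = ?f w t" for w t
    unfolding norm_mult norm_ch norm_of_real abs_of_nonneg[OF nn] by simp
  have "riesz_dual_sum V s x y = (\<Sum>\<^sub>\<infinity>w\<in>D - {0}. \<integral>t. ?F w t \<partial>lborel)"
    unfolding riesz_dual_sum_eq[OF s] dual_coeff_def
    by (intro infsum_cong) (simp only: integral_mult_left_zero integral_complex_of_real)
  also have "\<dots> = (\<integral>t. (\<Sum>\<^sub>\<infinity>w\<in>D - {0}. ?F w t) \<partial>lborel)"
  proof (rule integral_infsum[symmetric, OF lborel.sigma_finite_measure_axioms])
    show "countable (D - {0})" using countable_D by simp
    show "integrable lborel (?F w)" if "w \<in> D - {0}" for w
      using integrable_dual_coeff[OF s that] by (intro integrable_mult_left integrable_of_real)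
    show "(\<lambda>w. norm (?F w t)) summable_on D - {0}" for t
      unfolding norm_F
    proof (cases "t > 0")
      case True
      then show "(\<lambda>w. ?f w t) summable_on D - {0}"
        using summable_on_subset[OF summable_gauss_hat[of t], of "D - {0}"]
        by (intro summable_on_cmult_right) auto
    qed simp
    show "(\<lambda>w. \<integral>t. norm (?F w t) \<partial>lborel) summable_on D - {0}"
      unfolding norm_F using summable_dual_coeff[OF s] by (simp add: dual_coeff_def[abs_def])
  qed
  also have "\<dots> = (\<integral>t. of_real (indicator {0<..<1} t * (riesz_weight s t * \<phi> t (x - y))) \<partial>lborel)"
  proof (rule Bochner_Integration.integral_cong)
    fix t :: real
    show "(\<Sum>\<^sub>\<infinity>w\<in>D - {0}. ?F w t) = of_real (indicator {0<..<1} t * (riesz_weight s t * \<phi> t (x - y)))"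
    proof (cases "0 < t \<and> t < 1")
      case True
      then have "(\<Sum>\<^sub>\<infinity>w\<in>D - {0}. ?F w t) = (\<Sum>\<^sub>\<infinity>w\<in>D - {0}. of_real (riesz_weight s t) * (of_real (gauss_hat t w) * ch w (x - y)))"
        by (simp add: mult.assoc)
      also have "\<dots> = of_real (riesz_weight s t) * of_real (\<phi> t (x - y))"
        using True by (simp add: infsum_cmult_right' \<phi>_dual)
      finally show ?thesis using True by simp
    qed auto
  qed simp
  finally show ?thesis by (simp only: integral_complex_of_real)
qed

lemma riesz_direct_sum_eq_infsum:
  assumes s: "s > 0"
  shows "riesz_direct_sum V s x y
    = (\<Sum>\<^sub>\<infinity>v\<in>L. \<integral>\<^sup>+t. ennreal (indicator {1<..} t * (riesz_weight s t * exp (- (t * (norm (x - y + v))\<^sup>2)))) \<partial>lborel)"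
  unfolding riesz_direct_sum_def
proof (rule infsum_cong)
  fix v
  show "(\<integral>\<^sup>+t\<in>{1<..}. ennreal (exp (- (norm (x - y + v))\<^sup>2 * t)) \<partial>riesz_measure s)
    = (\<integral>\<^sup>+t. ennreal (indicator {1<..} t * (riesz_weight s t * exp (- (t * (norm (x - y + v))\<^sup>2)))) \<partial>lborel)"
    by (subst nn_integral_riesz_measure)
       (auto intro!: nn_integral_cong simp: indicator_def ennreal_mult' riesz_weight_nonneg[OF s] mult.commute)
qed

lemma riesz_direct_sum_eq:
  assumes s: "s > 0"
  shows "riesz_direct_sum V s x y = (\<integral>\<^sup>+t. ennreal (indicator {1<..} t * (riesz_weight s t * \<theta> t (x - y))) \<partial>lborel)"
proof -
  have "riesz_direct_sum V s x y
      = (\<Sum>\<^sub>\<infinity>v\<in>L. \<integral>\<^sup>+t. ennreal (indicator {1<..} t * (riesz_weight s t * exp (- (t * (norm (x - y + v))\<^sup>2)))) \<partial>lborel)"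
    by (rule riesz_direct_sum_eq_infsum[OF s])
  also have "\<dots> = (\<integral>\<^sup>+t. (\<Sum>\<^sub>\<infinity>v\<in>L. ennreal (indicator {1<..} t * (riesz_weight s t * exp (- (t * (norm (x - y + v))\<^sup>2))))) \<partial>lborel)"
    by (intro nn_integral_infsum[symmetric] countable_L) measurable
  also have "\<dots> = (\<integral>\<^sup>+t. ennreal (indicator {1<..} t * (riesz_weight s t * \<theta> t (x - y))) \<partial>lborel)"
  proof (rule nn_integral_cong)
    fix t :: real
    show "(\<Sum>\<^sub>\<infinity>v\<in>L. ennreal (indicator {1<..} t * (riesz_weight s t * exp (- (t * (norm (x - y + v))\<^sup>2)))))
        = ennreal (indicator {1<..} t * (riesz_weight s t * \<theta> t (x - y)))"
    proof (cases "t > 1")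
      case True
      then show ?thesis
        unfolding \<theta>_def infsum_cmult_right'[symmetric]
        by (intro infsum_ennreal summable_on_cmult_right summable_lattice_gaussian)
           (auto simp: riesz_weight_nonneg[OF s])
    qed simp
  qed
  finally show ?thesis .
qed

lemma integrable_riesz_weight_\<phi>:
  assumes "q \<notin> L"
  shows "integrable lborel (\<lambda>t. riesz_weight s t * \<phi> t q)"
proof -
  have "integrable lborel (\<lambda>t. indicator {0<..} t * \<phi> t q * t powr (s / 2 - 1) / Gamma (s / 2))"
    by (intro integrable_divide integrable_mellin_real assms)
  then show ?thesis by (simp add: riesz_weight_def mult_ac)
qed

lemma periodic_riesz_kernel_eq_integral:
  assumes s: "s > 0" and q: "x - y \<notin> L"
  shows "periodic_riesz_kernel V s x y = ereal (\<integral>t. riesz_weight s t * \<phi> t (x - y) \<partial>lborel)"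
proof -
  let ?h = "\<lambda>t. riesz_weight s t * \<phi> t (x - y)"
  have int: "integrable lborel ?h" by (rule integrable_riesz_weight_\<phi>[OF q])
  have int1: "integrable lborel (\<lambda>t. indicator {1<..} t * ?h t)"
    and int0: "integrable lborel (\<lambda>t. indicator {0<..<1} t * ?h t)"
    using integrable_mult_indicator[OF _ int, of "{1<..}"] integrable_mult_indicator[OF _ int, of "{0<..<1}"] by simp_all
  have "riesz_direct_sum V s x y = (\<integral>\<^sup>+t. ennreal (indicator {1<..} t * ?h t) \<partial>lborel)"
    unfolding riesz_direct_sum_eq[OF s] by (intro nn_integral_cong) (auto simp: \<phi>_def indicator_def)
  also have "\<dots> = ennreal (\<integral>t. indicator {1<..} t * ?h t \<partial>lborel)"
    by (intro nn_integral_eq_integral int1) (auto simp: \<phi>_def indicator_def \<theta>_nonneg riesz_weight_nonneg[OF s])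
  finally have 1: "riesz_direct_sum V s x y = ennreal (\<integral>t. indicator {1<..} t * ?h t \<partial>lborel)" .
  have "0 \<le> (\<integral>t. indicator {1<..} t * ?h t \<partial>lborel)"
    by (intro integral_nonneg_AE AE_I2) (auto simp: \<phi>_def indicator_def \<theta>_nonneg riesz_weight_nonneg[OF s])
  then have "periodic_riesz_kernel V s x y
      = ereal ((\<integral>t. indicator {1<..} t * ?h t \<partial>lborel) + (\<integral>t. indicator {0<..<1} t * ?h t \<partial>lborel))"
    unfolding periodic_riesz_kernel_def 1 riesz_dual_sum_eq_integral[OF s] by (simp add: enn2ereal_ennreal)
  also have "(\<integral>t. indicator {1<..} t * ?h t \<partial>lborel) + (\<integral>t. indicator {0<..<1} t * ?h t \<partial>lborel)
      = (\<integral>t. indicator {1<..} t * ?h t + indicator {0<..<1} t * ?h t \<partial>lborel)"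
    by (rule Bochner_Integration.integral_add[symmetric, OF int1 int0])
  \<comment> \<open>The point t = 1 lies in neither half but is null, and the weight vanishes for t
    \<le> 0.\<close>
  also have "\<dots> = (\<integral>t. ?h t \<partial>lborel)"
  proof (rule integral_cong_AE)
    show "AE t in lborel. indicator {1<..} t * ?h t + indicator {0<..<1} t * ?h t = ?h t"
      using AE_lborel_singleton[of "1 :: real"] 
      by eventually_elim (auto simp: indicator_def riesz_weight_def)
  qed (use int int0 int1 in auto)
  finally show ?thesis .
qed

text \<open>The single term \<open>v = - (x - y)\<close> of the direct series is already infinite,
  and the dual series is a finite number.\<close>

lemma periodic_riesz_kernel_lattice:
  assumes s: "s > 0" and q: "x - y \<in> L"
  shows "periodic_riesz_kernel V s x y = \<infinity>"
proof -
  have G: "Gamma (s / 2) > 0" using s by (intro Gamma_real_pos) auto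
  have "(\<integral>\<^sup>+t\<in>{1<..}. ennreal (exp (- (norm (x - y + - (x - y)))\<^sup>2 * t)) \<partial>riesz_measure s)
      = (\<integral>\<^sup>+t. ennreal (1 / Gamma (s / 2)) * ennreal (indicator {1<..} t * t powr (s / 2 - 1)) \<partial>lborel)"
    by (subst nn_integral_riesz_measure)
       (use G in \<open>auto intro!: nn_integral_cong simp: indicator_def riesz_weight_def simp flip: ennreal_mult\<close>)
  also have "\<dots> = ennreal (1 / Gamma (s / 2)) * \<infinity>"
    using s by (subst nn_integral_cmult) (auto simp: nn_integral_powr_infinite)
  also have "\<dots> = \<infinity>" using G by (simp add: ennreal_mult_top)
  finally have "\<infinity> = (\<Sum>v\<in>{- (x - y)}. \<integral>\<^sup>+t\<in>{1<..}. ennreal (exp (- (norm (x - y + v))\<^sup>2 * t)) \<partial>riesz_measure s)"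
    by simp
  also have "\<dots> \<le> riesz_direct_sum V s x y"
    unfolding riesz_direct_sum_def using L_uminus[of "x - y"] q
    by (subst nonneg_infsum_complete, simp, intro SUP_upper) (simp del: L_uminus)
  finally have "riesz_direct_sum V s x y = \<infinity>" by (simp add: top.extremum_unique)
  then show ?thesis by (simp add: periodic_riesz_kernel_def)
qed

text \<open>Summing the Gaussian representation of each term produces \<theta>. Restoring the term
  removed in \<phi> costs a power of t that is integrable at 0 because s > d. Convergence of the
  series comes out of the same computation.\<close>

lemma epstein_hurwitz_series_eq:
  assumes s: "s > real CARD('d)" and q: "q \<notin> L"
  shows "epstein_hurwitz_series V s q = (\<integral>t. riesz_weight s t * \<phi> t q \<partial>lborel)
    + 2 * pi powr (real CARD('d) / 2) / (Gamma (s / 2) * (s - real CARD('d)))"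
proof -
  let ?d = "real CARD('d)"
  have s0: "s > 0" using s by (rule le_less_trans[rotated]) simp
  have G: "Gamma (s / 2) > 0" using s0 by (intro Gamma_real_pos) auto
  let ?p = "\<lambda>t. indicator {0<..<1} t * t powr (s / 2 - ?d / 2 - 1)"
  have p: "has_bochner_integral lborel ?p (1 / (s / 2 - ?d / 2 - 1 + 1))"
    using s by (intro powr_integral_0_1) auto
  then have int_p: "integrable lborel (\<lambda>t. pi powr (?d / 2) / Gamma (s / 2) * ?p t)"
    by (auto simp: has_bochner_integral_iff)
  have eq: "riesz_weight s t * \<theta> t q = riesz_weight s t * \<phi> t q + pi powr (?d / 2) / Gamma (s / 2) * ?p t" for t
  proof (cases "0 < t \<and> t < 1")
    case True
    have "t powr (s / 2 - 1) * (pi / t) powr (?d / 2) = pi powr (?d / 2) * t powr (s / 2 - ?d / 2 - 1)"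
      using True by (simp add: powr_divide powr_diff mult.commute)
    with True show ?thesis
      by (simp add: \<phi>_def riesz_weight_def right_diff_distrib)
  qed (auto simp: \<phi>_def riesz_weight_def indicator_def)
  have int: "integrable lborel (\<lambda>t. riesz_weight s t * \<theta> t q)"
    unfolding eq by (intro Bochner_Integration.integrable_add integrable_riesz_weight_\<phi> q int_p)
  have nz: "norm (q + v) > 0" if "v \<in> L" for v
    using q that L_uminus[of v] by (auto simp: add_eq_0_iff2 simp del: L_uminus)
  have "(\<Sum>\<^sub>\<infinity>v\<in>L. ennreal (norm (q + v) powr (- s)))
      = (\<Sum>\<^sub>\<infinity>v\<in>L. \<integral>\<^sup>+t. ennreal (riesz_weight s t * exp (- (t * (norm (q + v))\<^sup>2))) \<partial>lborel)"
    by (intro infsum_cong nn_integral_riesz_weight_exp[symmetric] s0 nz)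
  also have "\<dots> = (\<integral>\<^sup>+t. (\<Sum>\<^sub>\<infinity>v\<in>L. ennreal (riesz_weight s t * exp (- (t * (norm (q + v))\<^sup>2)))) \<partial>lborel)"
    by (intro nn_integral_infsum[symmetric] countable_L) measurable
  also have "\<dots> = (\<integral>\<^sup>+t. ennreal (riesz_weight s t * \<theta> t q) \<partial>lborel)"
  proof (rule nn_integral_cong)
    fix t :: real
    show "(\<Sum>\<^sub>\<infinity>v\<in>L. ennreal (riesz_weight s t * exp (- (t * (norm (q + v))\<^sup>2)))) = ennreal (riesz_weight s t * \<theta> t q)"
    proof (cases "t > 0")
      case True
      then show ?thesis
        unfolding \<theta>_def infsum_cmult_right'[symmetric]
        by (intro infsum_ennreal summable_on_cmult_right summable_lattice_gaussian)
           (auto simp: riesz_weight_nonneg[OF s0])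
    qed (simp add: riesz_weight_def)
  qed
  also have "\<dots> = ennreal (\<integral>t. riesz_weight s t * \<theta> t q \<partial>lborel)"
    by (intro nn_integral_eq_integral int AE_I2 mult_nonneg_nonneg riesz_weight_nonneg \<theta>_nonneg s0)
  finally have sum: "(\<Sum>\<^sub>\<infinity>v\<in>L. ennreal (norm (q + v) powr (- s))) = ennreal (\<integral>t. riesz_weight s t * \<theta> t q \<partial>lborel)" .
  then have "(\<lambda>v. norm (q + v) powr (- s)) summable_on L"
    by (intro summable_on_if_infsum_ennreal) auto
  from infsum_ennreal[OF this] sum
  have "ennreal (epstein_hurwitz_series V s q) = ennreal (\<integral>t. riesz_weight s t * \<theta> t q \<partial>lborel)"
    by (simp add: epstein_hurwitz_series_def)
  then have "epstein_hurwitz_series V s q = (\<integral>t. riesz_weight s t * \<theta> t q \<partial>lborel)"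
    by (subst (asm) ennreal_inj)
       (auto simp: epstein_hurwitz_series_def intro!: infsum_nonneg integral_nonneg_AE
         mult_nonneg_nonneg riesz_weight_nonneg \<theta>_nonneg s0)
  also have "\<dots> = (\<integral>t. riesz_weight s t * \<phi> t q \<partial>lborel) + (\<integral>t. pi powr (?d / 2) / Gamma (s / 2) * ?p t \<partial>lborel)"
    unfolding eq by (intro Bochner_Integration.integral_add integrable_riesz_weight_\<phi> q int_p)
  also have "(\<integral>t. pi powr (?d / 2) / Gamma (s / 2) * ?p t \<partial>lborel) = pi powr (?d / 2) / Gamma (s / 2) * (1 / (s / 2 - ?d / 2 - 1 + 1))"
    using p by (simp add: has_bochner_integral_iff)
  also have "\<dots> = 2 * pi powr (?d / 2) / (Gamma (s / 2) * (s - ?d))"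
  proof -
    have "1 / (s / 2 - ?d / 2 - 1 + 1) = 2 / (s - ?d)" using s by (simp add: field_simps)
    then show ?thesis by (simp add: mult_ac)
  qed
  finally show ?thesis .
qed

text \<open>The factor 1/Gamma is taken as the entire function \<open>rGamma\<close>, so the product
  with the Mellin transform is entire; on real s it is the integral that represents the
  kernel.\<close>

lemma
  assumes q: "q \<notin> L"
  defines "F \<equiv> \<lambda>z. rGamma (z / 2) * mellin q (z / 2)"
  shows entire_function_real: "F (of_real s) = of_real (\<integral>t. riesz_weight s t * \<phi> t q \<partial>lborel)"
    and is_epstein_hurwitz_entire: "is_epstein_hurwitz_entire V q F"
proof -
  have F: "F (of_real s) = of_real (\<integral>t. riesz_weight s t * \<phi> t q \<partial>lborel)" for s
  proof -
    have "F (of_real s) = rGamma (of_real (s / 2)) * mellin q (of_real (s / 2))"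
      by (simp add: F_def)
    also have "\<dots> = of_real (rGamma (s / 2) * (\<integral>t. indicator {0<..} t * \<phi> t q * t powr (s / 2 - 1) \<partial>lborel))"
      unfolding mellin_real[OF q] rGamma_complex_of_real by simp
    also have "rGamma (s / 2) * (\<integral>t. indicator {0<..} t * \<phi> t q * t powr (s / 2 - 1) \<partial>lborel)
        = (\<integral>t. rGamma (s / 2) * (indicator {0<..} t * \<phi> t q * t powr (s / 2 - 1)) \<partial>lborel)"
      by simp
    \<comment> \<open>At the poles of Gamma both sides are 0: \<open>rGamma\<close> vanishes there,
      and \<open>riesz_weight\<close> divides by the default value 0.\<close>
    also have "\<dots> = (\<integral>t. riesz_weight s t * \<phi> t q \<partial>lborel)"
      by (intro Bochner_Integration.integral_cong)
         (simp_all only: riesz_weight_def rGamma_inverse_Gamma divide_inverse mult_ac)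
    finally show ?thesis .
  qed
  then show "F (of_real s) = of_real (\<integral>t. riesz_weight s t * \<phi> t q \<partial>lborel)" .
  have "(mellin q \<circ> (\<lambda>z. z / 2)) holomorphic_on UNIV"
    by (intro holomorphic_on_compose holomorphic_intros)
       (use holomorphic_on_subset[OF holomorphic_mellin[OF q]] in auto)
  then have "F holomorphic_on UNIV"
    unfolding F_def by (intro holomorphic_intros) (simp_all add: o_def)
  then show "is_epstein_hurwitz_entire V q F"
    unfolding is_epstein_hurwitz_entire_def using F epstein_hurwitz_series_eq[OF _ q] by simp
qed

text \<open>On the lattice both sides are infinite. Off it, for s \<noteq> d, the added constant
  cancels the polar part of the zeta function and leaves the entire function; for s = d that
  function is used directly.\<close>

lemma kernel_formula:
  assumes s: "s > 0"
  shows "periodic_riesz_kernel V s x y =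
            (if s = real CARD('d) then epstein_hurwitz_regular V s (x - y)
             else epstein_hurwitz_zeta V s (x - y) +
               ereal (2 * pi powr (real CARD('d) / 2) / (Gamma (s/2) * (real CARD('d) - s))))"
proof (cases "x - y \<in> L")
  case True
  then show ?thesis
    using s by (simp add: periodic_riesz_kernel_lattice epstein_hurwitz_regular_def epstein_hurwitz_zeta_def)
next
  case False
  let ?I = "\<integral>t. riesz_weight s t * \<phi> t (x - y) \<partial>lborel"
  have neg: "2 * pi powr (real CARD('d) / 2) / (Gamma (s/2) * (real CARD('d) - s))
      = - (2 * pi powr (real CARD('d) / 2) / (Gamma (s/2) * (s - real CARD('d))))"
    by (metis minus_diff_eq minus_divide_right mult_minus_right)
  have ent: "Re (epstein_hurwitz_entire V (x - y) (of_real s)) = ?I"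
    using epstein_hurwitz_entire_real(1)[OF is_epstein_hurwitz_entire[OF False]] entire_function_real[OF False, of s]
    by simp
  show ?thesis
  proof (cases "s = real CARD('d)")
    case True
    show ?thesis
      unfolding periodic_riesz_kernel_eq_integral[OF s False] epstein_hurwitz_regular_def ent
      by (simp only: if_P[OF True] if_not_P[OF False])
  next
    case s_neq: False
    show ?thesis
      using False s_neq s
      by (simp add: periodic_riesz_kernel_eq_integral epstein_hurwitz_zeta_def ent epstein_hurwitz_series_eq neg)
  qed
qed

end

section \<open>The mean value of the kernel\<close>

context unimodular_lattice
begin

text \<open>One term of the direct series as a function on the whole space, so that the series
  becomes its periodization.\<close>

definition tail_gaussian :: "real \<Rightarrow> real^'d \<Rightarrow> ennreal" where
  "tail_gaussian s z = (\<integral>\<^sup>+t. ennreal (indicator {1<..} t * (riesz_weight s t * exp (- (t * (norm z)\<^sup>2)))) \<partial>lborel)"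

definition direct_part :: "real \<Rightarrow> real^'d \<Rightarrow> ennreal" where
  "direct_part s z = (\<Sum>\<^sub>\<infinity>v\<in>L. tail_gaussian s (z + v))"

definition dual_part :: "real \<Rightarrow> real^'d \<Rightarrow> complex" where
  "dual_part s z = (\<Sum>\<^sub>\<infinity>w\<in>D - {0}. of_real (dual_coeff s w) * ch w z)"

lemma measurable_tail_gaussian [measurable]: "tail_gaussian s \<in> borel_measurable borel"
  unfolding tail_gaussian_def by measurable

lemma measurable_direct_part [measurable]: "direct_part s \<in> borel_measurable borel"
  unfolding direct_part_def by (intro borel_measurable_infsum_ennreal countable_L) measurable

lemma riesz_direct_sum_eq_direct_part:
  assumes s: "s > 0"
  shows "riesz_direct_sum V s x y = direct_part s (x - y)"
  unfolding direct_part_def tail_gaussian_def by (rule riesz_direct_sum_eq_infsum[OF assms])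

text \<open>Integrating over space first leaves the power s/2 - d/2 - 1 of t on (1,\<infinity>),
  integrable because s < d.\<close>

lemma nn_integral_tail_gaussian:
  assumes s: "s > 0" and sd: "s < real CARD('d)"
  shows "(\<integral>\<^sup>+z. tail_gaussian s z \<partial>lborel)
    = ennreal (2 * pi powr (real CARD('d) / 2) / (Gamma (s / 2) * (real CARD('d) - s)))"
proof -
  let ?d = "real CARD('d)"
  have G: "Gamma (s / 2) > 0" using s by (intro Gamma_real_pos) auto
  let ?p = "\<lambda>t. indicator {1<..} t * t powr (s / 2 - ?d / 2 - 1)"
  have p: "has_bochner_integral lborel ?p (- 1 / (s / 2 - ?d / 2 - 1 + 1))"
    using sd by (intro powr_integral_1_infinity) auto
  have "(\<integral>\<^sup>+z. tail_gaussian s z \<partial>lborel)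
      = (\<integral>\<^sup>+t. (\<integral>\<^sup>+z. ennreal (indicator {1<..} t * (riesz_weight s t * exp (- (t * (norm (z :: real^'d))\<^sup>2)))) \<partial>lborel) \<partial>lborel)"
    unfolding tail_gaussian_def by (rule lborel_pair.Fubini') measurable
  also have "\<dots> = (\<integral>\<^sup>+t. ennreal (pi powr (?d / 2) / Gamma (s / 2) * ?p t) \<partial>lborel)"
  proof (rule nn_integral_cong)
    fix t :: real
    show "(\<integral>\<^sup>+z. ennreal (indicator {1<..} t * (riesz_weight s t * exp (- (t * (norm (z :: real^'d))\<^sup>2)))) \<partial>lborel)
        = ennreal (pi powr (?d / 2) / Gamma (s / 2) * ?p t)"
    proof (cases "t > 1")
      case True
      have "(\<integral>\<^sup>+z. ennreal (indicator {1<..} t * (riesz_weight s t * exp (- (t * (norm (z :: real^'d))\<^sup>2)))) \<partial>lborel)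
          = (\<integral>\<^sup>+z. ennreal (riesz_weight s t) * ennreal (exp (- (t * (norm (z :: real^'d))\<^sup>2))) \<partial>lborel)"
        using True by (simp add: ennreal_mult' riesz_weight_nonneg[OF s])
      also have "\<dots> = ennreal (riesz_weight s t) * ennreal ((pi / t) powr (?d / 2))"
        using True by (subst nn_integral_cmult) (simp_all add: nn_integral_gaussian)
      also have "\<dots> = ennreal (riesz_weight s t * (pi / t) powr (?d / 2))"
        by (simp add: ennreal_mult riesz_weight_nonneg[OF s])
      also have "riesz_weight s t * (pi / t) powr (?d / 2) = pi powr (?d / 2) / Gamma (s / 2) * ?p t"
        using True by (simp add: riesz_weight_def powr_divide powr_diff mult.commute)
      finally show ?thesis .
    qed simp
  qed
  also have "\<dots> = ennreal (\<integral>t. pi powr (?d / 2) / Gamma (s / 2) * ?p t \<partial>lborel)"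
    using p G by (intro nn_integral_eq_integral) (auto simp: has_bochner_integral_iff)
  also have "(\<integral>t. pi powr (?d / 2) / Gamma (s / 2) * ?p t \<partial>lborel) = pi powr (?d / 2) / Gamma (s / 2) * (- 1 / (s / 2 - ?d / 2 - 1 + 1))"
    using p by (simp add: has_bochner_integral_iff)
  also have "\<dots> = 2 * pi powr (?d / 2) / (Gamma (s / 2) * (?d - s))"
  proof -
    have "- 1 / (s / 2 - ?d / 2 - 1 + 1) = 2 / (?d - s)" using sd by (simp add: field_simps)
    then show ?thesis by simp
  qed
  finally show ?thesis .
qed

lemma nn_integral_direct_part:
  assumes "s > 0" "s < real CARD('d)"
  shows "(\<integral>\<^sup>+x\<in>\<Omega>. direct_part s (x - y) \<partial>lborel)
    = ennreal (2 * pi powr (real CARD('d) / 2) / (Gamma (s / 2) * (real CARD('d) - s)))"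
proof -
  have "(\<integral>\<^sup>+x\<in>\<Omega>. direct_part s (x - y) \<partial>lborel)
      = (\<integral>\<^sup>+x. (\<Sum>\<^sub>\<infinity>v\<in>L. tail_gaussian s (x + v - y) * indicator \<Omega> x) \<partial>lborel)"
  proof (rule nn_integral_cong)
    fix x
    show "direct_part s (x - y) * indicator \<Omega> x = (\<Sum>\<^sub>\<infinity>v\<in>L. tail_gaussian s (x + v - y) * indicator \<Omega> x)"
      by (cases "x \<in> \<Omega>") (simp_all add: direct_part_def algebra_simps)
  qed
  also have "\<dots> = (\<Sum>\<^sub>\<infinity>v\<in>L. \<integral>\<^sup>+x\<in>\<Omega>. tail_gaussian s (x + v - y) \<partial>lborel)"
    by (intro nn_integral_infsum countable_L) measurable
  also have "\<dots> = (\<integral>\<^sup>+x. tail_gaussian s (x - y) \<partial>lborel)"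
    by (rule nn_integral_tiling[symmetric]) measurable
  also have "\<dots> = (\<integral>\<^sup>+x. tail_gaussian s x \<partial>lborel)"
    using nn_integral_lborel_shift[of "tail_gaussian s" "- y"] by simp
  finally show ?thesis using nn_integral_tail_gaussian[OF assms] by simp
qed

lemma norm_dual_part_term: "s > 0 \<Longrightarrow> norm (of_real (dual_coeff s w) * ch w z) = dual_coeff s w"
  by (simp add: norm_mult dual_coeff_nonneg)

lemma continuous_dual_part: "s > 0 \<Longrightarrow> continuous_on UNIV (dual_part s)"
  unfolding dual_part_def
proof (rule uniform_limit_theorem[OF _ Weierstrass_m_test_general])
  assume s: "s > 0"
  show "dual_coeff s summable_on D - {0}" by (rule summable_dual_coeff[OF s])
  show "norm (of_real (dual_coeff s w) * ch w z) \<le> dual_coeff s w" for w z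
    by (simp add: norm_dual_part_term[OF s])
qed (auto intro!: always_eventually continuous_intros)

lemma norm_dual_part_le: "s > 0 \<Longrightarrow> norm (dual_part s z) \<le> (\<Sum>\<^sub>\<infinity>w\<in>D - {0}. dual_coeff s w)"
  unfolding dual_part_def
  using norm_infsum_bound[of "\<lambda>w. of_real (dual_coeff s w) * ch w z" "D - {0}"]
  by (simp add: norm_dual_part_term summable_dual_coeff)

lemma integral_dual_part:
  assumes s: "s > 0"
  shows "(LINT x:\<Omega>|lborel. dual_part s (x - y)) = 0"
proof -
  define f where "f w x = indicator \<Omega> x *\<^sub>R (of_real (dual_coeff s w) * ch w (x - y))" for w x
  have int: "integrable lborel (f w)" for w
    using set_integrable_fundamental_domain[of "\<lambda>x. of_real (dual_coeff s w) * ch w (x - y)"]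
    unfolding f_def set_integrable_def by (simp add: continuous_intros)
  have norm_f: "norm (f w x) = indicator \<Omega> x * dual_coeff s w" for w x
    by (simp add: f_def norm_dual_part_term[OF s] del: norm_mult)
  have "(LINT x:\<Omega>|lborel. dual_part s (x - y)) = (\<integral>x. (\<Sum>\<^sub>\<infinity>w\<in>D - {0}. f w x) \<partial>lborel)"
    unfolding set_lebesgue_integral_def
    by (rule Bochner_Integration.integral_cong) (simp_all add: f_def dual_part_def indicator_def)
  also have "\<dots> = (\<Sum>\<^sub>\<infinity>w\<in>D - {0}. \<integral>x. f w x \<partial>lborel)"
  proof (rule integral_infsum[OF lborel.sigma_finite_measure_axioms])
    show "countable (D - {0})" using countable_D by simp
    show "(\<lambda>w. norm (f w x)) summable_on D - {0}" for x
      unfolding norm_f by (intro summable_on_cmult_right summable_dual_coeff s)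
    have "(\<lambda>w. \<integral>x. norm (f w x) \<partial>lborel) = dual_coeff s"
      by (rule ext) (simp add: norm_f measure_def emeasure_fundamental_domain)
    then show "(\<lambda>w. \<integral>x. norm (f w x) \<partial>lborel) summable_on D - {0}"
      by (simp add: summable_dual_coeff[OF s])
  qed (rule int)
  also have "\<dots> = (\<Sum>\<^sub>\<infinity>w\<in>D - {0}. 0)"
  proof (rule infsum_cong)
    fix w assume w: "w \<in> D - {0}"
    have "f w = (\<lambda>x. of_real (dual_coeff s w) * ch w (- y) * (indicator \<Omega> x *\<^sub>R ch w x))"
      by (simp add: f_def fun_eq_iff diff_conv_add_uminus ch_add_right del: add_uminus_conv_diff)
    then have "(\<integral>x. f w x \<partial>lborel) = of_real (dual_coeff s w) * ch w (- y) * (LINT x:\<Omega>|lborel. ch w x)"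
      by (simp only: set_lebesgue_integral_def integral_mult_right_zero)
    then show "(\<integral>x. f w x \<partial>lborel) = 0"
      using w integral_ch[of w] by simp
  qed
  finally show ?thesis by simp
qed

definition finite_dual_part :: "real \<Rightarrow> real^'d \<Rightarrow> real" where
  "finite_dual_part s z = (if direct_part s z = \<infinity> then 0 else Re (dual_part s z))"

lemma measurable_finite_dual_part [measurable]:
  assumes "s > 0"
  shows "finite_dual_part s \<in> borel_measurable borel"
proof -
  have [measurable]: "dual_part s \<in> borel_measurable borel"
    by (intro borel_measurable_continuous_onI continuous_dual_part assms)
  show ?thesis unfolding finite_dual_part_def by measurable
qed

text \<open>On the lattice the kernel is infinite and \<^const>\<open>real_of_ereal\<close> returns \<open>0\<close>, as does
  \<^const>\<open>enn2real\<close>; hence the cut-off in \<open>finite_dual_part\<close>.\<close>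

lemma real_kernel_eq:
  assumes "s > 0"
  shows "real_of_ereal (periodic_riesz_kernel V s x y)
    = enn2real (direct_part s (x - y)) + finite_dual_part s (x - y)"
  unfolding periodic_riesz_kernel_def riesz_direct_sum_eq_direct_part[OF assms]
    riesz_dual_sum_eq[OF assms] dual_part_def[symmetric] finite_dual_part_def
  by (cases "direct_part s (x - y)") (simp_all add: enn2ereal_ennreal)

lemma abs_finite_dual_part_le: "s > 0 \<Longrightarrow> \<bar>finite_dual_part s z\<bar> \<le> (\<Sum>\<^sub>\<infinity>w\<in>D - {0}. dual_coeff s w)"
  using norm_dual_part_le[of s z] abs_Re_le_cmod[of "dual_part s z"] order_trans[OF norm_ge_zero norm_dual_part_le[of s z]]
  by (auto simp: finite_dual_part_def)

text \<open>The integral over \<open>x\<close> alone already has the asserted value, for each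
  \<open>y\<close>: the direct part contributes all of it and the dual part nothing.\<close>

lemma kernel_integral:
  assumes s: "s > 0" and sd: "s < real CARD('d)"
  shows "(LINT x:\<Omega>|lborel. real_of_ereal (periodic_riesz_kernel V s x y))
    = 2 * pi powr (real CARD('d) / 2) / (Gamma (s / 2) * (real CARD('d) - s))" (is "_ = ?c")
proof -
  note [measurable] = measurable_finite_dual_part[OF s]
  have c: "?c \<ge> 0" using s sd by (simp add: Gamma_real_nonneg)
  let ?F = "\<lambda>x. direct_part s (x - y) * indicator \<Omega> x"
  \<comment> \<open>A finite integral makes the direct part finite almost everywhere, so
    \<open>enn2real\<close> and the cut-off change only a null set.\<close>
  have fin: "AE x in lborel. ?F x \<noteq> \<infinity>"
    by (rule nn_integral_noteq_infinite) (simp_all add: nn_integral_direct_part[OF s sd])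
  have "(\<integral>\<^sup>+x. ennreal (enn2real (?F x)) \<partial>lborel) = (\<integral>\<^sup>+x. ?F x \<partial>lborel)"
    by (rule nn_integral_cong_AE) (use fin in \<open>eventually_elim, auto simp: less_top\<close>)
  then have direct: "has_bochner_integral lborel (\<lambda>x. enn2real (?F x)) ?c"
    by (intro has_bochner_integral_nn_integral) (use c in \<open>auto simp: nn_integral_direct_part[OF s sd]\<close>)
  have "integrable lborel (\<lambda>x. indicator \<Omega> x *\<^sub>R dual_part s (x - y))"
    using set_integrable_fundamental_domain[OF continuous_on_compose2[OF continuous_dual_part[OF s], of UNIV "\<lambda>x. x - y"]]
    by (simp add: set_integrable_def continuous_intros)
  from integrable_Re[OF this] integral_Re[OF this]
  have dual': "has_bochner_integral lborel (\<lambda>x. Re (indicator \<Omega> x *\<^sub>R dual_part s (x - y))) 0"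
    using integral_dual_part[OF s, of y] unfolding set_lebesgue_integral_def has_bochner_integral_iff
    by (simp only: zero_complex.sel)
  have "AE x in lborel. Re (indicator \<Omega> x *\<^sub>R dual_part s (x - y)) = indicator \<Omega> x * finite_dual_part s (x - y)"
    using fin by eventually_elim (auto simp: finite_dual_part_def indicator_def split: if_splits)
  then have "has_bochner_integral lborel (\<lambda>x. indicator \<Omega> x * finite_dual_part s (x - y)) 0"
    using dual' by (subst has_bochner_integral_cong_AE[symmetric]) (auto intro: borel_measurable_has_bochner_integral)
  from has_bochner_integral_add[OF direct this]
  have "has_bochner_integral lborel (\<lambda>x. indicator \<Omega> x *\<^sub>R real_of_ereal (periodic_riesz_kernel V s x y)) (?c + 0)"
    by (rule has_bochner_integral_cong[THEN iffD1, rotated 3])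
       (auto simp: real_kernel_eq[OF s] indicator_def)
  then show ?thesis by (simp add: has_bochner_integral_iff set_lebesgue_integral_def)
qed

text \<open>Guarantees that the iterated integral is a genuine double integral. The absolute value
  is at most the direct part plus the constant \<open>?A\<close>, and Tonelli bounds the total by
  \<open>?c + ?A\<close>.\<close>

lemma kernel_integrable:
  assumes s: "s > 0" and sd: "s < real CARD('d)"
  shows "set_integrable lborel (\<Omega> \<times> \<Omega>) (\<lambda>(x, y). real_of_ereal (periodic_riesz_kernel V s x y))"
proof -
  note [measurable] = measurable_finite_dual_part[OF s]
  let ?c = "2 * pi powr (real CARD('d) / 2) / (Gamma (s / 2) * (real CARD('d) - s))"
  let ?A = "\<Sum>\<^sub>\<infinity>w\<in>D - {0}. dual_coeff s w"
  let ?k = "\<lambda>x y. indicator \<Omega> x * indicator \<Omega> y * (enn2real (direct_part s (x - y)) + finite_dual_part s (x - y))"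
  have A: "?A \<ge> 0" by (intro infsum_nonneg dual_coeff_nonneg s)
  have le: "ennreal (norm (?k x y)) \<le> indicator \<Omega> y * ((direct_part s (x - y) * indicator \<Omega> x) + ennreal ?A * indicator \<Omega> x)" for x y
  proof (cases "direct_part s (x - y)")
    case (real r)
    have "\<bar>r + finite_dual_part s (x - y)\<bar> \<le> r + ?A"
      using abs_finite_dual_part_le[OF s, of "x - y"] real(1) by linarith
    from ennreal_leI[OF this] show ?thesis
      using real A by (auto simp: indicator_def)
  qed (auto simp: finite_dual_part_def)
  have "integrable (lborel \<Otimes>\<^sub>M lborel) (\<lambda>(x, y). ?k x y)"
  proof (rule integrableI_bounded)
    have "(\<integral>\<^sup>+p. ennreal (norm (case p of (x, y) \<Rightarrow> ?k x y)) \<partial>(lborel \<Otimes>\<^sub>M lborel))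
        \<le> (\<integral>\<^sup>+p. (case p of (x, y) \<Rightarrow> indicator \<Omega> y * ((direct_part s (x - y) * indicator \<Omega> x) + ennreal ?A * indicator \<Omega> x)) \<partial>(lborel \<Otimes>\<^sub>M lborel))"
      by (rule nn_integral_mono) (use le in auto)
    also have "\<dots> = (\<integral>\<^sup>+y. (\<integral>\<^sup>+x. indicator \<Omega> y * ((direct_part s (x - y) * indicator \<Omega> x) + ennreal ?A * indicator \<Omega> x) \<partial>lborel) \<partial>lborel)"
      by (subst lborel_pair.nn_integral_snd[symmetric]) simp_all
    also have "\<dots> = (\<integral>\<^sup>+y. indicator \<Omega> y * (ennreal ?c + ennreal ?A) \<partial>lborel)"
    proof (rule nn_integral_cong)
      fix y
      show "(\<integral>\<^sup>+x. indicator \<Omega> y * ((direct_part s (x - y) * indicator \<Omega> x) + ennreal ?A * indicator \<Omega> x) \<partial>lborel)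
          = indicator \<Omega> y * (ennreal ?c + ennreal ?A)"
        by (simp add: nn_integral_cmult nn_integral_add nn_integral_direct_part[OF s sd] emeasure_fundamental_domain)
    qed
    also have "\<dots> = ennreal ?c + ennreal ?A"
      by (simp add: nn_integral_multc emeasure_fundamental_domain)
    also have "\<dots> < \<infinity>" by simp
    finally show "(\<integral>\<^sup>+p. ennreal (norm (case p of (x, y) \<Rightarrow> ?k x y)) \<partial>(lborel \<Otimes>\<^sub>M lborel)) < \<infinity>" .
  qed measurable
  then show ?thesis
    unfolding set_integrable_def lborel_prod
    by (rule Bochner_Integration.integrable_cong[THEN iffD1, rotated 2])
       (auto simp: real_kernel_eq[OF s] indicator_def)
qed

end

theorem theorem3p1:
  fixes V :: "real^'d^'d" and s :: real
  assumes "det V = 1" and "s > 0"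
  shows "(\<forall>x y. periodic_riesz_kernel V s x y =
            (if s = real CARD('d) then epstein_hurwitz_regular V s (x - y)
             else epstein_hurwitz_zeta V s (x - y) +
               ereal (2 * pi powr (real CARD('d) / 2) / (Gamma (s/2) * (real CARD('d) - s))))) \<and>
         (s < real CARD('d) \<longrightarrow>
            set_integrable lborel (fundamental_domain V \<times> fundamental_domain V)
              (\<lambda>(x, y). real_of_ereal (periodic_riesz_kernel V s x y)) \<and>
            (LINT y:fundamental_domain V|lborel.
               LINT x:fundamental_domain V|lborel.
                 real_of_ereal (periodic_riesz_kernel V s x y)) =
            2 * pi powr (real CARD('d) / 2) / (Gamma (s/2) * (real CARD('d) - s)))"
proof -
  have "invertible V" using assms(1) by (simp add: invertible_det_nz)
  then obtain U where "U ** V = mat 1" "V ** U = mat 1" by (auto simp: invertible_def)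
  then interpret unimodular_lattice V U
    by unfold_locales (use assms(1) in auto)
  \<comment> \<open>The inner integral is constant in \<open>y\<close>, and \<Omega> has volume
    1.\<close>
  have "(LINT y:\<Omega>|lborel. LINT x:\<Omega>|lborel. real_of_ereal (periodic_riesz_kernel V s x y))
      = 2 * pi powr (real CARD('d) / 2) / (Gamma (s/2) * (real CARD('d) - s))" if "s < real CARD('d)"
    unfolding kernel_integral[OF assms(2) that]
    by (simp add: set_lebesgue_integral_def measure_def emeasure_fundamental_domain)
  then show ?thesis
    using kernel_formula[OF assms(2)] kernel_integrable[OF assms(2)] by blast
qed

end
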